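(* For each simplex $T\in\mathbb T_h$ with vertices $\bm x_1,\ldots,\bm x_{d+1}$ and barycentre $\bm x_T$, define $\mu_T:=\int_T|\bm x-\bm x_T|^2\,dx$. Then $$\mu_T=\frac{|T|_d}{(d+1)^2(d+2)}\sum_{1\le i<j\le d+1}|\bm x_i-\bm x_j|^2 .$$ Moreover, for every $g_h\in X_h$, writing $g_T:=g_h|_T\in\mathbb R$ for $T\in\mathbb T_h$, $$\|\bm\sigma_h^M(g_h)-\nabla z_h^c(g_h)\|_{L^2(\Omega)^d}^2=|z_h^{\mathrm{CR}}(g_h)-z_h^c(g_h)|_{H^1(\mathbb T_h)}^2+\frac1{d^2}\sum_{T\in\mathbb T_h}\mu_T|g_T|^2,$$ and $$|z_h^{\mathrm{CR}}(g_h)-z_h^c(g_h)|_{H^1(\mathbb T_h)}^2=|z_h^{\mathrm{CR}}(g_h)|_{H^1(\mathbb T_h)}^2-|z_h^c(g_h)|_{H^1(\Omega)}^2 .$$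
   Context: Let $d\in\{2,3\}$, let $\Omega\subset\mathbb R^d$ be a bounded polyhedral Lipschitz domain, and let $\mathbb T_h$ be a finite conforming triangulation of $\overline\Omega$ into non-degenerate closed $d$-simplices (the intersection of two distinct elements is empty or a common subsimplex); no shape regularity is assumed. $|\cdot|_d$ is $d$-dimensional measure; $(\cdot,\cdot)$ is the $L^2(\Omega)$ inner product (scalar or vector valued). $|v|_{H^1(\Omega)}:=\|\nabla v\|_{L^2(\Omega)^d}$. For elementwise $H^1$ functions $v$, $\nabla_h v$ is the elementwise (broken) gradient and $|v|_{H^1(\mathbb T_h)}:=\|\nabla_h v\|_{L^2(\Omega)^d}$. $X_h$ is the space of functions constant on each $T\in\mathbb T_h$. $V_h^c:=\{v\in H_0^1(\Omega): v|_T \text{ affine } \forall T\in\mathbb T_h\}$. The Crouzeix--Raviart space $V_{h,0}^{\mathrm{CR}}$ consists of the elementwise affine functions $v$ such that $\int_F[\![v]\!]\,ds=0$ for all faces $F$, where $[\![v]\!]$ is the jump across an interior face and the trace of $v$ on a boundary face. For $g_h\in X_h$: $z_h^c(g_h)\in V_h^c$ is the unique solution of $(\nabla z_h^c(g_h),\nabla v_h)=(g_h,v_h)$ for all $v_h\in V_h^c$; $z_h^{\mathrm{CR}}(g_h)\in V_{h,0}^{\mathrm{CR}}$ is the unique solution of $(\nabla_h z_h^{\mathrm{CR}}(g_h),\nabla_h v_h)=(g_h,v_h)$ for all $v_h\in V_{h,0}^{\mathrm{CR}}$; and the Marini flux is defined elementwise by $\bm\sigma_h^M(g_h)|_T:=\nabla_h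 z_h^{\mathrm{CR}}(g_h)|_T-\frac{g_h|_T}{d}(\bm x-\bm x_T)$, with $\bm x_T$ the barycentre of $T$. *)

theory Defs
  imports "HOL-Analysis.Analysis"
begin

section \<open>Lebesgue and Sobolev spaces\<close>

text \<open>Functions are representatives of almost-everywhere classes. Only their values on the
  given set matter, and the complete measure \<^term>\<open>lebesgue\<close> is used so that changing a function
  on a null set never affects measurability.\<close>

definition square_integrable_on ::
  "('a::euclidean_space \<Rightarrow> 'b::euclidean_space) \<Rightarrow> 'a set \<Rightarrow> bool"  (infixr "square'_integrable'_on" 46)
  where "f square_integrable_on U \<longleftrightarrow>
    set_borel_measurable lebesgue U f \<and> set_integrable lebesgue U (\<lambda>x. (norm (f x))\<^sup>2)"

definition L2_inner ::
  "'a::euclidean_space set \<Rightarrow> ('a \<Rightarrow> 'b::euclidean_space) \<Rightarrow> ('a \<Rightarrow> 'b) \<Rightarrow> real"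
  where "L2_inner U f g = (LINT x:U|lebesgue. f x \<bullet> g x)"

definition L2_norm :: "'a::euclidean_space set \<Rightarrow> ('a \<Rightarrow> 'b::euclidean_space) \<Rightarrow> real"
  where "L2_norm U f = sqrt (LINT x:U|lebesgue. (norm (f x))\<^sup>2)"

primrec Ck :: "nat \<Rightarrow> ('a::euclidean_space \<Rightarrow> real) \<Rightarrow> bool" where
  "Ck 0 f \<longleftrightarrow> continuous_on UNIV f"
| "Ck (Suc k) f \<longleftrightarrow> (\<forall>x. f differentiable (at x)) \<and>
     (\<forall>b\<in>Basis. Ck k (\<lambda>x. frechet_derivative f (at x) b))"

definition test_functions :: "'a::euclidean_space set \<Rightarrow> ('a \<Rightarrow> real) set"
  where "test_functions U = {\<phi>. (\<forall>k. Ck k \<phi>) \<and>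
    compact (closure {x. \<phi> x \<noteq> 0}) \<and> closure {x. \<phi> x \<noteq> 0} \<subseteq> U}"

definition classical_grad :: "('a::euclidean_space \<Rightarrow> real) \<Rightarrow> 'a \<Rightarrow> 'a"
  where "classical_grad f x = (\<Sum>b\<in>Basis. frechet_derivative f (at x) b *\<^sub>R b)"

definition has_weak_grad ::
  "'a::euclidean_space set \<Rightarrow> ('a \<Rightarrow> real) \<Rightarrow> ('a \<Rightarrow> 'a) \<Rightarrow> bool"
  where "has_weak_grad U v G \<longleftrightarrow>
    (\<forall>K. compact K \<and> K \<subseteq> U \<longrightarrow> set_integrable lebesgue K v \<and> set_integrable lebesgue K G) \<and>
    (\<forall>\<phi>\<in>test_functions U.
       (LINT x:U|lebesgue. v x *\<^sub>R classical_grad \<phi> x) = - (LINT x:U|lebesgue. \<phi> x *\<^sub>R G x))"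

text \<open>A weak gradient on an open set is unique only up to null sets, so an arbitrary one is
  chosen.\<close>

definition weak_grad :: "'a::euclidean_space set \<Rightarrow> ('a \<Rightarrow> real) \<Rightarrow> 'a \<Rightarrow> 'a"
  where "weak_grad U v = (SOME G. has_weak_grad U v G)"

definition sobolev_H1 :: "'a::euclidean_space set \<Rightarrow> ('a \<Rightarrow> real) set"
  where "sobolev_H1 U = {v. v square_integrable_on U \<and>
    (\<exists>G. has_weak_grad U v G \<and> G square_integrable_on U)}"

definition H1_seminorm :: "'a::euclidean_space set \<Rightarrow> ('a \<Rightarrow> real) \<Rightarrow> real"
  where "H1_seminorm U v = L2_norm U (weak_grad U v)"

definition H1_norm :: "'a::euclidean_space set \<Rightarrow> ('a \<Rightarrow> real) \<Rightarrow> real"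
  where "H1_norm U v = sqrt ((L2_norm U v)\<^sup>2 + (H1_seminorm U v)\<^sup>2)"

definition sobolev_H10 :: "'a::euclidean_space set \<Rightarrow> ('a \<Rightarrow> real) set"
  where "sobolev_H10 U = {v \<in> sobolev_H1 U.
    \<exists>\<phi>::nat \<Rightarrow> 'a \<Rightarrow> real. (\<forall>n. \<phi> n \<in> test_functions U) \<and>
      (\<lambda>n. H1_norm U (\<lambda>x. \<phi> n x - v x)) \<longlonglongrightarrow> 0}"

section \<open>Domain and mesh\<close>

text \<open>Near each boundary point the set is, in suitable orthonormal coordinates with last axis
  \<open>e\<close>, the strict epigraph of a Lipschitz function of the remaining coordinates; the hyperplane
  orthogonal to \<open>e\<close> plays the role of the space of these coordinates.\<close>

definition lipschitz_boundary :: "'a::euclidean_space set \<Rightarrow> bool"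
  where "lipschitz_boundary \<Omega> \<longleftrightarrow>
    (\<forall>p\<in>frontier \<Omega>. \<exists>e \<gamma> L r. norm e = 1 \<and> 0 < r \<and> L-lipschitz_on {y. y \<bullet> e = 0} \<gamma> \<and>
       \<Omega> \<inter> ball p r = {x \<in> ball p r. \<gamma> (x - (x \<bullet> e) *\<^sub>R e) < x \<bullet> e})"

definition polyhedral_lipschitz_domain :: "'a::euclidean_space set \<Rightarrow> bool"
  where "polyhedral_lipschitz_domain \<Omega> \<longleftrightarrow>
    open \<Omega> \<and> connected \<Omega> \<and> \<Omega> \<noteq> {} \<and> bounded \<Omega> \<and> lipschitz_boundary \<Omega> \<and>
    (\<exists>\<P>. finite \<P> \<and> (\<forall>P\<in>\<P>. polytope P) \<and> closure \<Omega> = \<Union>\<P>)"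

text \<open>\<^const>\<open>triangulation\<close> demands that any two elements meet in a (possibly empty) face of
  both.\<close>

definition conforming_triangulation :: "'a::euclidean_space set \<Rightarrow> 'a set set \<Rightarrow> bool"
  where "conforming_triangulation \<Omega> \<T> \<longleftrightarrow>
    triangulation \<T> \<and> (\<forall>T\<in>\<T>. int DIM('a) simplex T) \<and> \<Union>\<T> = closure \<Omega>"

definition vertices :: "'a::euclidean_space set \<Rightarrow> 'a set"
  where "vertices T = {p. p extreme_point_of T}"

definition barycentre :: "'a::euclidean_space set \<Rightarrow> 'a"
  where "barycentre T = (\<Sum>p\<in>vertices T. p) /\<^sub>R real (card (vertices T))"

definition second_moment :: "'a::euclidean_space set \<Rightarrow> real"
  where "second_moment T = (LINT x:T|lebesgue. (norm (x - barycentre T))\<^sup>2)"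

section \<open>Discrete spaces\<close>

text \<open>Neighbouring closed elements overlap in faces, where an elementwise function is two-valued.
  Since faces are null sets, elementwise properties are imposed on the element interiors and values
  on the mesh skeleton are irrelevant.\<close>

definition piecewise_constant :: "'a::euclidean_space set set \<Rightarrow> ('a \<Rightarrow> real) set"
  where "piecewise_constant \<T> = {g. \<forall>T\<in>\<T>. \<exists>c. \<forall>x\<in>interior T. g x = c}"

definition elem_value :: "('a::euclidean_space \<Rightarrow> real) \<Rightarrow> 'a set \<Rightarrow> real"
  where "elem_value g T = (THE c. \<forall>x\<in>interior T. g x = c)"

definition piecewise_affine :: "'a::euclidean_space set set \<Rightarrow> ('a \<Rightarrow> real) set"
  where "piecewise_affine \<T> = {v. \<forall>T\<in>\<T>. \<exists>a c. \<forall>x\<in>interior T. v x = a \<bullet> x + c}"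

definition broken_grad :: "'a::euclidean_space set set \<Rightarrow> ('a \<Rightarrow> real) \<Rightarrow> 'a \<Rightarrow> 'a"
  where "broken_grad \<T> v x = (\<Sum>T\<in>\<T>. indicat_real (interior T) x *\<^sub>R weak_grad (interior T) v x)"

definition broken_H1_seminorm ::
  "'a::euclidean_space set \<Rightarrow> 'a set set \<Rightarrow> ('a \<Rightarrow> real) \<Rightarrow> real"
  where "broken_H1_seminorm \<Omega> \<T> v = L2_norm \<Omega> (broken_grad \<T> v)"

definition conforming_space :: "'a::euclidean_space set \<Rightarrow> 'a set set \<Rightarrow> ('a \<Rightarrow> real) set"
  where "conforming_space \<Omega> \<T> = sobolev_H10 \<Omega> \<inter> piecewise_affine \<T>"

text \<open>The one-sided trace: for piecewise affine \<open>v\<close> the limit from inside \<open>T\<close> is the value of the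
  affine extension of \<open>v\<close> from the interior of \<open>T\<close> to the closed simplex.\<close>

definition elem_trace :: "'a::euclidean_space set \<Rightarrow> ('a \<Rightarrow> real) \<Rightarrow> 'a \<Rightarrow> real"
  where "elem_trace T v x = Lim (at x within interior T) v"

definition unit_normal :: "'a::euclidean_space set \<Rightarrow> 'a"
  where "unit_normal F = (SOME n. norm n = 1 \<and> (\<forall>x\<in>F. \<forall>y\<in>F. n \<bullet> (x - y) = 0))"

text \<open>The surface integral over a flat set \<open>F\<close> of codimension one. By Fubini it equals the volume
  integral, over the right prism of height one with base \<open>F\<close>, of the function extended constantly
  in the normal direction; the nearest point of the affine hull of \<open>F\<close> is the orthogonal
  projection. The value does not depend on the sign of the normal.\<close>

definition face_integral :: "'a::euclidean_space set \<Rightarrow> ('a \<Rightarrow> real) \<Rightarrow> real"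
  where "face_integral F f =
    (LINT x:{y + t *\<^sub>R unit_normal F | y t. y \<in> F \<and> t \<in> {0..1}}|lebesgue.
       f (closest_point (affine hull F) x))"

text \<open>The jump across an interior face is defined up to sign, which is irrelevant here: both
  orderings of the two adjacent elements are covered.\<close>

definition CR_space :: "'a::euclidean_space set \<Rightarrow> 'a set set \<Rightarrow> ('a \<Rightarrow> real) set"
  where "CR_space \<Omega> \<T> = {v \<in> piecewise_affine \<T>.
    (\<forall>T\<in>\<T>. \<forall>T'\<in>\<T>. \<forall>F. T \<noteq> T' \<and> F facet_of T \<and> F facet_of T' \<longrightarrow>
       face_integral F (\<lambda>x. elem_trace T v x - elem_trace T' v x) = 0) \<and>
    (\<forall>T\<in>\<T>. \<forall>F. F facet_of T \<and> F \<subseteq> frontier \<Omega> \<longrightarrow>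
       face_integral F (elem_trace T v) = 0)}"

section \<open>Discrete solutions and the Marini flux\<close>

definition is_conforming_solution ::
  "'a::euclidean_space set \<Rightarrow> 'a set set \<Rightarrow> ('a \<Rightarrow> real) \<Rightarrow> ('a \<Rightarrow> real) \<Rightarrow> bool"
  where "is_conforming_solution \<Omega> \<T> g z \<longleftrightarrow> z \<in> conforming_space \<Omega> \<T> \<and>
    (\<forall>v\<in>conforming_space \<Omega> \<T>. L2_inner \<Omega> (weak_grad \<Omega> z) (weak_grad \<Omega> v) = L2_inner \<Omega> g v)"

definition is_CR_solution ::
  "'a::euclidean_space set \<Rightarrow> 'a set set \<Rightarrow> ('a \<Rightarrow> real) \<Rightarrow> ('a \<Rightarrow> real) \<Rightarrow> bool"
  where "is_CR_solution \<Omega> \<T> g z \<longleftrightarrow> z \<in> CR_space \<Omega> \<T> \<and>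
    (\<forall>v\<in>CR_space \<Omega> \<T>. L2_inner \<Omega> (broken_grad \<T> z) (broken_grad \<T> v) = L2_inner \<Omega> g v)"

text \<open>Here \<open>z\<close> stands for the Crouzeix--Raviart solution with right-hand side \<open>g\<close>.\<close>

definition marini_flux ::
  "'a::euclidean_space set set \<Rightarrow> ('a \<Rightarrow> real) \<Rightarrow> ('a \<Rightarrow> real) \<Rightarrow> 'a \<Rightarrow> 'a"
  where "marini_flux \<T> g z x = (\<Sum>T\<in>\<T>. indicat_real (interior T) x *\<^sub>R
    (broken_grad \<T> z x - (elem_value g T / real DIM('a)) *\<^sub>R (x - barycentre T)))"

end

theory Submission
  imports Defs
begin

text \<open>On each simplex, the first and second moments of the barycentric coordinates follow from symmetry:
  exchanging two vertices preserves the simplex and its volume, and cutting it by the bisector of an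
  edge gives two affine copies of it, which relates the mixed second moments to the pure ones.

  Elementwise, the flux minus \<open>\<nabla> z_h^c\<close> is a constant plus a multiple of \<open>x - x_T\<close>, and the latter is
  orthogonal to constants; this is the first identity. The second is Galerkin orthogonality: it
  suffices that \<open>V_h^c\<close> is contained in the Crouzeix--Raviart space. For that, the extension by zero of a
  function in \<open>H_0^1\<close> has a weak gradient on the whole space, so that an elementwise affine function
  cannot jump across a facet, be it between two elements or between an element and the exterior.\<close>

section \<open>Linear images of Lebesgue measure\<close>

text \<open>Three obstacles shape the argument. First, no determinant is computed: the change of
  variables comes with an unknown factor, which the constant integrand then fixes, to 1 for the
  exchange of two vertices and to 2 for the halving. Second, \<open>weak_grad\<close> is an
  arbitrary choice, so its values are unknown until weak gradients are shown to be unique almost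
  everywhere; this takes smooth bumps approximating boxes and Lebesgue differentiation. Third,
  membership in \<open>sobolev_H10\<close> speaks of limits of test functions and offers no trace.
  The zero extension turns it into a property of jumps, and a jump is excluded by moving a bump
  across the hyperplane rather than by integrating by parts on half-balls. The extension cannot see
  values on a slit, which is a null set with the domain on both sides; the Lipschitz boundary rules
  slits out, through \<open>interior_closure_lipschitz\<close>.\<close>

lemma translation_invariant_eq_lborel:
  fixes \<mu> :: "'a::euclidean_space measure"
  assumes "sigma_finite_measure \<mu>" and sets: "sets \<mu> = sets borel"
    and inv: "\<And>a. distr \<mu> borel ((+) a) = \<mu>"
    and A: "A \<in> sets borel"
  shows "emeasure \<mu> A = emeasure \<mu> (uminus -` cbox 0 One) * emeasure lborel A"
proof -
  interpret M: sigma_finite_measure \<mu> by fact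
  interpret P: pair_sigma_finite lborel \<mu>
    by (simp add: M.sigma_finite_measure_axioms lborel.sigma_finite_measure_axioms pair_sigma_finite_def)
  note sets[measurable_cong] A[measurable]
  define h where "h = (indicator (cbox 0 One) :: 'a \<Rightarrow> ennreal)"
  have h[measurable]: "h \<in> borel_measurable borel" unfolding h_def by measurable
  have shift: "(\<integral>\<^sup>+x. u (a + x) \<partial>\<mu>) = (\<integral>\<^sup>+x. u x \<partial>\<mu>)" if [measurable]: "u \<in> borel_measurable borel"
    for u :: "'a \<Rightarrow> ennreal" and a
    by (subst (2) inv[of a, symmetric]) (simp add: nn_integral_distr)
  have shiftl: "(\<integral>\<^sup>+x. u (x + a) \<partial>lborel) = (\<integral>\<^sup>+x. u x \<partial>lborel)" if [measurable]: "u \<in> borel_measurable borel"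
    for u :: "'a \<Rightarrow> ennreal" and a
    by (subst (2) lborel_distr_plus[of a, symmetric]) (simp add: nn_integral_distr add.commute)
  have h1: "(\<integral>\<^sup>+y. h y \<partial>lborel) = 1" by (simp add: h_def emeasure_lborel_cbox_eq)
  \<comment> \<open>Uniqueness of Haar measure by Fubini: \<open>h\<close> has integral 1 for
    \<open>lborel\<close>, the invariance of \<mu> introduces the shift in the indicator of
    \<open>A\<close>, and that of \<open>lborel\<close> moves the shift onto \<open>h\<close>. What
    remains of \<mu> is the integral of \<open>h (- x)\<close>, whence the reflected unit cube in
    the constant.\<close>
  have "emeasure \<mu> A = (\<integral>\<^sup>+y. h y * emeasure \<mu> A \<partial>lborel)"
    by (simp add: nn_integral_multc h1)
  also have "\<dots> = (\<integral>\<^sup>+y. (\<integral>\<^sup>+x. h y * indicator A (y + x) \<partial>\<mu>) \<partial>lborel)"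
  proof (rule nn_integral_cong)
    fix y
    have "(\<integral>\<^sup>+x. h y * indicator A (y + x) \<partial>\<mu>) = h y * (\<integral>\<^sup>+x. indicator A (y + x) \<partial>\<mu>)"
      by (intro nn_integral_cmult) measurable
    also have "(\<integral>\<^sup>+x. indicator A (y + x) \<partial>\<mu>) = (\<integral>\<^sup>+x. indicator A x \<partial>\<mu>)"
      by (rule shift) measurable
    finally show "h y * emeasure \<mu> A = (\<integral>\<^sup>+x. h y * indicator A (y + x) \<partial>\<mu>)" 
      by simp
  qed
  also have "\<dots> = (\<integral>\<^sup>+x. (\<integral>\<^sup>+y. h y * indicator A (y + x) \<partial>lborel) \<partial>\<mu>)"
    by (rule P.Fubini'[symmetric]) measurable
  also have "\<dots> = (\<integral>\<^sup>+x. (\<integral>\<^sup>+y. h (y - x) * indicator A y \<partial>lborel) \<partial>\<mu>)"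
  proof (rule nn_integral_cong)
    fix x
    show "(\<integral>\<^sup>+y. h y * indicator A (y + x) \<partial>lborel) = (\<integral>\<^sup>+y. h (y - x) * indicator A y \<partial>lborel)"
      using shiftl[of "\<lambda>y. h (y - x) * indicator A y" x] by simp
  qed
  also have "\<dots> = (\<integral>\<^sup>+y. (\<integral>\<^sup>+x. h (y - x) * indicator A y \<partial>\<mu>) \<partial>lborel)"
    by (rule P.Fubini') measurable
  also have "\<dots> = (\<integral>\<^sup>+y. (\<integral>\<^sup>+x. h (- x) \<partial>\<mu>) * indicator A y \<partial>lborel)"
  proof (rule nn_integral_cong)
    fix y
    have "(\<integral>\<^sup>+x. h (y - x) * indicator A y \<partial>\<mu>) = (\<integral>\<^sup>+x. h (y - x) \<partial>\<mu>) * indicator A y"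
      by (intro nn_integral_multc) measurable
    also have "(\<integral>\<^sup>+x. h (y - x) \<partial>\<mu>) = (\<integral>\<^sup>+x. h (- x) \<partial>\<mu>)"
      using shift[of "\<lambda>x. h (y - x)" y] by simp
    finally show "(\<integral>\<^sup>+x. h (y - x) * indicator A y \<partial>\<mu>) = (\<integral>\<^sup>+x. h (- x) \<partial>\<mu>) * indicator A y" by simp
  qed
  also have "\<dots> = (\<integral>\<^sup>+x. h (- x) \<partial>\<mu>) * emeasure lborel A"
    by (simp add: nn_integral_cmult)
  also have "(\<integral>\<^sup>+x. h (- x) \<partial>\<mu>) = (\<integral>\<^sup>+x. indicator (uminus -` cbox 0 One) x \<partial>\<mu>)"
    by (intro nn_integral_cong) (auto simp: h_def indicator_def)
  also have "\<dots> = emeasure \<mu> (uminus -` cbox 0 One)"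
    by (rule nn_integral_indicator) (auto simp: sets intro!: measurable_sets_borel[of uminus borel])
  finally show ?thesis .
qed

text \<open>The image of \<open>lborel\<close> under \<open>L\<close> is again translation
  invariant, since every translation vector is \<open>L s\<close> for some \<open>s\<close>; so it
  is a multiple of \<open>lborel\<close>. The factor \<open>c\<close> is left unidentified: the
  applications determine it from a known volume. The offset \<open>t\<close> makes the rule serve
  affine maps.\<close>

lemma lborel_integral_linear_bij:
  fixes L :: "'a::euclidean_space \<Rightarrow> 'a"
  assumes L: "linear L" "bij L"
  obtains c :: real where "0 \<le> c"
    "\<And>(u :: 'a \<Rightarrow> real) t. u \<in> borel_measurable borel \<Longrightarrow> (LINT x|lborel. u (L x + t)) = c * (LINT x|lborel. u x)"
proof -
  define \<mu> where "\<mu> = distr lborel borel L"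
  have cL: "continuous_on UNIV L" using L(1) by (simp add: linear_continuous_on linear_conv_bounded_linear)
  then have [measurable]: "L \<in> borel_measurable borel" by (rule borel_measurable_continuous_onI)
  have sets: "sets \<mu> = sets borel" by (simp add: \<mu>_def)
  have shift: "distr lborel borel (\<lambda>x. L x + t) = \<mu>" for t
  proof -
    obtain s where s: "t = L s" using L(2) by (metis bij_pointE)
    have "distr lborel borel (\<lambda>x. L x + t) = distr lborel borel (L \<circ> (+) s)"
      by (intro distr_cong) (auto simp: s linear_add[OF L(1)])
    also have "\<dots> = distr (distr lborel borel ((+) s)) borel L" 
      by (rule distr_distr[symmetric]) measurable
    also have "\<dots> = \<mu>" by (simp add: lborel_distr_plus \<mu>_def)
    finally show ?thesis .
  qed
  have inv: "distr \<mu> borel ((+) a) = \<mu>" for a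
  proof -
    have "distr \<mu> borel ((+) a) = distr lborel borel (\<lambda>x. L x + a)"
      unfolding \<mu>_def by (subst distr_distr) (auto simp: comp_def add.commute)
    then show ?thesis by (simp add: shift)
  qed
  \<comment> \<open>Finiteness on bounded sets gives both sigma-finiteness and a finite constant
    \<open>c\<close>; it holds because preimages under \<open>L\<close> are images under its linear
    inverse.\<close>
  have fin: "emeasure \<mu> B < \<infinity>" if "bounded B" "B \<in> sets borel" for B
  proof -
    have li: "linear (inv L)" using L by (simp add: bij_betw_def linear_injective_left_inverse inj_linear_imp_inv_linear)
    have "L -` B = inv L ` B" using L(2) by (simp add: bij_vimage_eq_inv_image)
    then have "bounded (L -` B)" using bounded_linear_image[OF that(1)] li 
      by (simp add: linear_conv_bounded_linear)
    from emeasure_bounded_finite[OF this] show ?thesis using that(2) by (simp add: \<mu>_def emeasure_distr)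
  qed
  have sf: "sigma_finite_measure \<mu>"
  proof
    show "\<exists>A. countable A \<and> A \<subseteq> sets \<mu> \<and> \<Union> A = space \<mu> \<and> (\<forall>a\<in>A. emeasure \<mu> a \<noteq> \<infinity>)"
    proof (intro exI conjI ballI)
      show "countable (range (\<lambda>n::nat. ball (0::'a) (real n)))" by simp
      show "range (\<lambda>n::nat. ball (0::'a) (real n)) \<subseteq> sets \<mu>" by (auto simp: sets)
      show "\<Union> (range (\<lambda>n::nat. ball (0::'a) (real n))) = space \<mu>" by (auto simp: \<mu>_def reals_Archimedean2)
      show "emeasure \<mu> a \<noteq> \<infinity>" if "a \<in> range (\<lambda>n::nat. ball (0::'a) (real n))" for a 
        using that fin[of a] by fastforce
    qed
  qed
  have Q: "uminus -` cbox 0 (One::'a) = cbox (- One) 0"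
    by (auto simp: mem_box inner_simps) 
  define c where "c = measure \<mu> (cbox (- One) (0::'a))"
  have c: "emeasure \<mu> A = ennreal c * emeasure lborel A" if "A \<in> sets borel" for A
    using translation_invariant_eq_lborel[OF sf sets inv that] fin[of "cbox (- One) 0"]
    unfolding Q c_def by (simp add: emeasure_eq_ennreal_measure)
  have mu: "\<mu> = density lborel (\<lambda>_. ennreal c)"
    by (rule measure_eqI) (auto simp: sets emeasure_density c nn_integral_cmult)
  show ?thesis
  proof (rule that)
    show "0 \<le> c" by (simp add: c_def)
    fix u :: "'a \<Rightarrow> real" and t assume [measurable]: "u \<in> borel_measurable borel"
    have "(LINT x|lborel. u (L x + t)) = (LINT x|distr lborel borel (\<lambda>x. L x + t). u x)"
      by (subst integral_distr) auto
    also have "\<dots> = c * (LINT x|lborel. u x)"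
      unfolding shift mu by (subst integral_density) (auto simp: c_def)
    finally show "(LINT x|lborel. u (L x + t)) = c * (LINT x|lborel. u x)" .
  qed
qed

section \<open>Moments of a simplex\<close>

text \<open>Coefficients are chosen for every point of the space, not only for points of the
  simplex, so that each coordinate becomes a globally affine function; only vertices
  \<open>v\<close> in \<open>V\<close> are meaningful arguments.\<close>

definition bary_coord :: "'a::euclidean_space set \<Rightarrow> 'a \<Rightarrow> 'a \<Rightarrow> real"
  where "bary_coord V v x = (SOME u. sum u V = 1 \<and> (\<Sum>w\<in>V. u w *\<^sub>R w) = x) v"

locale simplex_vertices =
  fixes V :: "'a::euclidean_space set"
  assumes indep: "\<not> affine_dependent V" and card_V: "card V = Suc DIM('a)"
begin

lemma finite_V: "finite V" using card_V card.infinite by fastforce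

abbreviation lam where "lam \<equiv> bary_coord V"

definition T where "T = convex hull V"

lemma lam_props: "(\<Sum>v\<in>V. lam v x) = 1 \<and> (\<Sum>v\<in>V. lam v x *\<^sub>R v) = x"
proof -
  have "x \<in> affine hull V"
    using affine_independent_span_eq[OF indep] card_V by simp
  then have "\<exists>u. sum u V = 1 \<and> (\<Sum>w\<in>V. u w *\<^sub>R w) = x"
    unfolding affine_hull_finite[OF finite_V] by auto
  from someI_ex[OF this] show ?thesis unfolding bary_coord_def .
qed

lemmas sum_lam = lam_props[THEN conjunct1] and sum_lam_scaleR = lam_props[THEN conjunct2]

text \<open>Two coefficient families for the same point would differ by an affine dependence of the
  vertices.\<close>

lemma lam_unique:
  assumes "sum u V = 1" "(\<Sum>w\<in>V. u w *\<^sub>R w) = x" "v \<in> V"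
  shows "lam v x = u v"
proof (rule ccontr)
  assume "lam v x \<noteq> u v"
  moreover have "(\<Sum>v\<in>V. lam v x - u v) = 0" by (simp add: sum_subtractf sum_lam assms)
  moreover have "(\<Sum>v\<in>V. (lam v x - u v) *\<^sub>R v) = 0"
    by (simp add: scaleR_left_diff_distrib sum_subtractf sum_lam_scaleR assms)
  ultimately have "affine_dependent V"
    unfolding affine_dependent_explicit_finite[OF finite_V]
    using assms(3) by (intro exI[of _ "\<lambda>v. lam v x - u v"]) auto
  with indep show False by simp
qed

text \<open>The weights may have any sign. Linearity, continuity and the effect of affine maps on
  the coordinates all derive from this rule.\<close>

lemma lam_affine_sum:
  assumes "sum k I = 1" "v \<in> V"
  shows "lam v (\<Sum>i\<in>I. k i *\<^sub>R y i) = (\<Sum>i\<in>I. k i * lam v (y i))"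
proof (rule lam_unique[OF _ _ assms(2)])
  show "(\<Sum>v\<in>V. \<Sum>i\<in>I. k i * lam v (y i)) = 1"
    by (subst sum.swap) (simp add: sum_distrib_left[symmetric] sum_lam assms)
  have "(\<Sum>w\<in>V. (\<Sum>i\<in>I. k i * lam w (y i)) *\<^sub>R w) = (\<Sum>i\<in>I. k i *\<^sub>R (\<Sum>w\<in>V. lam w (y i) *\<^sub>R w))"
    by (simp add: scaleR_sum_left scaleR_sum_right) (rule sum.swap)
  then show "(\<Sum>w\<in>V. (\<Sum>i\<in>I. k i * lam w (y i)) *\<^sub>R w) = (\<Sum>i\<in>I. k i *\<^sub>R y i)"
    by (simp add: sum_lam_scaleR)
qed

lemma lam_vertex:
  assumes "v \<in> V" "w \<in> V" shows "lam v w = (if v = w then 1 else 0)"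
proof (rule lam_unique[OF _ _ assms(1)])
  show "(\<Sum>v\<in>V. if v = w then 1 else 0 :: real) = 1" using assms by (simp add: finite_V)
  have "(\<Sum>v\<in>V. (if v = w then 1 else 0) *\<^sub>R v) = (\<Sum>v\<in>V. if v = w then w else 0)"
    by (rule sum.cong) auto
  then show "(\<Sum>v\<in>V. (if v = w then 1 else 0) *\<^sub>R v) = w" using assms by (simp add: finite_V)
qed

lemma lam_linear: assumes "v \<in> V" shows "linear (\<lambda>x. lam v x - lam v 0)"
proof
  fix x y :: 'a and r :: real
  \<comment> \<open>\<open>x + y\<close> is the affine combination of \<open>x\<close>,
    \<open>y\<close>, 0 with weights 1, 1, -1, and \<open>r *\<^sub>R x\<close> that of
    \<open>x\<close>, 0 with weights \<open>r\<close>, \<open>1 - r\<close>. Indexing by list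
    positions keeps coinciding points apart.\<close>
  have "lam v (\<Sum>i\<in>{0,1,2::nat}. ([1,1,-1] ! i) *\<^sub>R ([x, y, 0] ! i))
    = (\<Sum>i\<in>{0,1,2::nat}. ([1,1,-1] ! i) * lam v ([x, y, 0] ! i))"
    by (rule lam_affine_sum) (auto simp: assms)
  then show "lam v (x + y) - lam v 0 = lam v x - lam v 0 + (lam v y - lam v 0)" by simp
  have "lam v (\<Sum>i\<in>{0,1::nat}. ([r,1-r] ! i) *\<^sub>R ([x, 0] ! i))
    = (\<Sum>i\<in>{0,1::nat}. ([r,1-r] ! i) * lam v ([x, 0] ! i))"
    by (rule lam_affine_sum) (auto simp: assms)
  then show "lam v (r *\<^sub>R x) - lam v 0 = r *\<^sub>R (lam v x - lam v 0)" by (simp add: algebra_simps)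
qed

lemma lam_continuous: assumes "v \<in> V" shows "continuous_on S (lam v)"
proof -
  have "continuous_on S (\<lambda>x. (lam v x - lam v 0) + lam v 0)"
    by (intro continuous_intros linear_continuous_on linear_conv_bounded_linear[THEN iffD1] lam_linear assms)
  then show ?thesis by simp
qed

lemma mem_T: "x \<in> T \<longleftrightarrow> (\<forall>v\<in>V. 0 \<le> lam v x)"
proof
  assume "x \<in> T"
  then obtain u where "\<forall>v\<in>V. 0 \<le> u v" "sum u V = 1" "(\<Sum>v\<in>V. u v *\<^sub>R v) = x"
    unfolding T_def convex_hull_finite[OF finite_V] by auto
  then show "\<forall>v\<in>V. 0 \<le> lam v x" using lam_unique by auto
next
  assume "\<forall>v\<in>V. 0 \<le> lam v x"
  then show "x \<in> T" unfolding T_def convex_hull_finite[OF finite_V]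
    using lam_props[of x] by (auto intro!: exI[of _ "\<lambda>v. lam v x"])
qed

lemma compact_T: "compact T"
  by (simp add: T_def finite_V finite_imp_compact_convex_hull)

lemma T_borel[measurable]: "T \<in> sets borel" using compact_T by (rule borel_compact)

lemma integrable_T:
  assumes "continuous_on UNIV (h :: 'a \<Rightarrow> 'b::euclidean_space)" shows "integrable lborel (\<lambda>x. indicat_real T x *\<^sub>R h x)"
  by (rule borel_integrable_compact[OF compact_T continuous_on_subset[OF assms subset_UNIV]])

text \<open>Needed to cancel the volume when the unknown factor of an affine change of variables is
  determined.\<close>

lemma measure_T_pos: "0 < measure lborel T"
proof -
  have "interior T \<noteq> {}" unfolding T_def
    using affine_independent_span_eq[OF indep] card_V
    by (metis T_def affine_hull_convex_hull affine_hull_eq_empty convex_convex_hull empty_not_UNIV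
        rel_interior_eq_empty rel_interior_interior)
  from open_not_negligible[OF open_interior this] have "\<not> negligible T"
    using negligible_subset[OF _ interior_subset[of T]] by metis
  then have "emeasure lborel T \<noteq> 0"
    using T_borel null_sets_completion_iff[of T lborel] negligible_iff_null_sets[of T]
    by (auto simp: null_sets_def)
  then show ?thesis using emeasure_compact_finite[OF compact_T]
    by (simp add: measure_def enn2real_positive_iff zero_less_iff_neq_zero)
qed

text \<open>The affine interpolant of the vertex values \<open>\<sigma>\<close>; affine maps are
  specified and compared through their effect on vertices.\<close>

definition aff :: "('a \<Rightarrow> 'a) \<Rightarrow> 'a \<Rightarrow> 'a" where "aff \<sigma> x = (\<Sum>u\<in>V. lam u x *\<^sub>R \<sigma> u)"

lemma lam_aff: "v \<in> V \<Longrightarrow> lam v (aff \<sigma> x) = (\<Sum>u\<in>V. lam u x * lam v (\<sigma> u))"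
  unfolding aff_def by (rule lam_affine_sum) (auto simp: sum_lam)

lemma aff_aff:
  assumes "\<And>u. u \<in> V \<Longrightarrow> aff \<tau> (\<sigma> u) = u" shows "aff \<tau> (aff \<sigma> x) = x"
proof -
  have "aff \<tau> (aff \<sigma> x) = (\<Sum>v\<in>V. (\<Sum>u\<in>V. lam u x * lam v (\<sigma> u)) *\<^sub>R \<tau> v)"
    unfolding aff_def[of \<tau> "aff \<sigma> x"] by (intro sum.cong refl) (simp add: lam_aff)
  also have "\<dots> = (\<Sum>u\<in>V. lam u x *\<^sub>R aff \<tau> (\<sigma> u))"
    unfolding aff_def[of \<tau> "\<sigma> _"] by (simp add: scaleR_sum_left scaleR_sum_right) (rule sum.swap)
  also have "\<dots> = x" by (simp add: assms sum_lam_scaleR)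
  finally show ?thesis .
qed

text \<open>The two hypotheses make \<open>aff \<tau>\<close> and \<open>aff \<sigma>\<close>
  mutually inverse, by \<open>aff_aff\<close>; subtracting the value at 0 leaves a linear
  bijection.\<close>

lemma lborel_integral_aff:
  assumes 1: "\<And>u. u \<in> V \<Longrightarrow> aff \<tau> (\<sigma> u) = u" and 2: "\<And>u. u \<in> V \<Longrightarrow> aff \<sigma> (\<tau> u) = u"
  obtains c :: real where "0 \<le> c"
    "\<And>u :: 'a \<Rightarrow> real. u \<in> borel_measurable borel \<Longrightarrow> (LINT x|lborel. u (aff \<sigma> x)) = c * (LINT x|lborel. u x)"
proof -
  define L where "L x = aff \<sigma> x - aff \<sigma> 0" for x
  have L: "linear L"
  proof -
    have "L = (\<lambda>x. \<Sum>u\<in>V. (lam u x - lam u 0) *\<^sub>R \<sigma> u)"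
      by (simp add: L_def[abs_def] aff_def sum_subtractf scaleR_left_diff_distrib)
    moreover have "linear (\<lambda>x. \<Sum>u\<in>V. (lam u x - lam u 0) *\<^sub>R \<sigma> u)"
    proof (intro linear_compose_sum ballI)
      fix u assume "u \<in> V"
      then show "linear (\<lambda>x. (lam u x - lam u 0) *\<^sub>R \<sigma> u)"
        by (rule linear_compose[OF lam_linear bounded_linear.linear[OF bounded_linear_scaleR_left], unfolded comp_def])
    qed
    ultimately show ?thesis by metis
  qed
  have b: "bij L"
  proof (rule o_bij[of "\<lambda>y. aff \<tau> (y + aff \<sigma> 0)"])
    show "(\<lambda>y. aff \<tau> (y + aff \<sigma> 0)) \<circ> L = id"
      by (auto simp: L_def aff_aff[OF 1])
    show "L \<circ> (\<lambda>y. aff \<tau> (y + aff \<sigma> 0)) = id"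
      by (auto simp: L_def aff_aff[OF 2])
  qed
  define t where "t = aff \<sigma> 0"
  have eq: "aff \<sigma> x = L x + t" for x by (simp add: L_def t_def)
  show ?thesis
  proof (rule lborel_integral_linear_bij[OF L b])
    fix c :: real
    assume c: "0 \<le> c"
      "\<And>(u :: 'a \<Rightarrow> real) t. u \<in> borel_measurable borel \<Longrightarrow> (LINT x|lborel. u (L x + t)) = c * (LINT x|lborel. u x)"
    show ?thesis
      by (rule that[OF c(1)]) (simp add: eq c(2))
  qed
qed

section \<open>Integrals of products of barycentric coordinates\<close>

lemma lam_borel[measurable]: "v \<in> V \<Longrightarrow> lam v \<in> borel_measurable borel"
  by (intro borel_measurable_continuous_onI lam_continuous)

definition I :: "('a \<Rightarrow> real) \<Rightarrow> real" where "I h = (LINT x|lborel. indicat_real T x * h x)"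

lemma I_integrable: "continuous_on UNIV h \<Longrightarrow> integrable lborel (\<lambda>x. indicat_real T x * h x)"
  using integrable_T[of h] by simp

lemma I_add: "continuous_on UNIV h \<Longrightarrow> continuous_on UNIV k \<Longrightarrow> I (\<lambda>x. h x + k x) = I h + I k"
  unfolding I_def by (simp add: distrib_left I_integrable)

lemma I_cmult: "I (\<lambda>x. c * h x) = c * I h"
  unfolding I_def by (subst integral_mult_right_zero[symmetric]) (auto simp: ac_simps)

lemma I_sum: "(\<And>i. i \<in> A \<Longrightarrow> continuous_on UNIV (h i)) \<Longrightarrow> I (\<lambda>x. \<Sum>i\<in>A. h i x) = (\<Sum>i\<in>A. I (h i))"
  unfolding I_def by (simp add: sum_distrib_left I_integrable)

lemma I_one: "I (\<lambda>_. 1) = measure lborel T"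
  unfolding I_def by simp

definition swap where "swap v w = aff (Transposition.transpose v w)"

lemma aff_vertex: "v \<in> V \<Longrightarrow> aff \<sigma> v = \<sigma> v"
proof -
  assume "v \<in> V"
  then have "aff \<sigma> v = (\<Sum>u\<in>V. if u = v then \<sigma> v else 0)"
    unfolding aff_def by (intro sum.cong) (auto simp: lam_vertex)
  then show ?thesis using \<open>v \<in> V\<close> finite_V by simp
qed

lemma lam_swap:
  assumes "v \<in> V" "w \<in> V" "u \<in> V"
  shows "lam u (swap v w x) = lam (Transposition.transpose v w u) x"
proof -
  have tV: "Transposition.transpose v w y \<in> V" if "y \<in> V" for y using that assms by (auto simp: Transposition.transpose_def)
  have "lam u (swap v w x) = (\<Sum>y\<in>V. lam y x * lam u (Transposition.transpose v w y))"
    unfolding swap_def by (rule lam_aff) fact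
  also have "\<dots> = (\<Sum>y\<in>V. if y = Transposition.transpose v w u then lam y x else 0)"
    using tV assms by (intro sum.cong) (auto simp: lam_vertex)
  finally show ?thesis using tV[OF \<open>u \<in> V\<close>] finite_V by simp
qed

text \<open>An exchange of two vertices permutes the barycentric coordinates and so maps the simplex
  onto itself. Taking the indicator of \<open>T\<close> as integrand shows that the factor in the
  change of variables is 1.\<close>

lemma integral_swap:
  assumes vw: "v \<in> V" "w \<in> V" and [measurable]: "h \<in> borel_measurable borel"
  shows "(LINT x|lborel. indicat_real T x * h (swap v w x)) = (LINT x|lborel. indicat_real T x * h x)"
proof -
  have tV: "Transposition.transpose v w y \<in> V" if "y \<in> V" for y using that vw by (auto simp: Transposition.transpose_def)
  have T: "indicat_real T (swap v w x) = indicat_real T x" for x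
  proof -
    have "swap v w x \<in> T \<longleftrightarrow> (\<forall>u\<in>V. 0 \<le> lam (Transposition.transpose v w u) x)"
      by (simp add: mem_T lam_swap vw)
    also have "\<dots> \<longleftrightarrow> x \<in> T"
      unfolding mem_T using tV by (metis transpose_involutory)
    finally show ?thesis by (simp add: indicator_def)
  qed
  have tt: "aff (Transposition.transpose v w) (Transposition.transpose v w u) = u" if "u \<in> V" for u
    using tV[OF that] by (simp add: aff_vertex)
  show ?thesis
  proof (rule lborel_integral_aff[OF tt tt])
    fix c :: real
    assume c: "\<And>u :: 'a \<Rightarrow> real. u \<in> borel_measurable borel \<Longrightarrow> (LINT x|lborel. u (aff (Transposition.transpose v w) x)) = c * (LINT x|lborel. u x)"
    have "measure lborel T = (LINT x|lborel. indicat_real T (swap v w x))" by (simp add: T)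
    also have "\<dots> = c * measure lborel T" unfolding swap_def by (subst c) auto
    finally have "c = 1" using measure_T_pos by simp
    then show ?thesis
      using c[of "\<lambda>x. indicat_real T x * h x"] by (simp add: T swap_def[symmetric])
  qed
qed

lemma I_swap:
  assumes "v \<in> V" "w \<in> V" "continuous_on UNIV h"
  shows "I (\<lambda>x. h (swap v w x)) = I h"
  unfolding I_def using assms by (intro integral_swap borel_measurable_continuous_onI)

text \<open>By symmetry all coordinates have the same integral, and they sum to 1.\<close>

lemma I_lam: assumes "v \<in> V" shows "I (lam v) = measure lborel T / (DIM('a) + 1)"
proof -
  have eq: "I (lam w) = I (lam v)" if "w \<in> V" for w
    using I_swap[of v w "lam v"] that assms by (simp add: lam_continuous lam_swap)
  have "measure lborel T = I (\<lambda>x. \<Sum>w\<in>V. lam w x)" by (simp add: sum_lam I_one)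
  also have "\<dots> = (\<Sum>w\<in>V. I (lam w))" by (rule I_sum) (rule lam_continuous)
  also have "\<dots> = (DIM('a) + 1) * I (lam v)" by (simp add: eq card_V)
  finally show ?thesis by (simp add: field_simps)
qed

text \<open>The two coordinates differ by an affine function with nonzero linear part, so they agree
  only on a hyperplane.\<close>

lemma negligible_lam_eq:
  assumes "v \<in> V" "w \<in> V" "v \<noteq> w"
  shows "AE x in lborel. lam v x \<noteq> lam w x"
proof -
  define f where "f x = (lam v x - lam v 0) - (lam w x - lam w 0)" for x
  have f: "linear f" unfolding f_def by (intro linear_compose_sub lam_linear assms)
  define a where "a = adjoint f 1"
  have fa: "f x = a \<bullet> x" for x using adjoint_works[OF f, of x 1] by (simp add: a_def inner_commute)
  have "f v - f w = 2" using assms by (simp add: f_def lam_vertex)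
  then have "a \<noteq> 0" by (auto simp: fa)
  then have "negligible {x. a \<bullet> x = lam w 0 - lam v 0}" by (intro negligible_hyperplane) auto
  moreover have "{x. a \<bullet> x = lam w 0 - lam v 0} = {x. lam v x = lam w x}"
    by (auto simp: fa[symmetric] f_def)
  ultimately have "{x. lam v x = lam w x} \<in> null_sets lebesgue" by (simp add: negligible_iff_null_sets)
  moreover have "{x. lam v x = lam w x} \<in> sets borel"
    using assms by measurable
  ultimately have "{x. lam v x = lam w x} \<in> null_sets lborel" by (simp add: null_sets_completion_iff)
  then show ?thesis by (rule AE_I') auto
qed

text \<open>The swap exchanges the two halves of the simplex and leaves \<open>h\<close> invariant,
  so both halves carry the same integral; their overlap is a null set.\<close>

lemma I_half:
  assumes vw: "v \<in> V" "w \<in> V" "v \<noteq> w" and h: "continuous_on UNIV h" "\<And>x. h (swap v w x) = h x"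
  shows "2 * (LINT x|lborel. indicat_real T x * (indicat_real {x. lam w x \<le> lam v x} x * h x)) = I h"
proof -
  have [measurable]: "h \<in> borel_measurable borel" using h(1) by (rule borel_measurable_continuous_onI)
  note [measurable] = lam_borel[OF vw(1)] lam_borel[OF vw(2)]
  let ?J = "LINT x|lborel. indicat_real T x * (indicat_real {x. lam w x \<le> lam v x} x * h x)"
  let ?K = "LINT x|lborel. indicat_real T x * (indicat_real {x. lam v x \<le> lam w x} x * h x)"
  have "?J = (LINT x|lborel. indicat_real T x * (indicat_real {x. lam w x \<le> lam v x} (swap v w x) * h (swap v w x)))"
    by (rule integral_swap[symmetric]) (use vw in measurable)
  also have "\<dots> = ?K"
    using vw by (intro Bochner_Integration.integral_cong) (auto simp: h indicator_def lam_swap)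
  finally have JK: "?J = ?K" .
  have int: "integrable lborel (\<lambda>x. indicat_real T x * (indicat_real A x * h x))"
    if [measurable]: "A \<in> sets borel" for A
    by (rule Bochner_Integration.integrable_bound[OF I_integrable[OF h(1)]])
      (auto simp: indicator_def)
  have "?J + ?K = (LINT x|lborel. indicat_real T x * (indicat_real {x. lam w x \<le> lam v x} x * h x)
      + indicat_real T x * (indicat_real {x. lam v x \<le> lam w x} x * h x))"
    by (intro Bochner_Integration.integral_add[symmetric] int) measurable
  also have "\<dots> = I h"
    unfolding I_def by (rule integral_cong_AE, measurable)
      (use negligible_lam_eq[OF vw] in \<open>auto simp: indicator_def elim!: eventually_mono\<close>)
  finally show ?thesis using JK by simp
qed

text \<open>The set \<open>lam v = lam w\<close> cuts the simplex into two halves, each an affine image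
  of the whole; comparing the integrals of \<open>lam v * lam w\<close> over a half and over the simplex
  expresses them by those of \<open>(lam w)\<^sup>2\<close>.\<close>

lemma I_lam_lam:
  assumes vw: "v \<in> V" "w \<in> V" "v \<noteq> w"
  shows "I (\<lambda>x. lam v x * lam w x) = I (\<lambda>x. lam w x * lam w x) / 2"
proof -
  note [measurable] = lam_borel[OF vw(1)] lam_borel[OF vw(2)]
  \<comment> \<open>\<open>aff \<sigma>\<close> moves \<open>w\<close> to the midpoint of the edge
    and keeps all other vertices, so it maps the simplex onto the half on the side of
    \<open>v\<close>. The vertex values \<open>\<tau>\<close> of the inverse come from solving the
    midpoint equation for the other end point.\<close>
  define \<sigma> where "\<sigma> = id(w := (1/2) *\<^sub>R v + (1/2) *\<^sub>R w)"
  define \<tau> where "\<tau> = id(w := 2 *\<^sub>R w - v)"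
  have lam\<sigma>: "lam u (\<sigma> w) = (lam u v + lam u w) / 2" if "u \<in> V" for u
  proof -
    have "lam u (\<Sum>i\<in>{0,1::nat}. (1/2) *\<^sub>R ([v, w] ! i)) = (\<Sum>i\<in>{0,1::nat}. (1/2) * lam u ([v, w] ! i))"
      by (rule lam_affine_sum) (auto simp: that)
    then show ?thesis by (simp add: \<sigma>_def)
  qed
  have lam\<tau>: "lam u (\<tau> w) = 2 * lam u w - lam u v" if "u \<in> V" for u
  proof -
    have "lam u (\<Sum>i\<in>{0,1::nat}. ([2, -1] ! i) *\<^sub>R ([w, v] ! i)) = (\<Sum>i\<in>{0,1::nat}. ([2,-1] ! i) * lam u ([w, v] ! i))"
      by (rule lam_affine_sum) (auto simp: that)
    then show ?thesis by (simp add: \<tau>_def)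
  qed
  have aff\<sigma>: "aff \<rho> (\<sigma> w) = (1/2) *\<^sub>R (\<rho> v + \<rho> w)" for \<rho>
  proof -
    have "aff \<rho> (\<sigma> w) = (1/2) *\<^sub>R (aff \<rho> v + aff \<rho> w)"
      unfolding aff_def by (simp add: lam\<sigma> scaleR_sum_right sum.distrib[symmetric] algebra_simps add_divide_distrib)
    then show ?thesis by (simp add: aff_vertex vw)
  qed
  have aff\<tau>: "aff \<rho> (\<tau> w) = 2 *\<^sub>R \<rho> w - \<rho> v" for \<rho>
  proof -
    have "aff \<rho> (\<tau> w) = 2 *\<^sub>R aff \<rho> w - aff \<rho> v"
      unfolding aff_def by (simp add: lam\<tau> scaleR_sum_right sum_subtractf[symmetric] algebra_simps)
    then show ?thesis by (simp add: aff_vertex vw)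
  qed
  have 1: "aff \<tau> (\<sigma> u) = u" if "u \<in> V" for u
  proof (cases "u = w")
    case True
    then show ?thesis using vw by (simp add: aff\<sigma>) (simp add: \<tau>_def)
  next
    case False
    then show ?thesis using that by (simp add: \<sigma>_def aff_vertex) (simp add: \<tau>_def)
  qed
  have 2: "aff \<sigma> (\<tau> u) = u" if "u \<in> V" for u
  proof (cases "u = w")
    case True
    then show ?thesis using vw by (simp add: aff\<tau>) (simp add: \<sigma>_def scaleR_add_right)
  next
    case False
    then show ?thesis using that by (simp add: \<tau>_def aff_vertex) (simp add: \<sigma>_def)
  qed
  have \<sigma>': "\<sigma> y = y" if "y \<noteq> w" for y using that by (simp add: \<sigma>_def)
  define g where "g = aff \<sigma>"
  have lam_g: "lam u (g x) = (if u = v then lam v x + lam w x / 2 else if u = w then lam w x / 2 else lam u x)"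
    if u: "u \<in> V" for u x
  proof -
    have "lam u (g x) = (\<Sum>y\<in>V. lam y x * lam u (\<sigma> y))" unfolding g_def by (rule lam_aff) fact
    also have "\<dots> = (\<Sum>y\<in>V. (if y = u \<and> y \<noteq> w then lam u x else 0) + (if y = w then lam w x * ((lam u v + lam u w) / 2) else 0))"
      using u vw by (intro sum.cong) (auto simp: lam\<sigma> lam_vertex \<sigma>')
    also have "\<dots> = (if u \<noteq> w then lam u x else 0) + lam w x * ((lam u v + lam u w) / 2)"
      using u vw finite_V by (simp add: sum.distrib cong: conj_cong)
    finally show ?thesis using u vw by (auto simp: lam_vertex)
  qed
  \<comment> \<open>The \<open>v\<close>-coordinate of \<open>g x\<close> is
    \<open>lam v x + lam w x / 2\<close>, whose sign alone does not decide that of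
    \<open>lam v x\<close>; the inequality defining the half, evaluated at \<open>g x\<close>, reads
    exactly \<open>0 \<le> lam v x\<close>.\<close>
  have ind: "indicat_real T (g x) * indicat_real {x. lam w x \<le> lam v x} (g x) = indicat_real T x" for x
  proof -
    have "g x \<in> T \<and> lam w (g x) \<le> lam v (g x) \<longleftrightarrow> x \<in> T"
    proof
      assume a: "g x \<in> T \<and> lam w (g x) \<le> lam v (g x)"
      show "x \<in> T" unfolding mem_T
      proof
        fix u assume u: "u \<in> V"
        have "0 \<le> lam u (g x)" "lam w (g x) \<le> lam v (g x)" "0 \<le> lam w (g x)" using a u vw by (auto simp: mem_T)
        then show "0 \<le> lam u x" using u vw by (auto simp: lam_g split: if_splits)
      qed
    next
      assume a: "x \<in> T"
      then have "0 \<le> lam u x" if "u \<in> V" for u using that by (simp add: mem_T)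
      then show "g x \<in> T \<and> lam w (g x) \<le> lam v (g x)" using vw by (auto simp: mem_T lam_g)
    qed
    then show ?thesis by (auto simp: indicator_def)
  qed
  show ?thesis
  proof (rule lborel_integral_aff[OF 1 2])
    fix c :: real
    assume c: "\<And>u :: 'a \<Rightarrow> real. u \<in> borel_measurable borel \<Longrightarrow> (LINT x|lborel. u (aff \<sigma> x)) = c * (LINT x|lborel. u x)"
    have key: "I (\<lambda>x. h (g x)) = c / 2 * I h" if h: "continuous_on UNIV h" "\<And>x. h (swap v w x) = h x" for h
    proof -
      have [measurable]: "h \<in> borel_measurable borel" using h(1) by (rule borel_measurable_continuous_onI)
      have "I (\<lambda>x. h (g x)) = (LINT x|lborel. indicat_real T (g x) * (indicat_real {x. lam w x \<le> lam v x} (g x) * h (g x)))"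
        unfolding I_def by (simp add: mult.assoc[symmetric] ind)
      also have "\<dots> = c * (LINT x|lborel. indicat_real T x * (indicat_real {x. lam w x \<le> lam v x} x * h x))"
        unfolding g_def by (rule c) measurable
      also have "\<dots> = c / 2 * I h" using I_half[OF vw h] by simp
      finally show ?thesis .
    qed
    \<comment> \<open>The constant integrand yields |T| = c/2 |T|.\<close>
    have "c = 2" using key[of "\<lambda>_. 1"] measure_T_pos by (simp add: I_one)
    then have "I (\<lambda>x. lam v x * lam w x) = I (\<lambda>x. lam v (g x) * lam w (g x))"
      using key[of "\<lambda>x. lam v x * lam w x"] vw
      by (simp add: lam_swap lam_continuous continuous_intros mult.commute)
    \<comment> \<open>The coordinates at \<open>g x\<close> are \<open>lam v x + lam w x / 2\<close>
      and \<open>lam w x / 2\<close>. Their product contains the original integrand with factor 1/2,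
      so the equation can be solved for the mixed moment.\<close>
    also have "\<dots> = I (\<lambda>x. 1/2 * (lam v x * lam w x) + 1/4 * (lam w x * lam w x))"
      using vw by (simp add: lam_g algebra_simps)
    also have "\<dots> = 1/2 * I (\<lambda>x. lam v x * lam w x) + 1/4 * I (\<lambda>x. lam w x * lam w x)"
      by (subst I_add) (auto intro!: continuous_intros lam_continuous vw simp: I_cmult simp del: times_divide_eq_left)
    finally show ?thesis by simp
  qed
qed

text \<open>Integrating the square of the partition of unity gives one linear equation: each of the
  d + 1 vertices contributes one pure moment \<open>A\<close> and d mixed ones
  \<open>A / 2\<close>.\<close>

lemma I_lam_sq:
  assumes "v \<in> V" shows "I (\<lambda>x. lam v x * lam v x) = 2 * measure lborel T / ((DIM('a) + 1) * (DIM('a) + 2))"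
proof -
  define A where "A = I (\<lambda>x. lam v x * lam v x)"
  have eq: "I (\<lambda>x. lam w x * lam w x) = A" if "w \<in> V" for w
    using I_swap[of v w "\<lambda>x. lam v x * lam v x"] that assms
    by (simp add: lam_continuous lam_swap continuous_intros A_def)
  have "measure lborel T = I (\<lambda>x. (\<Sum>w\<in>V. lam w x) * (\<Sum>u\<in>V. lam u x))" by (simp add: sum_lam I_one)
  also have "\<dots> = I (\<lambda>x. \<Sum>w\<in>V. \<Sum>u\<in>V. lam w x * lam u x)" by (simp only: sum_product)
  also have "\<dots> = (\<Sum>w\<in>V. \<Sum>u\<in>V. I (\<lambda>x. lam w x * lam u x))"
  proof (subst I_sum)
    show "continuous_on UNIV (\<lambda>x. \<Sum>u\<in>V. lam w x * lam u x)" if "w \<in> V" for w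
      using that by (intro continuous_intros lam_continuous)
    show "(\<Sum>w\<in>V. I (\<lambda>x. \<Sum>u\<in>V. lam w x * lam u x)) = (\<Sum>w\<in>V. \<Sum>u\<in>V. I (\<lambda>x. lam w x * lam u x))"
      by (intro sum.cong refl I_sum continuous_intros lam_continuous)
  qed
  also have "\<dots> = (\<Sum>w\<in>V. \<Sum>u\<in>V. A / 2 + (if u = w then A / 2 else 0))"
    by (intro sum.cong refl) (auto simp: eq I_lam_lam)
  also have "\<dots> = (DIM('a) + 1) * (DIM('a) + 2) * A / 2"
  proof -
    have "(\<Sum>u\<in>V. A / 2 + (if u = w then A / 2 else 0)) = (DIM('a) + 2) * A / 2" if "w \<in> V" for w
      using that by (subst sum.distrib) (simp add: finite_V card_V algebra_simps add_divide_distrib)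
    then have "(\<Sum>w\<in>V. \<Sum>u\<in>V. A / 2 + (if u = w then A / 2 else 0)) = (\<Sum>w\<in>V. (DIM('a) + 2) * A / 2)"
      by (rule sum.cong[OF refl])
    also have "\<dots> = (DIM('a) + 1) * (DIM('a) + 2) * A / 2" by (simp add: card_V algebra_simps)
    finally show ?thesis .
  qed
  finally have m: "measure lborel T = real ((DIM('a) + 1) * (DIM('a) + 2)) * A / 2" .
  \<comment> \<open>The denominator is kept abstract, since simplification would expand the product
    of the dimension factors.\<close>
  have "A = 2 * (D * A / 2) / D" if "D \<noteq> 0" for D :: real using that by simp
  note this[of "real ((DIM('a) + 1) * (DIM('a) + 2))"]
  moreover have "real ((DIM('a) + 1) * (DIM('a) + 2)) \<noteq> 0" by (subst of_nat_eq_0_iff) simp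
  ultimately show ?thesis unfolding m A_def[symmetric] by blast
qed

lemma I_lam_lam_eq:
  assumes "v \<in> V" "w \<in> V"
  shows "I (\<lambda>x. lam v x * lam w x) = measure lborel T / ((DIM('a) + 1) * (DIM('a) + 2)) * (if v = w then 2 else 1)"
proof (cases "v = w")
  case False
  define D where "D = real ((DIM('a) + 1) * (DIM('a) + 2))"
  have "I (\<lambda>x. lam v x * lam w x) = I (\<lambda>x. lam w x * lam w x) / 2" by (rule I_lam_lam[OF assms False])
  then show ?thesis unfolding I_lam_sq[OF assms(2)] D_def[symmetric] using False by simp
qed (use I_lam_sq[OF assms(2)] in simp)

section \<open>Moments about the barycentre\<close>

definition centre :: 'a where "centre = (\<Sum>v\<in>V. v) /\<^sub>R card V"

lemma sum_centre: "(\<Sum>v\<in>V. v - centre) = 0"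
  by (simp add: sum_subtractf centre_def card_V sum_constant_scaleR)

lemma diff_centre: "x - centre = (\<Sum>v\<in>V. lam v x *\<^sub>R (v - centre))"
  by (simp add: scaleR_diff_right sum_subtractf sum_lam_scaleR scaleR_sum_left[symmetric] sum_lam)

lemma set_integral_T_eq_I:
  assumes "continuous_on UNIV h" shows "(LINT x:T|lebesgue. h x) = I h"
proof -
  have [measurable]: "h \<in> borel_measurable borel" using assms by (rule borel_measurable_continuous_onI)
  show ?thesis unfolding set_lebesgue_integral_def I_def
    by (subst integral_completion) auto
qed

text \<open>Every offset \<open>v - centre\<close> is weighted by the same integral, and the offsets
  sum to zero.\<close>

lemma first_moment_zero: "(LINT x:T|lebesgue. e \<bullet> (x - centre)) = 0"
proof -
  have "(LINT x:T|lebesgue. e \<bullet> (x - centre)) = I (\<lambda>x. e \<bullet> (x - centre))"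
    by (intro set_integral_T_eq_I continuous_intros)
  also have "\<dots> = I (\<lambda>x. \<Sum>v\<in>V. (e \<bullet> (v - centre)) * lam v x)"
    by (subst diff_centre) (simp add: inner_sum_right mult.commute)
  also have "\<dots> = (\<Sum>v\<in>V. (e \<bullet> (v - centre)) * I (lam v))"
    by (subst I_sum) (auto intro!: continuous_intros lam_continuous simp: I_cmult)
  also have "\<dots> = (\<Sum>v\<in>V. (e \<bullet> (v - centre)) * (measure lborel T / (DIM('a) + 1)))"
    by (intro sum.cong refl) (simp add: I_lam)
  also have "\<dots> = (e \<bullet> (\<Sum>v\<in>V. v - centre)) * (measure lborel T / (DIM('a) + 1))"
    by (simp only: sum_distrib_right inner_sum_right)
  finally show ?thesis by (simp add: sum_centre)
qed

text \<open>Expanded about the barycentre, the cross terms cancel and each of the two squares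
  contributes the same sum.\<close>

lemma sum_norm_diff: "(\<Sum>v\<in>V. \<Sum>w\<in>V. (norm (v - w))\<^sup>2) = 2 * real (card V) * (\<Sum>v\<in>V. (norm (v - centre))\<^sup>2)"
proof -
  have e: "(norm (v - w))\<^sup>2 = (norm (v - centre))\<^sup>2 + (norm (w - centre))\<^sup>2 - 2 * ((v - centre) \<bullet> (w - centre))" for v w
    by (simp add: power2_norm_eq_inner inner_simps inner_commute)
  have "(\<Sum>v\<in>V. \<Sum>w\<in>V. (norm (v - w))\<^sup>2) = (\<Sum>v\<in>V. \<Sum>w\<in>V.
    (norm (v - centre))\<^sup>2 + (norm (w - centre))\<^sup>2 - 2 * ((v - centre) \<bullet> (w - centre)))"
    by (intro sum.cong refl e)
  also have "\<dots> =
    (\<Sum>v\<in>V. card V * (norm (v - centre))\<^sup>2 + (\<Sum>w\<in>V. (norm (w - centre))\<^sup>2) - 2 * (\<Sum>w\<in>V. (v - centre) \<bullet> (w - centre)))"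
    by (simp only: sum.distrib sum_subtractf sum_distrib_left sum_constant of_nat_mult)
  also have "\<dots> = 2 * real (card V) * (\<Sum>v\<in>V. (norm (v - centre))\<^sup>2)"
    by (simp only: inner_sum_right[symmetric] sum_centre) (simp add: sum.distrib sum_distrib_left[symmetric])
  finally show ?thesis .
qed

text \<open>The matrix of second moments of the coordinates is \<open>m\<close> times the sum of the
  all-ones matrix and the identity. The all-ones part annihilates the offsets from the barycentre,
  so only the diagonal survives. Passing from offsets to edges by \<open>sum_norm_diff\<close> costs
  the second factor d + 1, and halving counts each edge once.\<close>

lemma set_integral_norm_diff_centre:
  "(LINT x:T|lebesgue. (norm (x - centre))\<^sup>2) =
    measure lebesgue T / ((real DIM('a) + 1)\<^sup>2 * (real DIM('a) + 2)) * ((\<Sum>v\<in>V. \<Sum>w\<in>V. (norm (v - w))\<^sup>2) / 2)"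
proof -
  define m where "m = measure lborel T / ((DIM('a) + 1) * (DIM('a) + 2))"
  have n: "(norm (x - centre))\<^sup>2 = (\<Sum>v\<in>V. \<Sum>w\<in>V. ((v - centre) \<bullet> (w - centre)) * (lam v x * lam w x))" for x
    unfolding power2_norm_eq_inner
    by (subst (1 2) diff_centre) (simp add: inner_sum_left inner_sum_right sum_distrib_left inner_commute ac_simps)
  have "(LINT x:T|lebesgue. (norm (x - centre))\<^sup>2) = I (\<lambda>x. (norm (x - centre))\<^sup>2)"
    by (intro set_integral_T_eq_I continuous_intros)
  also have "\<dots> = (\<Sum>v\<in>V. \<Sum>w\<in>V. ((v - centre) \<bullet> (w - centre)) * I (\<lambda>x. lam v x * lam w x))"
    unfolding n
  proof (subst I_sum)
    show "continuous_on UNIV (\<lambda>x. \<Sum>w\<in>V. ((v - centre) \<bullet> (w - centre)) * (lam v x * lam w x))" if "v \<in> V" for v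
      using that by (intro continuous_intros lam_continuous)
    show "(\<Sum>v\<in>V. I (\<lambda>x. \<Sum>w\<in>V. ((v - centre) \<bullet> (w - centre)) * (lam v x * lam w x))) =
      (\<Sum>v\<in>V. \<Sum>w\<in>V. ((v - centre) \<bullet> (w - centre)) * I (\<lambda>x. lam v x * lam w x))"
      by (rule sum.cong[OF refl], subst I_sum) (auto intro!: continuous_intros lam_continuous simp: I_cmult)
  qed
  also have "\<dots> = (\<Sum>v\<in>V. \<Sum>w\<in>V. m * ((v - centre) \<bullet> (w - centre)) + (if v = w then m * ((v - centre) \<bullet> (w - centre)) else 0))"
    by (intro sum.cong refl) (simp add: I_lam_lam_eq m_def)
  also have "\<dots> = (\<Sum>v\<in>V. m * ((v - centre) \<bullet> (\<Sum>w\<in>V. w - centre)) + m * (norm (v - centre))\<^sup>2)"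
    by (intro sum.cong refl) (simp add: sum.distrib finite_V inner_sum_right sum_distrib_left power2_norm_eq_inner)
  also have "\<dots> = m * (\<Sum>v\<in>V. (norm (v - centre))\<^sup>2)"
    by (simp add: sum_centre sum_distrib_left)
  also have "\<dots> = m * ((\<Sum>v\<in>V. \<Sum>w\<in>V. (norm (v - w))\<^sup>2) / (2 * real (card V)))"
    by (subst sum_norm_diff) (simp add: card_V)
  also have "\<dots> = measure lebesgue T / ((real DIM('a) + 1)\<^sup>2 * (real DIM('a) + 2)) * ((\<Sum>v\<in>V. \<Sum>w\<in>V. (norm (v - w))\<^sup>2) / 2)"
    by (simp add: m_def card_V power2_eq_square ac_simps measure_completion) (simp add: algebra_simps)
  finally show ?thesis .
qed

lemma vertices_T: "vertices T = V"
  unfolding vertices_def T_def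
  using extreme_point_of_convex_hull_affine_independent[OF indep] by auto

lemma barycentre_T: "barycentre T = centre"
  by (simp add: barycentre_def centre_def vertices_T)

end

section \<open>From ordered to unordered pairs, and from vertex sets to simplices\<close>

lemma sum_pairs_eq_half:
  fixes f :: "nat \<Rightarrow> nat \<Rightarrow> real"
  assumes "\<And>i j. f i j = f j i" "\<And>i. f i i = 0"
  shows "(\<Sum>i = 1..n. \<Sum>j = i + 1..n. f i j) = (\<Sum>i = 1..n. \<Sum>j = 1..n. f i j) / 2"
proof -
  have "(\<Sum>i = 1..n. \<Sum>j = 1..n. f i j) = (\<Sum>i = 1..n. (\<Sum>j = i + 1..n. f i j) + (\<Sum>j = 1..n. if j < i then f i j else 0))"
  proof (rule sum.cong[OF refl])
    fix i assume "i \<in> {1..n}"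
    have "(\<Sum>j = i + 1..n. f i j) = (\<Sum>j = 1..n. if i < j then f i j else 0)"
      by (rule sum.mono_neutral_cong_left) auto
    then show "(\<Sum>j = 1..n. f i j) = (\<Sum>j = i + 1..n. f i j) + (\<Sum>j = 1..n. if j < i then f i j else 0)"
      by (simp add: sum.distrib[symmetric]) (rule sum.cong, auto simp: assms(2) not_less)
  qed
  also have "\<dots> = (\<Sum>i = 1..n. \<Sum>j = i + 1..n. f i j) + (\<Sum>i = 1..n. \<Sum>j = 1..n. if j < i then f i j else 0)"
    by (rule sum.distrib)
  also have "(\<Sum>i = 1..n. \<Sum>j = 1..n. if j < i then f i j else 0) = (\<Sum>j = 1..n. \<Sum>i = 1..n. if j < i then f i j else 0)"
    by (rule sum.swap)
  also have "\<dots> = (\<Sum>j = 1..n. \<Sum>i = j + 1..n. f j i)"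
    by (intro sum.cong[OF refl] sum.mono_neutral_cong_right) (auto simp: assms(1))
  finally show ?thesis by simp
qed

lemma simplex_vertices_ex:
  assumes "int DIM('a) simplex (T::'a::euclidean_space set)"
  obtains V where "simplex_vertices V" "T = simplex_vertices.T V"
proof -
  obtain V where V: "\<not> affine_dependent V" "int (card V) = int DIM('a) + 1" "T = convex hull V"
    using assms unfolding simplex_def by auto
  then interpret simplex_vertices V by unfold_locales auto
  show ?thesis by (rule that[of V]) (use V T_def simplex_vertices_axioms in auto)
qed

lemma second_moment_simplex:
  fixes T :: "'a::euclidean_space set" and x :: "nat \<Rightarrow> 'a"
  assumes "int DIM('a) simplex T" and x: "bij_betw x {1..DIM('a) + 1} (vertices T)"
  shows "second_moment T =
             measure lebesgue T / ((real DIM('a) + 1)\<^sup>2 * (real DIM('a) + 2)) *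
             (\<Sum>i = 1..DIM('a) + 1. \<Sum>j = i + 1..DIM('a) + 1. (norm (x i - x j))\<^sup>2)"
proof -
  obtain V where V: "simplex_vertices V" "T = simplex_vertices.T V" using simplex_vertices_ex assms(1) by blast
  interpret S: simplex_vertices V by fact
  have x: "bij_betw x {1..DIM('a) + 1} V" using x by (simp add: V(2) S.vertices_T)
  have "(\<Sum>v\<in>V. \<Sum>w\<in>V. (norm (v - w))\<^sup>2) = (\<Sum>i = 1..DIM('a) + 1. \<Sum>j = 1..DIM('a) + 1. (norm (x i - x j))\<^sup>2)"
    by (simp only: sum.reindex_bij_betw[OF x, symmetric])
  also have "\<dots> / 2 = (\<Sum>i = 1..DIM('a) + 1. \<Sum>j = i + 1..DIM('a) + 1. (norm (x i - x j))\<^sup>2)"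
    by (rule sum_pairs_eq_half[symmetric]) (auto simp: norm_minus_commute)
  finally show ?thesis
    unfolding second_moment_def V(2) S.barycentre_T S.set_integral_norm_diff_centre by simp
qed

lemma barycentre_moment_zero:
  assumes "int DIM('a) simplex (T::'a::euclidean_space set)"
  shows "(LINT x:T|lebesgue. e \<bullet> (x - barycentre T)) = 0"
proof -
  obtain V where V: "simplex_vertices V" "T = simplex_vertices.T V" using simplex_vertices_ex assms(1) by blast
  interpret S: simplex_vertices V by fact
  show ?thesis unfolding V(2) S.barycentre_T by (rule S.first_moment_zero)
qed

section \<open>Smooth bump functions\<close>

text \<open>For k = 0 this is the classical smooth function that is flat at 0. Differentiation
  produces powers of 1/t; with them included, the span of the family is closed under
  differentiation.\<close>

definition flat_exp :: "nat \<Rightarrow> real \<Rightarrow> real"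
  where "flat_exp k t = (if t > 0 then exp (- (1 / t)) / t ^ k else 0)"

lemma flat_exp_tendsto_0: "(flat_exp k \<longlongrightarrow> 0) (at 0)"
proof -
  have "((\<lambda>t. (inverse t) ^ k / exp (inverse t)) \<longlongrightarrow> (0::real)) (at_right 0)"
    by (rule filterlim_compose[OF tendsto_power_div_exp_0 filterlim_inverse_at_top_right])
  then have r: "(flat_exp k \<longlongrightarrow> 0) (at_right 0)"
    by (rule Lim_transform_eventually)
      (auto simp: flat_exp_def eventually_at_right_field exp_minus field_simps power_inverse intro!: exI[of _ 1])
  have l: "(flat_exp k \<longlongrightarrow> 0) (at_left 0)"
    by (rule tendsto_eventually) (auto simp: flat_exp_def eventually_at_left_field intro!: exI[of _ "-1"])
  show ?thesis using l r by (simp add: filterlim_split_at)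
qed

lemma DERIV_flat_exp:
  "(flat_exp k has_real_derivative (- real k * flat_exp (Suc k) t + flat_exp (k + 2) t)) (at t)"
proof (cases "t > 0 \<or> t < 0")
  case True
  then show ?thesis
  proof
    assume t: "t > 0"
    have "((\<lambda>t. exp (- (1 / t)) / t ^ k) has_real_derivative (- real k * flat_exp (Suc k) t + flat_exp (k + 2) t)) (at t)"
      using t by (auto intro!: derivative_eq_intros simp: flat_exp_def field_simps) 
        (cases k; simp add: field_simps)
    then show ?thesis
      by (rule has_field_derivative_transform_within_open[of _ _ _ "{0<..}"]) (use t in \<open>auto simp: flat_exp_def\<close>)
  next
    assume t: "t < 0"
    have "((\<lambda>t. 0) has_real_derivative (- real k * flat_exp (Suc k) t + flat_exp (k + 2) t)) (at t)"
      using t by (auto simp: flat_exp_def)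
    then show ?thesis
      by (rule has_field_derivative_transform_within_open[of _ _ _ "{..<0}"]) (use t in \<open>auto simp: flat_exp_def\<close>)
  qed
next
  case False
  then have t: "t = 0" by simp
  \<comment> \<open>At 0 the difference quotient of \<open>flat_exp k\<close> is
    \<open>flat_exp (Suc k)\<close>, which tends to 0.\<close>
  have "((\<lambda>h. (flat_exp k (0 + h) - flat_exp k 0) / h) \<longlongrightarrow> 0) (at 0)"
    by (rule Lim_transform_eventually[OF flat_exp_tendsto_0[of "Suc k"]])
      (auto simp: flat_exp_def eventually_at_filter field_simps)
  then show ?thesis unfolding t DERIV_def by (simp add: flat_exp_def)
qed

lemma flat_exp_bounds: "0 \<le> flat_exp 0 t" "flat_exp 0 t \<le> 1" "flat_exp 0 t \<noteq> 0 \<longleftrightarrow> t > 0"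
  by (auto simp: flat_exp_def)

text \<open>\<open>Ck\<close> is recursive in the partial derivatives. A class of functions closed
  under taking them satisfies every \<open>Ck\<close> by a single induction, without product and
  chain rules for \<open>Ck\<close> itself; the bumps below belong to this class.\<close>

inductive_set flat_algebra :: "('a::euclidean_space \<Rightarrow> real) set" where
  gen: "(\<lambda>x. flat_exp k (u \<bullet> x + t)) \<in> flat_algebra"
| const: "(\<lambda>x. c) \<in> flat_algebra"
| add: "f \<in> flat_algebra \<Longrightarrow> g \<in> flat_algebra \<Longrightarrow> (\<lambda>x. f x + g x) \<in> flat_algebra"
| mult: "f \<in> flat_algebra \<Longrightarrow> g \<in> flat_algebra \<Longrightarrow> (\<lambda>x. f x * g x) \<in> flat_algebra"

lemma flat_algebra_derivative:
  "f \<in> flat_algebra \<Longrightarrow> \<exists>f'. (\<forall>x. (f has_derivative f' x) (at x)) \<and> (\<forall>b. (\<lambda>x. f' x b) \<in> flat_algebra)"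
proof (induction rule: flat_algebra.induct)
  case (gen k u t)
  let ?g = "\<lambda>x. - real k * flat_exp (Suc k) (u \<bullet> x + t) + flat_exp (k + 2) (u \<bullet> x + t)"
  have "((\<lambda>x. flat_exp k (u \<bullet> x + t)) has_derivative (\<lambda>b. ?g x * (u \<bullet> b))) (at x)" for x
  proof -
    have "((\<lambda>x. u \<bullet> x + t) has_derivative (\<lambda>b. u \<bullet> b)) (at x)" by (auto intro!: derivative_eq_intros)
    from DERIV_compose_FDERIV[OF DERIV_flat_exp this] show ?thesis by (simp add: mult.commute)
  qed
  moreover have "(\<lambda>x. ?g x * (u \<bullet> b)) \<in> flat_algebra" for b
    by (intro flat_algebra.intros)
  ultimately show ?case by (intro exI[of _ "\<lambda>x b. ?g x * (u \<bullet> b)"]) auto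
next
  case (const c)
  show ?case by (rule exI[of _ "\<lambda>x b. 0"]) (auto intro: flat_algebra.const)
next
  case (add f g)
  then obtain f' g' where "\<And>x. (f has_derivative f' x) (at x)" "\<And>x. (g has_derivative g' x) (at x)"
    "\<And>b. (\<lambda>x. f' x b) \<in> flat_algebra" "\<And>b. (\<lambda>x. g' x b) \<in> flat_algebra" by blast
  then show ?case by (intro exI[of _ "\<lambda>x b. f' x b + g' x b"]) (auto intro: has_derivative_add flat_algebra.intros)
next
  case (mult f g)
  then obtain f' g' where "\<And>x. (f has_derivative f' x) (at x)" "\<And>x. (g has_derivative g' x) (at x)"
    "\<And>b. (\<lambda>x. f' x b) \<in> flat_algebra" "\<And>b. (\<lambda>x. g' x b) \<in> flat_algebra" by blast
  note d = this
  show ?case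
  proof (intro exI[of _ "\<lambda>x b. f x * g' x b + f' x b * g x"] conjI allI)
    show "((\<lambda>x. f x * g x) has_derivative (\<lambda>b. f x * g' x b + f' x b * g x)) (at x)" for x
      by (rule has_derivative_mult[OF d(1,2)])
    show "(\<lambda>x. f x * g' x b + f' x b * g x) \<in> flat_algebra" for b
      by (rule flat_algebra.add[OF flat_algebra.mult[OF mult.hyps(1) d(4)] flat_algebra.mult[OF d(3) mult.hyps(2)]])
  qed
qed

lemma Ck_flat_algebra: "f \<in> flat_algebra \<Longrightarrow> Ck k f"
proof (induction k arbitrary: f)
  case 0
  then obtain f' where "\<And>x. (f has_derivative f' x) (at x)" using flat_algebra_derivative by blast
  then show ?case by (auto intro: has_derivative_continuous_on has_derivative_at_withinI)
next
  case (Suc k)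
  then obtain f' where f': "\<And>x. (f has_derivative f' x) (at x)" "\<And>b. (\<lambda>x. f' x b) \<in> flat_algebra"
    using flat_algebra_derivative by blast
  have "frechet_derivative f (at x) = f' x" for x using frechet_derivative_at[OF f'(1)] by simp
  then show ?case using Suc.IH[OF f'(2)] f'(1) by (auto simp: differentiable_def)
qed

text \<open>For \<open>n > 0\<close> this is positive exactly on the open box with corners
  \<open>a\<close> and \<open>c\<close>. Growing \<open>n\<close> steepens the flanks, so that the
  bumps tend to the indicator of the box. The arguments have the shape
  \<open>u \<bullet> x + t\<close> of the generators of \<open>flat_algebra\<close>.\<close>

definition bump :: "'a::euclidean_space \<Rightarrow> 'a \<Rightarrow> nat \<Rightarrow> 'a \<Rightarrow> real" where
  "bump a c n x = (\<Prod>b\<in>Basis. flat_exp 0 (real n *\<^sub>R b \<bullet> x + (- real n * (a \<bullet> b))) * flat_exp 0 ((- real n) *\<^sub>R b \<bullet> x + real n * (c \<bullet> b)))"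

lemma flat_algebra_prod: "finite A \<Longrightarrow> (\<And>i. i \<in> A \<Longrightarrow> f i \<in> flat_algebra) \<Longrightarrow> (\<lambda>x. \<Prod>i\<in>A. f i x) \<in> flat_algebra"
  by (induction A rule: finite_induct) (auto intro: flat_algebra.intros)

lemma bump_flat_algebra: "bump a c n \<in> flat_algebra"
  unfolding bump_def[abs_def] by (intro flat_algebra_prod flat_algebra.mult flat_algebra.gen) auto

lemma bump_bounds: "0 \<le> bump a c n x" "bump a c n x \<le> 1"
  unfolding bump_def by (auto intro!: prod_nonneg prod_le_1 mult_le_one simp: flat_exp_bounds)

lemma bump_nonzero: "n > 0 \<Longrightarrow> bump a c n x \<noteq> 0 \<longleftrightarrow> x \<in> box a c"
proof -
  assume n: "n > 0"
  have "bump a c n x \<noteq> 0 \<longleftrightarrow> (\<forall>b\<in>Basis. real n * (x \<bullet> b - a \<bullet> b) > 0 \<and> real n * (c \<bullet> b - x \<bullet> b) > 0)"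
    by (auto simp: bump_def prod_zero_iff flat_exp_bounds(3) inner_commute algebra_simps)
  also have "\<dots> \<longleftrightarrow> x \<in> box a c" using n by (auto simp: mem_box zero_less_mult_iff)
  finally show ?thesis .
qed

lemma bump_in_test_functions:
  assumes "n > 0" "cbox a c \<subseteq> U" shows "bump a c n \<in> test_functions U"
proof -
  have "closure {x. bump a c n x \<noteq> 0} \<subseteq> cbox a c"
    by (rule closure_minimal) (use assms(1) box_subset_cbox in \<open>auto simp: bump_nonzero\<close>)
  moreover from this have "compact (closure {x. bump a c n x \<noteq> 0})"
    using bounded_subset[OF bounded_cbox] by (auto simp: compact_eq_bounded_closed)
  ultimately show ?thesis unfolding test_functions_def
    using assms(2) by (auto intro: Ck_flat_algebra bump_flat_algebra)
qed

lemma flat_exp_LIMSEQ: "(\<lambda>n. flat_exp 0 (real n * s)) \<longlonglongrightarrow> (if s > 0 then 1 else 0)"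
proof (cases "s > 0")
  case True
  have "(\<lambda>n. exp (- (inverse (real n) * inverse s))) \<longlonglongrightarrow> exp (- (0 * inverse s))"
    by (intro tendsto_intros lim_inverse_n)
  then have "(\<lambda>n. exp (- (1 / (real n * s)))) \<longlonglongrightarrow> 1"
    by (simp add: field_simps)
  moreover have "\<forall>\<^sub>F n in sequentially. exp (- (1 / (real n * s))) = flat_exp 0 (real n * s)"
    by (rule eventually_mono[OF eventually_gt_at_top[of 0]]) (use True in \<open>simp add: flat_exp_def\<close>)
  ultimately have "(\<lambda>n. flat_exp 0 (real n * s)) \<longlonglongrightarrow> 1" by (rule Lim_transform_eventually)
  then show ?thesis using True by simp
next
  case False
  then have "flat_exp 0 (real n * s) = 0" for n by (simp add: flat_exp_def zero_less_mult_iff)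
  then show ?thesis using False by simp
qed

lemma bump_LIMSEQ: "(\<lambda>n. bump a c n x) \<longlonglongrightarrow> indicat_real (box a c) x"
proof -
  have "(\<lambda>n. \<Prod>b\<in>Basis. flat_exp 0 (real n * (x \<bullet> b - a \<bullet> b)) * flat_exp 0 (real n * (c \<bullet> b - x \<bullet> b))) \<longlonglongrightarrow>
    (\<Prod>b\<in>Basis. (if x \<bullet> b - a \<bullet> b > 0 then 1 else 0) * (if c \<bullet> b - x \<bullet> b > 0 then 1 else 0))"
    by (intro tendsto_intros flat_exp_LIMSEQ)
  moreover have "(\<Prod>b\<in>Basis. (if x \<bullet> b - a \<bullet> b > 0 then 1 else 0) * (if c \<bullet> b - x \<bullet> b > 0 then 1 else 0)) = indicat_real (box a c) x"
    by (auto simp: indicator_def mem_box intro!: prod.neutral)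
  moreover have "bump a c n x = (\<Prod>b\<in>Basis. flat_exp 0 (real n * (x \<bullet> b - a \<bullet> b)) * flat_exp 0 (real n * (c \<bullet> b - x \<bullet> b)))" for n
    by (simp add: bump_def inner_commute algebra_simps)
  ultimately show ?thesis by simp
qed

text \<open>Translates of bumps are bumps, hence test functions; this is used when a bump is moved
  across a hyperplane.\<close>

lemma bump_shift: "bump a c n (x + s) = bump (a - s) (c - s) n x"
  unfolding bump_def by (intro prod.cong refl arg_cong2[where f="(*)"] arg_cong[where f="flat_exp 0"])
    (auto simp: inner_simps inner_commute algebra_simps)

section \<open>Test functions, their gradients and supports\<close>

lemma test_function_has_derivative:
  assumes "\<phi> \<in> test_functions U"
  shows "(\<phi> has_derivative (\<lambda>h. classical_grad \<phi> x \<bullet> h)) (at x)"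
proof -
  have "Ck (Suc 0) \<phi>" using assms by (auto simp: test_functions_def)
  then have d: "(\<phi> has_derivative frechet_derivative \<phi> (at x)) (at x)" by (simp add: frechet_derivative_works)
  then have l: "linear (frechet_derivative \<phi> (at x))" by (rule has_derivative_linear)
  have "frechet_derivative \<phi> (at x) h = classical_grad \<phi> x \<bullet> h" for h
  proof -
    have "frechet_derivative \<phi> (at x) h = frechet_derivative \<phi> (at x) (\<Sum>b\<in>Basis. (h \<bullet> b) *\<^sub>R b)"
      by (simp only: euclidean_representation)
    also have "\<dots> = (\<Sum>b\<in>Basis. (h \<bullet> b) * frechet_derivative \<phi> (at x) b)"
      by (simp only: linear_sum[OF l] linear_scale[OF l] real_scaleR_def)
    also have "\<dots> = classical_grad \<phi> x \<bullet> h"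
      by (simp add: classical_grad_def inner_sum_left inner_commute[of h] mult.commute)
    finally show ?thesis .
  qed
  then have "frechet_derivative \<phi> (at x) = (\<lambda>h. classical_grad \<phi> x \<bullet> h)" by auto
  with d show ?thesis by simp
qed

lemma has_derivative_classical_grad:
  assumes "(f has_derivative (\<lambda>h. g \<bullet> h)) (at x)" shows "classical_grad f x = g"
proof -
  have "frechet_derivative f (at x) = (\<lambda>h. g \<bullet> h)" using frechet_derivative_at[OF assms] by simp
  then show ?thesis by (simp add: classical_grad_def euclidean_representation)
qed

lemma test_function_continuous:
  assumes "\<phi> \<in> test_functions U" shows "continuous_on S \<phi>"
  by (rule has_derivative_continuous_on[OF has_derivative_at_withinI[OF test_function_has_derivative[OF assms]]])

lemma test_function_grad_continuous:
  assumes "\<phi> \<in> test_functions U" shows "continuous_on S (classical_grad \<phi>)"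
proof -
  have "Ck (Suc 0) \<phi>" using assms by (auto simp: test_functions_def)
  then have "continuous_on UNIV (\<lambda>x. frechet_derivative \<phi> (at x) b)" if "b \<in> Basis" for b using that by simp
  then have "continuous_on UNIV (classical_grad \<phi>)"
    unfolding classical_grad_def[abs_def] by (intro continuous_intros)
  then show ?thesis by (rule continuous_on_subset) simp
qed

lemma test_function_support:
  assumes "\<phi> \<in> test_functions U"
  obtains K where "compact K" "K \<subseteq> U" "\<And>x. x \<notin> K \<Longrightarrow> \<phi> x = 0" "\<And>x. x \<notin> K \<Longrightarrow> classical_grad \<phi> x = 0"
proof (rule that)
  let ?K = "closure {x. \<phi> x \<noteq> 0}"
  show "compact ?K" "?K \<subseteq> U" using assms by (auto simp: test_functions_def)
  show 0: "\<phi> x = 0" if "x \<notin> ?K" for x using that closure_subset[of "{x. \<phi> x \<noteq> 0}"] by auto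
  show "classical_grad \<phi> x = 0" if "x \<notin> ?K" for x
  proof (rule has_derivative_classical_grad)
    have "((\<lambda>_. 0) has_derivative (\<lambda>h. 0 \<bullet> h)) (at x)"
      by (simp only: inner_zero_left has_derivative_const)
    moreover have "open (- ?K)" "x \<in> - ?K" using that by auto
    ultimately show "(\<phi> has_derivative (\<lambda>h. 0 \<bullet> h)) (at x)"
      by (rule has_derivative_transform_within_open) (rule 0[symmetric], erule ComplD)
  qed
qed

lemma test_functions_mono: "U \<subseteq> W \<Longrightarrow> test_functions U \<subseteq> test_functions W"
  by (auto simp: test_functions_def)

section \<open>Weak gradients\<close>

text \<open>Completeness of the measure transfers measurability along almost-everywhere equality,
  and if neither function is integrable, both integrals have the default value 0.\<close>

lemma lebesgue_integral_cong_AE':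
  fixes f g :: "'a::euclidean_space \<Rightarrow> 'b::euclidean_space"
  assumes ae: "AE x in lebesgue. f x = g x"
  shows "integral\<^sup>L lebesgue f = integral\<^sup>L lebesgue g" "integrable lebesgue f \<longleftrightarrow> integrable lebesgue g"
proof -
  have ae': "AE x in lebesgue. g x = f x" using ae by eventually_elim simp
  have imp: "integrable lebesgue g" if "integrable lebesgue f" "AE x in lebesgue. f x = g x" for f g :: "'a \<Rightarrow> 'b"
    by (rule integrable_cong_AE_imp[OF that(1) borel_measurable_AE[OF _ that(2)] that(2)])
      (rule borel_measurable_integrable[OF that(1)])
  show iff: "integrable lebesgue f \<longleftrightarrow> integrable lebesgue g"
    using imp[OF _ ae] imp[OF _ ae'] by (rule iffI)
  show "integral\<^sup>L lebesgue f = integral\<^sup>L lebesgue g"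
  proof (cases "integrable lebesgue f")
    case True
    with iff show ?thesis by (intro integral_cong_AE borel_measurable_integrable ae) auto
  next
    case False
    with iff show ?thesis by (simp add: not_integrable_integral_eq)
  qed
qed

lemma set_lebesgue_cong_AE:
  fixes f g :: "'a::euclidean_space \<Rightarrow> 'b::euclidean_space"
  assumes ae: "AE x in lebesgue. x \<in> S \<longrightarrow> f x = g x"
  shows "(LINT x:S|lebesgue. f x) = (LINT x:S|lebesgue. g x)"
    "set_integrable lebesgue S f \<longleftrightarrow> set_integrable lebesgue S g"
proof -
  have "AE x in lebesgue. indicat_real S x *\<^sub>R f x = indicat_real S x *\<^sub>R g x"
    using ae by eventually_elim (auto simp: indicator_def)
  from lebesgue_integral_cong_AE'[OF this]
  show "(LINT x:S|lebesgue. f x) = (LINT x:S|lebesgue. g x)"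
    "set_integrable lebesgue S f \<longleftrightarrow> set_integrable lebesgue S g"
    unfolding set_lebesgue_integral_def set_integrable_def by blast+
qed

lemma set_integral_support:
  assumes "K \<subseteq> U" "\<And>x. x \<notin> K \<Longrightarrow> f x = 0"
  shows "(LINT x:U|M. f x) = (LINT x:K|M. f x)"
  unfolding set_lebesgue_integral_def using assms
  by (intro Bochner_Integration.integral_cong) (auto simp: indicator_def)

lemma set_integrable_bilinear_continuous:
  fixes f :: "'a::euclidean_space \<Rightarrow> 'b::euclidean_space" and g :: "'a \<Rightarrow> 'c::euclidean_space"
    and h :: "'b \<Rightarrow> 'c \<Rightarrow> 'd::euclidean_space"
  assumes "bounded_bilinear h" "compact K" "continuous_on UNIV f" "set_integrable lebesgue K g"
  shows "set_integrable lebesgue K (\<lambda>x. h (f x) (g x))"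
proof (rule absolutely_integrable_bounded_measurable_product[of h f K g])
  show "bilinear h" using assms(1) by (simp add: bilinear_conv_bounded_bilinear)
  show "f \<in> borel_measurable (lebesgue_on K)"
    using assms by (intro continuous_imp_measurable_on_sets_lebesgue lmeasurable_compact fmeasurableD)
      (auto intro: continuous_on_subset)
  show "K \<in> sets lebesgue" using assms by (intro lmeasurable_compact fmeasurableD)
  show "bounded (f ` K)" using assms 
    by (intro compact_imp_bounded compact_continuous_image) (auto intro: continuous_on_subset)
  show "set_integrable lebesgue K g" by fact
qed

lemmas set_integrable_scaleR_continuous =
  set_integrable_bilinear_continuous[OF bounded_bilinear_scaleR]

lemma set_integrable_scaleR_continuous':
  fixes f :: "'a::euclidean_space \<Rightarrow> 'b::euclidean_space" and g :: "'a \<Rightarrow> real"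
  assumes "compact K" "continuous_on UNIV f" "set_integrable lebesgue K g"
  shows "set_integrable lebesgue K (\<lambda>x. g x *\<^sub>R f x)"
  by (rule set_integrable_bilinear_continuous[OF bounded_bilinear.flip[OF bounded_bilinear_scaleR] assms])

lemma set_integrable_continuous:
  fixes f :: "'a::euclidean_space \<Rightarrow> 'b::euclidean_space"
  assumes "compact K" "continuous_on UNIV f"
  shows "set_integrable lebesgue K f"
proof -
  have "integrable lborel (\<lambda>x. indicat_real K x *\<^sub>R f x)"
    by (rule borel_integrable_compact[OF assms(1) continuous_on_subset[OF assms(2) subset_UNIV]])
  then show ?thesis unfolding set_integrable_def
    by (subst integrable_completion) (auto dest: borel_measurable_integrable)
qed

text \<open>The defining identity integrates over \<open>U\<close>, where \<open>v\<close> need not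
  be integrable. On a compact set that carries the test function both integrands are integrable, so
  linearity of the integral becomes available.\<close>

lemma has_weak_gradD:
  assumes "has_weak_grad U v G" "\<phi> \<in> test_functions U" "compact K" "K \<subseteq> U"
    "\<And>x. x \<notin> K \<Longrightarrow> \<phi> x = 0" "\<And>x. x \<notin> K \<Longrightarrow> classical_grad \<phi> x = 0"
  shows "(LINT x:K|lebesgue. v x *\<^sub>R classical_grad \<phi> x) = - (LINT x:K|lebesgue. \<phi> x *\<^sub>R G x)"
    "set_integrable lebesgue K (\<lambda>x. v x *\<^sub>R classical_grad \<phi> x)"
    "set_integrable lebesgue K (\<lambda>x. \<phi> x *\<^sub>R G x)"
proof -
  have "(LINT x:U|lebesgue. v x *\<^sub>R classical_grad \<phi> x) = (LINT x:K|lebesgue. v x *\<^sub>R classical_grad \<phi> x)"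
    "(LINT x:U|lebesgue. \<phi> x *\<^sub>R G x) = (LINT x:K|lebesgue. \<phi> x *\<^sub>R G x)"
    by (rule set_integral_support[OF assms(4)]; simp add: assms)+
  then show "(LINT x:K|lebesgue. v x *\<^sub>R classical_grad \<phi> x) = - (LINT x:K|lebesgue. \<phi> x *\<^sub>R G x)"
    using assms(1,2) unfolding has_weak_grad_def by auto
  have vG: "set_integrable lebesgue K v" "set_integrable lebesgue K G"
    using assms unfolding has_weak_grad_def by auto
  show "set_integrable lebesgue K (\<lambda>x. v x *\<^sub>R classical_grad \<phi> x)"
    by (intro set_integrable_scaleR_continuous' assms vG test_function_grad_continuous[OF assms(2)])
  show "set_integrable lebesgue K (\<lambda>x. \<phi> x *\<^sub>R G x)"
    by (intro set_integrable_scaleR_continuous assms vG test_function_continuous[OF assms(2)])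
qed

lemma has_weak_gradI:
  assumes "\<And>K. compact K \<Longrightarrow> K \<subseteq> U \<Longrightarrow> set_integrable lebesgue K v \<and> set_integrable lebesgue K G"
    and "\<And>\<phi> K. \<phi> \<in> test_functions U \<Longrightarrow> compact K \<Longrightarrow> K \<subseteq> U \<Longrightarrow>
      (\<And>x. x \<notin> K \<Longrightarrow> \<phi> x = 0) \<Longrightarrow> (\<And>x. x \<notin> K \<Longrightarrow> classical_grad \<phi> x = 0) \<Longrightarrow>
      (LINT x:K|lebesgue. v x *\<^sub>R classical_grad \<phi> x) = - (LINT x:K|lebesgue. \<phi> x *\<^sub>R G x)"
  shows "has_weak_grad U v G"
  unfolding has_weak_grad_def
proof (intro conjI allI impI ballI)
  fix \<phi> assume p: "\<phi> \<in> test_functions U"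
  obtain K where K: "compact K" "K \<subseteq> U" "\<And>x. x \<notin> K \<Longrightarrow> \<phi> x = 0" "\<And>x. x \<notin> K \<Longrightarrow> classical_grad \<phi> x = 0"
    using test_function_support[OF p] by metis
  have "(LINT x:U|lebesgue. v x *\<^sub>R classical_grad \<phi> x) = (LINT x:K|lebesgue. v x *\<^sub>R classical_grad \<phi> x)"
    "(LINT x:U|lebesgue. \<phi> x *\<^sub>R G x) = (LINT x:K|lebesgue. \<phi> x *\<^sub>R G x)"
    by (rule set_integral_support[OF K(2)]; simp add: K)+
  then show "(LINT x:U|lebesgue. v x *\<^sub>R classical_grad \<phi> x) = - (LINT x:U|lebesgue. \<phi> x *\<^sub>R G x)"
    using assms(2)[OF p K] by simp
qed (use assms(1) in auto)

lemma has_weak_grad_diff: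
  assumes v: "has_weak_grad U v G" and w: "has_weak_grad U w H"
  shows "has_weak_grad U (\<lambda>x. v x - w x) (\<lambda>x. G x - H x)"
proof (rule has_weak_gradI)
  fix K assume "compact K" "K \<subseteq> U"
  then show "set_integrable lebesgue K (\<lambda>x. v x - w x) \<and> set_integrable lebesgue K (\<lambda>x. G x - H x)"
    using v w unfolding has_weak_grad_def by auto
next
  fix \<phi> K assume K: "\<phi> \<in> test_functions U" "compact K" "K \<subseteq> U" 
    "\<And>x. x \<notin> K \<Longrightarrow> \<phi> x = 0" "\<And>x. x \<notin> K \<Longrightarrow> classical_grad \<phi> x = 0"
  note a = has_weak_gradD[OF v K] and b = has_weak_gradD[OF w K]
  show "(LINT x:K|lebesgue. (v x - w x) *\<^sub>R classical_grad \<phi> x) = - (LINT x:K|lebesgue. \<phi> x *\<^sub>R (G x - H x))"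
    using set_integral_diff(2)[OF a(2) b(2)] set_integral_diff(2)[OF a(3) b(3)]
    by (simp add: scaleR_diff_left scaleR_diff_right a(1) b(1))
qed

lemma has_weak_grad_subset:
  assumes "has_weak_grad U v G" "W \<subseteq> U"
  shows "has_weak_grad W v G"
proof (rule has_weak_gradI)
  fix K assume "compact K" "K \<subseteq> W"
  then show "set_integrable lebesgue K v \<and> set_integrable lebesgue K G"
    using assms unfolding has_weak_grad_def by auto
next
  fix \<phi> K assume K: "\<phi> \<in> test_functions W" "compact K" "K \<subseteq> W" 
    "\<And>x. x \<notin> K \<Longrightarrow> \<phi> x = 0" "\<And>x. x \<notin> K \<Longrightarrow> classical_grad \<phi> x = 0"
  show "(LINT x:K|lebesgue. v x *\<^sub>R classical_grad \<phi> x) = - (LINT x:K|lebesgue. \<phi> x *\<^sub>R G x)"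
    by (rule has_weak_gradD(1)[OF assms(1) _ K(2) _ K(4,5)]) (use K assms(2) test_functions_mono in blast)+
qed

lemma has_weak_grad_cong:
  assumes h: "has_weak_grad U v G" and ae: "AE x in lebesgue. x \<in> U \<longrightarrow> v x = w x \<and> G x = H x"
  shows "has_weak_grad U w H"
proof (rule has_weak_gradI)
  fix K assume K: "compact K" "K \<subseteq> U"
  have "AE x in lebesgue. x \<in> K \<longrightarrow> v x = w x" "AE x in lebesgue. x \<in> K \<longrightarrow> G x = H x"
    using ae by (eventually_elim; use K in blast)+
  from set_lebesgue_cong_AE(2)[OF this(1)] set_lebesgue_cong_AE(2)[OF this(2)]
  show "set_integrable lebesgue K w \<and> set_integrable lebesgue K H"
    using K h unfolding has_weak_grad_def by auto
next
  fix \<phi> K assume K: "\<phi> \<in> test_functions U" "compact K" "K \<subseteq> U" 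
    "\<And>x. x \<notin> K \<Longrightarrow> \<phi> x = 0" "\<And>x. x \<notin> K \<Longrightarrow> classical_grad \<phi> x = 0"
  have "AE x in lebesgue. x \<in> K \<longrightarrow> v x *\<^sub>R classical_grad \<phi> x = w x *\<^sub>R classical_grad \<phi> x"
    "AE x in lebesgue. x \<in> K \<longrightarrow> \<phi> x *\<^sub>R G x = \<phi> x *\<^sub>R H x"
    using ae by (eventually_elim; use K(3) in auto)+
  from set_lebesgue_cong_AE(1)[OF this(1)] set_lebesgue_cong_AE(1)[OF this(2)]
  show "(LINT x:K|lebesgue. w x *\<^sub>R classical_grad \<phi> x) = - (LINT x:K|lebesgue. \<phi> x *\<^sub>R H x)"
    using has_weak_gradD(1)[OF h K] by simp
qed

text \<open>Differentiation under the integral sign; the mean value bound supplies the dominating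
  function. Translating the smooth factor is the device behind both the vanishing integral of a
  compactly supported gradient and the exclusion of jumps.\<close>

lemma DERIV_integral_shift:
  fixes w u :: "'a::euclidean_space \<Rightarrow> real"
  assumes w: "integrable lebesgue w"
    and u: "\<And>x. (u has_derivative (\<lambda>h. g x \<bullet> h)) (at x)"
    and g: "continuous_on UNIV g" and C: "\<And>x. norm (g x) \<le> C" and C': "\<And>x. \<bar>u x\<bar> \<le> C'"
  shows "((\<lambda>s. LINT x|lebesgue. w x * u (x + s *\<^sub>R b)) has_real_derivative
    (LINT x|lebesgue. w x * (g (x + s *\<^sub>R b) \<bullet> b))) (at s)"
proof -
  note [measurable] = borel_measurable_integrable[OF w]
  have cu: "continuous_on UNIV u"
    by (rule has_derivative_continuous_on[OF has_derivative_at_withinI[OF u]])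
  have mu[measurable]: "(\<lambda>x. u (x + t *\<^sub>R b)) \<in> borel_measurable lebesgue" for t
    by (intro measurable_completion, subst measurable_lborel2, intro borel_measurable_continuous_onI continuous_on_compose2[OF cu]) (auto intro!: continuous_intros)
  have mg[measurable]: "(\<lambda>x. g (x + t *\<^sub>R b) \<bullet> b) \<in> borel_measurable lebesgue" for t
    by (intro measurable_completion, subst measurable_lborel2, intro borel_measurable_continuous_onI continuous_intros continuous_on_compose2[OF g]) (auto intro!: continuous_intros)
  have int: "integrable lebesgue (\<lambda>x. w x * u (x + t *\<^sub>R b))" for t
  proof (rule Bochner_Integration.integrable_bound)
    show "integrable lebesgue (\<lambda>x. C' * w x)" using w by simp
    show "AE x in lebesgue. norm (w x * u (x + t *\<^sub>R b)) \<le> norm (C' * w x)"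
    proof (rule AE_I2)
      fix x
      have "\<bar>u (x + t *\<^sub>R b)\<bar> * \<bar>w x\<bar> \<le> \<bar>C'\<bar> * \<bar>w x\<bar>"
        by (intro mult_right_mono order_trans[OF C' abs_ge_self]) simp
      then show "norm (w x * u (x + t *\<^sub>R b)) \<le> norm (C' * w x)" by (simp add: abs_mult mult.commute)
    qed
  qed measurable
  have lip: "\<bar>u x - u y\<bar> \<le> C * norm (x - y)" for x y
  proof -
    have "onorm (\<lambda>h. g z \<bullet> h) \<le> C" for z
      by (rule onorm_le, rule order_trans[OF _ mult_right_mono[OF C[of z] norm_ge_zero]])
        (simp add: Cauchy_Schwarz_ineq2)
    then show ?thesis using differentiable_bound[of UNIV u "\<lambda>x h. g x \<bullet> h" C x y] u by simp
  qed
  show ?thesis unfolding DERIV_def tendsto_at_iff_sequentially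
  proof (intro allI impI)
    fix X :: "nat \<Rightarrow> real" assume X: "\<forall>i. X i \<in> UNIV - {0}" "X \<longlonglongrightarrow> 0"
    have lim: "(\<lambda>i. LINT x|lebesgue. w x * ((u (x + (s + X i) *\<^sub>R b) - u (x + s *\<^sub>R b)) / X i)) \<longlonglongrightarrow>
       (LINT x|lebesgue. w x * (g (x + s *\<^sub>R b) \<bullet> b))"
    proof (rule integral_dominated_convergence[where w = "\<lambda>x. (C * norm b) * norm (w x)"])
      show "integrable lebesgue (\<lambda>x. (C * norm b) * norm (w x))" using w by simp
      show "AE x in lebesgue. norm (w x * ((u (x + (s + X i) *\<^sub>R b) - u (x + s *\<^sub>R b)) / X i)) \<le> C * norm b * norm (w x)" for i
      proof (intro AE_I2)
        fix x
        have "\<bar>u (x + (s + X i) *\<^sub>R b) - u (x + s *\<^sub>R b)\<bar> \<le> C * norm (X i *\<^sub>R b)"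
          using lip[of "x + (s + X i) *\<^sub>R b" "x + s *\<^sub>R b"] by (simp add: scaleR_add_left)
        then have "\<bar>u (x + (s + X i) *\<^sub>R b) - u (x + s *\<^sub>R b)\<bar> / \<bar>X i\<bar> \<le> C * norm b"
          using X(1) by (simp add: divide_le_eq ac_simps)
        from mult_right_mono[OF this abs_ge_zero[of "w x"]]
        show "norm (w x * ((u (x + (s + X i) *\<^sub>R b) - u (x + s *\<^sub>R b)) / X i)) \<le> C * norm b * norm (w x)"
          by (simp add: abs_mult ac_simps)
      qed
      show "AE x in lebesgue. (\<lambda>i. w x * ((u (x + (s + X i) *\<^sub>R b) - u (x + s *\<^sub>R b)) / X i)) \<longlonglongrightarrow> w x * (g (x + s *\<^sub>R b) \<bullet> b)"
      proof (intro AE_I2 tendsto_intros)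
        fix x
        have "((\<lambda>t. x + t *\<^sub>R b) has_derivative (\<lambda>t. t *\<^sub>R b)) (at s)" by (auto intro!: derivative_eq_intros)
        from has_derivative_compose[OF this u]
        have "((\<lambda>t. u (x + t *\<^sub>R b)) has_real_derivative (g (x + s *\<^sub>R b) \<bullet> b)) (at s)"
          unfolding has_field_derivative_def by (simp add: mult_commute_abs)
        then show "(\<lambda>i. (u (x + (s + X i) *\<^sub>R b) - u (x + s *\<^sub>R b)) / X i) \<longlonglongrightarrow> g (x + s *\<^sub>R b) \<bullet> b"
          unfolding DERIV_def tendsto_at_iff_sequentially using X by (auto simp: comp_def)
      qed
    qed measurable
    have eq: "(LINT x|lebesgue. w x * ((u (x + (s + X i) *\<^sub>R b) - u (x + s *\<^sub>R b)) / X i))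
      = ((LINT x|lebesgue. w x * u (x + (s + X i) *\<^sub>R b)) - (LINT x|lebesgue. w x * u (x + s *\<^sub>R b))) / X i" for i
      using Bochner_Integration.integral_diff[OF int[of "s + X i"] int[of s]]
      by (simp add: right_diff_distrib[symmetric] diff_divide_distrib[symmetric])
    show "((\<lambda>h. ((LINT x|lebesgue. w x * u (x + (s + h) *\<^sub>R b)) - (LINT x|lebesgue. w x * u (x + s *\<^sub>R b))) / h) \<circ> X)
      \<longlonglongrightarrow> (LINT x|lebesgue. w x * (g (x + s *\<^sub>R b) \<bullet> b))"
      using lim unfolding eq comp_def .
  qed
qed

lemma continuous_compact_support_bounded:
  fixes g :: "'a::euclidean_space \<Rightarrow> 'b::real_normed_vector"
  assumes "continuous_on UNIV g" "compact K" "\<And>x. x \<notin> K \<Longrightarrow> g x = 0"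
  obtains C where "\<And>x. norm (g x) \<le> C"
proof -
  have "bounded (g ` K)" using assms(1,2)
    by (intro compact_imp_bounded compact_continuous_image) (auto intro: continuous_on_subset)
  then obtain C where C: "\<And>x. x \<in> K \<Longrightarrow> norm (g x) \<le> C" by (auto simp: bounded_iff)
  have "norm (g x) \<le> max C 0" for x by (cases "x \<in> K") (auto simp: assms(3) C le_max_iff_disj)
  then show ?thesis by (rule that)
qed

text \<open>By translation invariance the integral of \<open>u (x + s *\<^sub>R b)\<close> does not
  depend on \<open>s\<close>, while its derivative at 0 is the integral of the partial
  derivative.\<close>

lemma integral_gradient_compact_support:
  fixes u :: "'a::euclidean_space \<Rightarrow> real"
  assumes u: "\<And>x. (u has_derivative (\<lambda>h. g x \<bullet> h)) (at x)"
    and g: "continuous_on UNIV g" and K: "compact K" "\<And>x. x \<notin> K \<Longrightarrow> u x = 0" "\<And>x. x \<notin> K \<Longrightarrow> g x = 0"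
  shows "(LINT x:K|lebesgue. g x) = 0"
proof (rule euclidean_eqI)
  fix b :: 'a assume b: "b \<in> Basis"
  have cu: "continuous_on UNIV u"
    by (rule has_derivative_continuous_on[OF has_derivative_at_withinI[OF u]])
  obtain C where C: "\<And>x. norm (g x) \<le> C" using continuous_compact_support_bounded[OF g K(1,3)] by blast
  obtain C' where C': "\<And>x. norm (u x) \<le> C'" using continuous_compact_support_bounded[OF cu K(1,2)] by blast
  obtain R where R: "K \<subseteq> ball 0 R" using compact_imp_bounded[OF K(1)] bounded_subset_ballD by blast
  \<comment> \<open>Differentiation under the integral requires an integrable weight. For
    \<open>\<bar>s\<bar> < 1\<close> the translated support stays in the ball of radius
    \<open>R + 1\<close>, so this weight changes nothing.\<close>
  define w where "w = indicat_real (ball (0::'a) (R + 1))"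
  have w: "integrable lebesgue w" unfolding w_def using lmeasurable_ball lmeasurable_iff_integrable by blast
  have d: "((\<lambda>s. LINT x|lebesgue. w x * u (x + s *\<^sub>R b)) has_real_derivative
    (LINT x|lebesgue. w x * (g (x + 0 *\<^sub>R b) \<bullet> b))) (at 0)"
    by (rule DERIV_integral_shift[OF w u g C]) (use C' in simp)
  have const: "(LINT x|lebesgue. w x * u (x + s *\<^sub>R b)) = (LINT x|lborel. u x)" if "s \<in> ball 0 1" for s
  proof -
    have [measurable]: "u \<in> borel_measurable borel" by (rule borel_measurable_continuous_onI[OF cu])
    have "w x * u (x + s *\<^sub>R b) = u (x + s *\<^sub>R b)" for x
    proof (cases "x + s *\<^sub>R b \<in> K")
      case True
      then have "norm (x + s *\<^sub>R b) < R" using R by auto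
      moreover have "norm (s *\<^sub>R b) < 1" using that b by simp
      moreover have "norm x \<le> norm (x + s *\<^sub>R b) + norm (s *\<^sub>R b)" by (metis add_diff_cancel norm_triangle_ineq4)
      ultimately show ?thesis by (simp add: w_def)
    qed (simp add: K)
    then have "(LINT x|lebesgue. w x * u (x + s *\<^sub>R b)) = (LINT x|lebesgue. u (x + s *\<^sub>R b))" by (simp only:)
    also have "\<dots> = (LINT x|lborel. u (x + s *\<^sub>R b))" by (rule integral_completion) measurable
    also have "\<dots> = (LINT x|lborel. u x)"
      by (subst (2) lborel_distr_plus[of "s *\<^sub>R b", symmetric]) (simp add: integral_distr add.commute)
    finally show ?thesis .
  qed
  have "((\<lambda>s. LINT x|lborel. u x) has_real_derivative (LINT x|lebesgue. w x * (g (x + 0 *\<^sub>R b) \<bullet> b))) (at 0)"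
    by (rule has_field_derivative_transform_within_open[OF d open_ball[of 0 1]]) (use const in auto)
  then have "(LINT x|lebesgue. w x * (g (x + 0 *\<^sub>R b) \<bullet> b)) = 0"
    using DERIV_unique DERIV_const by blast
  moreover have "(indicat_real K x *\<^sub>R g x) \<bullet> b = w x * (g (x + 0 *\<^sub>R b) \<bullet> b)" for x
    using R by (cases "x \<in> K") (auto simp: w_def K indicator_def)
  ultimately have "(LINT x|lebesgue. (indicat_real K x *\<^sub>R g x) \<bullet> b) = 0" by (simp only:)
  moreover have "integrable lebesgue (\<lambda>x. indicat_real K x *\<^sub>R g x)"
    using set_integrable_continuous[OF K(1) g] by (simp add: set_integrable_def)
  ultimately show "(LINT x:K|lebesgue. g x) \<bullet> b = 0 \<bullet> b"
    unfolding set_lebesgue_integral_def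
    using integral_inner_left[of b lebesgue "\<lambda>x. indicat_real K x *\<^sub>R g x"] by simp
qed

text \<open>By the product rule the two integrands add up to the gradient of
  \<open>v x * \<phi> x\<close>, which has compact support.\<close>

lemma has_weak_grad_classical:
  fixes v :: "'a::euclidean_space \<Rightarrow> real"
  assumes v: "\<And>x. (v has_derivative (\<lambda>h. G x \<bullet> h)) (at x)" and G: "continuous_on UNIV G"
  shows "has_weak_grad U v G"
proof (rule has_weak_gradI)
  have cv: "continuous_on UNIV v"
    by (rule has_derivative_continuous_on[OF has_derivative_at_withinI[OF v]])
  fix K :: "'a set" assume K: "compact K"
  show "set_integrable lebesgue K v \<and> set_integrable lebesgue K G"
    by (intro conjI set_integrable_continuous K cv G)
  fix \<phi> assume \<phi>: "\<phi> \<in> test_functions U" "\<And>x. x \<notin> K \<Longrightarrow> \<phi> x = 0" "\<And>x. x \<notin> K \<Longrightarrow> classical_grad \<phi> x = 0"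
  note cp = test_function_continuous[OF \<phi>(1), of UNIV] and cg = test_function_grad_continuous[OF \<phi>(1), of UNIV]
  have "(LINT x:K|lebesgue. v x *\<^sub>R classical_grad \<phi> x + \<phi> x *\<^sub>R G x) = 0"
  proof (rule integral_gradient_compact_support[OF _ _ K])
    show "((\<lambda>x. v x * \<phi> x) has_derivative (\<lambda>h. (v x *\<^sub>R classical_grad \<phi> x + \<phi> x *\<^sub>R G x) \<bullet> h)) (at x)" for x
      using has_derivative_mult[OF v test_function_has_derivative[OF \<phi>(1)], of x]
      by (simp add: inner_add_left mult.commute)
  qed (auto intro!: continuous_intros cv cp cg G simp: \<phi>)
  then show "(LINT x:K|lebesgue. v x *\<^sub>R classical_grad \<phi> x) = - (LINT x:K|lebesgue. \<phi> x *\<^sub>R G x)"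
    by (subst (asm) set_integral_add)
      (auto intro!: set_integrable_continuous K continuous_intros cv cp cg G simp: eq_neg_iff_add_eq_0)
qed

lemma has_weak_grad_affine: "has_weak_grad U (\<lambda>x. a \<bullet> x + c) (\<lambda>_. a)"
  by (rule has_weak_grad_classical) (auto intro!: derivative_eq_intros)

lemma has_weak_grad_test_function:
  "\<phi> \<in> test_functions W \<Longrightarrow> has_weak_grad U \<phi> (classical_grad \<phi>)"
  by (rule has_weak_grad_classical) (auto intro: test_function_has_derivative test_function_grad_continuous)

text \<open>The fundamental lemma of the calculus of variations: bumps tending to indicators show
  that \<open>H\<close> has integral 0 over boxes in \<open>U\<close>, and Lebesgue differentiation
  on shrinking cubes then gives \<open>H x = 0\<close> almost everywhere.\<close>

lemma has_weak_grad_zero_AE: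
  fixes H :: "'a::euclidean_space \<Rightarrow> 'a"
  assumes U: "open U" and h: "has_weak_grad U (\<lambda>_. 0) H"
  shows "AE x in lebesgue. x \<in> U \<longrightarrow> H x = 0"
proof -
  have H: "set_integrable lebesgue K H" if "compact K" "K \<subseteq> U" for K
    using h that unfolding has_weak_grad_def by auto
  have box0: "(LINT x:box a c|lebesgue. H x) = 0" if ac: "cbox a c \<subseteq> U" for a c
  proof -
    let ?s = "\<lambda>n x. bump a c (Suc n) x *\<^sub>R (indicat_real (cbox a c) x *\<^sub>R H x)"
    have int: "integrable lebesgue (\<lambda>x. indicat_real (cbox a c) x *\<^sub>R H x)"
      using H[OF compact_cbox ac] by (simp add: set_integrable_def)
    note mH = borel_measurable_integrable[OF int]
    have mb: "bump a c (Suc n) \<in> borel_measurable lebesgue" for n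
      using bump_in_test_functions[of "Suc n" a c UNIV]
      by (intro measurable_completion, subst measurable_lborel2, 
          intro borel_measurable_continuous_onI test_function_continuous[of _ UNIV]) auto
    have lim: "(\<lambda>n. LINT x|lebesgue. ?s n x) \<longlonglongrightarrow> (LINT x|lebesgue. indicat_real (box a c) x *\<^sub>R (indicat_real (cbox a c) x *\<^sub>R H x))"
    proof (rule integral_dominated_convergence[OF _ _ integrable_norm[OF int]])
      show "AE x in lebesgue. (\<lambda>n. ?s n x) \<longlonglongrightarrow> indicat_real (box a c) x *\<^sub>R (indicat_real (cbox a c) x *\<^sub>R H x)"
        by (intro AE_I2 tendsto_intros LIMSEQ_Suc bump_LIMSEQ)
      show "AE x in lebesgue. norm (?s n x) \<le> norm (indicat_real (cbox a c) x *\<^sub>R H x)" for n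
        using bump_bounds[of a c "Suc n"] by (intro AE_I2) (auto simp: indicator_def intro!: mult_left_le_one_le)
      show "(\<lambda>x. indicat_real (box a c) x *\<^sub>R (indicat_real (cbox a c) x *\<^sub>R H x)) \<in> borel_measurable lebesgue"
        by (rule borel_measurable_scaleR[OF borel_measurable_indicator mH]) auto
      show "?s n \<in> borel_measurable lebesgue" for n
        by (rule borel_measurable_scaleR[OF mb mH])
    qed
    have s0: "(LINT x|lebesgue. ?s n x) = 0" for n
    proof -
      have "bump a c (Suc n) \<in> test_functions U" using bump_in_test_functions[of "Suc n" a c U] ac by simp
      then have "(LINT x:U|lebesgue. bump a c (Suc n) x *\<^sub>R H x) = 0"
        using h unfolding has_weak_grad_def by (auto simp: set_lebesgue_integral_def)
      also have "(LINT x:U|lebesgue. bump a c (Suc n) x *\<^sub>R H x) = (LINT x:cbox a c|lebesgue. bump a c (Suc n) x *\<^sub>R H x)"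
        by (rule set_integral_support[OF ac])
          (use bump_nonzero[of "Suc n" a c] box_subset_cbox in \<open>auto simp: subset_iff\<close>)
      finally show ?thesis by (simp add: set_lebesgue_integral_def mult.commute)
    qed
    have eq: "indicat_real (box a c) x *\<^sub>R (indicat_real (cbox a c) x *\<^sub>R H x) = indicat_real (box a c) x *\<^sub>R H x" for x
      using box_subset_cbox[of a c] by (auto simp: indicator_def)
    from lim show ?thesis unfolding set_lebesgue_integral_def s0 eq by (simp add: LIMSEQ_const_iff)
  qed
  have D: "AE x in lebesgue. x \<in> D \<longrightarrow> H x = 0" if D: "D = cbox p q" "D \<subseteq> U" for D p q
  proof -
    \<comment> \<open>The differentiation theorem applies to functions integrable on all boxes,
      hence the truncation to \<open>D\<close>; near an interior point of \<open>D\<close> the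
      truncation is invisible.\<close>
    define f where "f x = (if x \<in> D then H x else 0)" for x
    have "f integrable_on UNIV" unfolding f_def integrable_restrict_UNIV
      using set_lebesgue_integral_eq_integral(1)[OF H] D by simp
    then have "f integrable_on cbox a b" for a b by (rule integrable_on_subcbox) simp
    then obtain N where N: "negligible N" 
      "\<And>x e. \<lbrakk>x \<notin> N; 0 < e\<rbrakk> \<Longrightarrow> \<exists>d>0. \<forall>h. 0 < h \<and> h < d \<longrightarrow>
        norm (integral (cbox x (x + h *\<^sub>R One)) f /\<^sub>R h ^ DIM('a) - f x) < e"
      using integrable_ccontinuous_explicit by metis
    have z: "H x = 0" if x: "x \<in> box p q" "x \<notin> N" for x
    proof (rule ccontr)
      assume "H x \<noteq> 0"
      then obtain d where d: "d > 0" "\<And>h. 0 < h \<and> h < d \<Longrightarrow> 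
        norm (integral (cbox x (x + h *\<^sub>R One)) f /\<^sub>R h ^ DIM('a) - f x) < norm (H x)"
        using N(2)[OF x(2), of "norm (H x)"] by auto
      obtain r where r: "r > 0" "ball x r \<subseteq> box p q" using open_box x(1) openE by blast
      \<comment> \<open>The first bound keeps \<open>h < d\<close>; the second keeps the cube with
        corner \<open>x\<close> and diagonal \<open>h * norm One\<close> inside the ball of radius
        \<open>r\<close>.\<close>
      define h where "h = min (d / 2) (r / (2 * norm (One :: 'a)))"
      have One0: "norm (One::'a) > 0" by (simp add: norm_eq_sqrt_inner) 
      have h: "h > 0" "h < d" using d(1) r(1) One0 by (auto simp: h_def min_less_iff_disj)
      have "h * norm (One::'a) \<le> r / (2 * norm (One :: 'a)) * norm (One :: 'a)"
        unfolding h_def by (rule mult_right_mono) auto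
      then have hr: "h * norm (One::'a) < r" using r(1) One0 by simp
      have sub: "cbox x (x + h *\<^sub>R One) \<subseteq> D"
      proof
        fix y assume y: "y \<in> cbox x (x + h *\<^sub>R One)"
        have "norm (y - x) \<le> norm (h *\<^sub>R (One::'a))"
          by (rule norm_le_componentwise) (use y h(1) in \<open>auto simp: mem_box inner_simps\<close>)
        then have "y \<in> ball x r" using h hr by (simp add: dist_norm norm_minus_commute)
        then show "y \<in> D" using r(2) box_subset_cbox D by blast
      qed
      have "integral (cbox x (x + h *\<^sub>R One)) f = integral (cbox x (x + h *\<^sub>R One)) H"
        by (rule integral_cong) (use sub in \<open>auto simp: f_def\<close>)
      also have "\<dots> = integral (box x (x + h *\<^sub>R One)) H" by (simp add: integral_open_interval)
      also have "\<dots> = (LINT x:box x (x + h *\<^sub>R One)|lebesgue. H x)"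
        by (rule set_lebesgue_integral_eq_integral(2)[symmetric], rule set_integrable_subset[OF H[OF compact_cbox]])
          (use sub D box_subset_cbox[of x "x + h *\<^sub>R One"] in auto)
      also have "\<dots> = 0" by (rule box0) (use sub D in auto)
      finally show False using d(2)[of h] h x(1) D box_subset_cbox[of p q] by (auto simp: f_def)
    qed
    have "negligible (N \<union> (cbox p q - box p q))"
      using N(1) negligible_frontier_interval by (simp add: negligible_Un)
    then have "AE x in lebesgue. x \<notin> N \<union> (cbox p q - box p q)"
      unfolding negligible_iff_null_sets by (rule AE_not_in)
    then show ?thesis by eventually_elim (use z D in auto)
  qed
  obtain \<D> where \<D>: "countable \<D>" "\<D> \<subseteq> Pow U" "\<And>X. X \<in> \<D> \<Longrightarrow> \<exists>a b. X = cbox a b" "\<Union>\<D> = U"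
    by (metis open_countable_Union_open_cbox[OF U])
  have "AE x in lebesgue. \<forall>X\<in>\<D>. x \<in> X \<longrightarrow> H x = 0"
    unfolding AE_ball_countable[OF \<D>(1)]
  proof
    fix X assume "X \<in> \<D>"
    then obtain a b where "X = cbox a b" "X \<subseteq> U" using \<D>(2,3) by blast
    then show "AE x in lebesgue. x \<in> X \<longrightarrow> H x = 0" by (rule D)
  qed
  then show ?thesis by eventually_elim (use \<D>(4) in blast)
qed

lemma has_weak_grad_unique:
  assumes "open U" "has_weak_grad U v G" "has_weak_grad U v H"
  shows "AE x in lebesgue. x \<in> U \<longrightarrow> G x = H x"
proof -
  have "has_weak_grad U (\<lambda>_. 0) (\<lambda>x. G x - H x)"
    using has_weak_grad_diff[OF assms(2,3)] by simp
  from has_weak_grad_zero_AE[OF assms(1) this] show ?thesis by eventually_elim simp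
qed

lemma weak_grad_AE:
  assumes "open U" "has_weak_grad U v G"
  shows "AE x in lebesgue. x \<in> U \<longrightarrow> weak_grad U v x = G x"
proof (rule has_weak_grad_unique[OF assms(1) _ assms(2)])
  show "has_weak_grad U v (weak_grad U v)" unfolding weak_grad_def by (rule someI[of "has_weak_grad U v", OF assms(2)])
qed


section \<open>Square-integrable functions and the extension by zero\<close>

lemma square_integrable_imp_set_integrable:
  fixes f :: "'a::euclidean_space \<Rightarrow> 'b::euclidean_space"
  assumes f: "f square_integrable_on U" and K: "compact K"
  shows "set_integrable lebesgue K (\<lambda>x. indicat_real U x *\<^sub>R f x)"
  unfolding set_integrable_def
proof (rule Bochner_Integration.integrable_bound)
  have m: "(\<lambda>x. indicat_real U x *\<^sub>R f x) \<in> borel_measurable lebesgue"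
    and i: "integrable lebesgue (\<lambda>x. indicat_real U x *\<^sub>R (norm (f x))\<^sup>2)"
    using f by (auto simp: square_integrable_on_def set_borel_measurable_def set_integrable_def)
  have k: "integrable lebesgue (indicat_real K)" using lmeasurable_compact[OF K] lmeasurable_iff_integrable by blast
  show "integrable lebesgue (\<lambda>x. indicat_real K x + indicat_real U x *\<^sub>R (norm (f x))\<^sup>2)"
    by (rule Bochner_Integration.integrable_add[OF k i])
  show "(\<lambda>x. indicat_real K x *\<^sub>R indicat_real U x *\<^sub>R f x) \<in> borel_measurable lebesgue"
    by (rule borel_measurable_scaleR[OF borel_measurable_integrable[OF k] m])
  have "norm (f x) \<le> 1 + (norm (f x))\<^sup>2" for x
  proof -
    have "0 \<le> (norm (f x) - 1)\<^sup>2" by simp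
    then have "2 * norm (f x) \<le> 1 + (norm (f x))\<^sup>2" by (simp add: power2_eq_square algebra_simps)
    then show ?thesis using norm_ge_zero[of "f x"] by linarith
  qed
  then show "AE x in lebesgue. norm (indicat_real K x *\<^sub>R indicat_real U x *\<^sub>R f x)
      \<le> norm (indicat_real K x + indicat_real U x *\<^sub>R (norm (f x))\<^sup>2)"
    by (intro AE_I2) (auto simp: indicator_def)
qed

lemma square_integrable_diff:
  fixes f g :: "'a::euclidean_space \<Rightarrow> 'b::euclidean_space"
  assumes f: "f square_integrable_on U" and g: "g square_integrable_on U"
  shows "(\<lambda>x. f x - g x) square_integrable_on U"
proof -
  have fm: "(\<lambda>x. indicat_real U x *\<^sub>R f x) \<in> borel_measurable lebesgue"
    and fi: "integrable lebesgue (\<lambda>x. indicat_real U x *\<^sub>R (norm (f x))\<^sup>2)"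
    using f by (auto simp: square_integrable_on_def set_borel_measurable_def set_integrable_def)
  have gm: "(\<lambda>x. indicat_real U x *\<^sub>R g x) \<in> borel_measurable lebesgue"
    and gi: "integrable lebesgue (\<lambda>x. indicat_real U x *\<^sub>R (norm (g x))\<^sup>2)"
    using g by (auto simp: square_integrable_on_def set_borel_measurable_def set_integrable_def)
  have m: "(\<lambda>x. indicat_real U x *\<^sub>R (f x - g x)) \<in> borel_measurable lebesgue"
    using borel_measurable_diff[OF fm gm] by (simp add: scaleR_diff_right)
  have "integrable lebesgue (\<lambda>x. indicat_real U x *\<^sub>R (norm (f x - g x))\<^sup>2)"
  proof (rule Bochner_Integration.integrable_bound)
    show "integrable lebesgue (\<lambda>x. 2 * (indicat_real U x *\<^sub>R (norm (f x))\<^sup>2) + 2 * (indicat_real U x *\<^sub>R (norm (g x))\<^sup>2))"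
      using fi gi by (intro Bochner_Integration.integrable_add integrable_mult_right)
    have "(\<lambda>x. (norm (indicat_real U x *\<^sub>R (f x - g x)))\<^sup>2) \<in> borel_measurable lebesgue"
      by (intro borel_measurable_power measurable_compose[OF m borel_measurable_norm])
    moreover have "(norm (indicat_real U x *\<^sub>R (f x - g x)))\<^sup>2 = indicat_real U x *\<^sub>R (norm (f x - g x))\<^sup>2" for x
      by (simp add: indicator_def)
    ultimately show "(\<lambda>x. indicat_real U x *\<^sub>R (norm (f x - g x))\<^sup>2) \<in> borel_measurable lebesgue"
      by simp
    have "(norm (f x - g x))\<^sup>2 \<le> 2 * (norm (f x))\<^sup>2 + 2 * (norm (g x))\<^sup>2" for x
    proof -
      have "(norm (f x - g x))\<^sup>2 + (norm (f x + g x))\<^sup>2 = 2 * (norm (f x))\<^sup>2 + 2 * (norm (g x))\<^sup>2"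
        by (simp add: power2_norm_eq_inner inner_simps inner_commute)
      then show ?thesis using zero_le_power2[of "norm (f x + g x)"] by linarith
    qed
    then show "AE x in lebesgue. norm (indicat_real U x *\<^sub>R (norm (f x - g x))\<^sup>2)
      \<le> norm (2 * (indicat_real U x *\<^sub>R (norm (f x))\<^sup>2) + 2 * (indicat_real U x *\<^sub>R (norm (g x))\<^sup>2))"
      by (intro AE_I2) (auto simp: indicator_def)
  qed
  then show ?thesis using m by (auto simp: square_integrable_on_def set_borel_measurable_def set_integrable_def)
qed

lemma square_integrable_continuous_compact_support:
  fixes f :: "'a::euclidean_space \<Rightarrow> 'b::euclidean_space"
  assumes f: "continuous_on UNIV f" and K: "compact K" "\<And>x. x \<notin> K \<Longrightarrow> f x = 0" and U: "open U"
  shows "f square_integrable_on U"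
proof -
  have "f \<in> borel_measurable lebesgue"
    by (intro measurable_completion, subst measurable_lborel2, intro borel_measurable_continuous_onI f)
  then have m: "(\<lambda>x. indicat_real U x *\<^sub>R f x) \<in> borel_measurable lebesgue"
    using U by (intro borel_measurable_scaleR borel_measurable_indicator) auto
  have "set_integrable lebesgue K (\<lambda>x. (norm (f x))\<^sup>2)"
    by (intro set_integrable_continuous K continuous_intros f)
  then have "integrable lebesgue (\<lambda>x. (norm (f x))\<^sup>2)"
    unfolding set_integrable_def
    by (rule Bochner_Integration.integrable_cong[THEN iffD1, rotated -1]) (use K(2) in \<open>auto simp: indicator_def\<close>)
  then have "set_integrable lebesgue U (\<lambda>x. (norm (f x))\<^sup>2)"
    unfolding set_integrable_def using U by (intro integrable_mult_indicator) auto
  then show ?thesis using m by (auto simp: square_integrable_on_def set_borel_measurable_def)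
qed

text \<open>A Cauchy--Schwarz bound, up to the constant, from
  \<open>\<bar>f\<bar> \<le> \<epsilon>/2 + \<bar>f\<bar>\<^sup>2/(2\<epsilon>)\<close> with \<open>\<epsilon>\<close> at least the norm of \<open>f\<close>.\<close>

lemma norm_integral_le_L2_norm:
  fixes f :: "'a::euclidean_space \<Rightarrow> 'b::euclidean_space" and q :: "'a \<Rightarrow> 'c::euclidean_space"
  assumes f: "f square_integrable_on U" and K: "compact K" and C: "0 \<le> C"
    and q: "\<And>x. norm (q x) \<le> C * (indicat_real U x * norm (f x))"
  shows "norm (LINT x:K|lebesgue. q x) \<le> C * (measure lebesgue K + 1) * L2_norm U f"
proof -
  have i: "integrable lebesgue (\<lambda>x. indicat_real U x *\<^sub>R (norm (f x))\<^sup>2)"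
    using f by (auto simp: square_integrable_on_def set_integrable_def)
  have k: "integrable lebesgue (indicat_real K)" using lmeasurable_compact[OF K] lmeasurable_iff_integrable by blast
  have L: "(L2_norm U f)\<^sup>2 = (LINT x|lebesgue. indicat_real U x *\<^sub>R (norm (f x))\<^sup>2)"
    unfolding L2_norm_def set_lebesgue_integral_def by (rule real_sqrt_pow2) (simp add: Bochner_Integration.integral_nonneg)
  have L0: "0 \<le> L2_norm U f" unfolding L2_norm_def set_lebesgue_integral_def by (simp add: Bochner_Integration.integral_nonneg)
  have *: "norm (LINT x:K|lebesgue. q x) \<le> C * (measure lebesgue K + 1) * e" if e: "e > 0" "L2_norm U f \<le> e" for e
  proof -
    have pt: "norm (f x) \<le> e + (1 / e) * (norm (f x))\<^sup>2" for x
    proof -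
      have "e * norm (f x) \<le> e\<^sup>2 + (norm (f x))\<^sup>2"
      proof -
        have "0 \<le> (norm (f x) - e)\<^sup>2" by simp
        then have "2 * (e * norm (f x)) \<le> e\<^sup>2 + (norm (f x))\<^sup>2" by (simp add: power2_eq_square algebra_simps)
        moreover have "0 \<le> e * norm (f x)" using e(1) by simp
        ultimately show ?thesis by linarith
      qed
      then show ?thesis using e(1) by (simp add: field_simps power2_eq_square)
    qed
    have "norm (LINT x:K|lebesgue. q x) \<le> (LINT x|lebesgue. norm (indicat_real K x *\<^sub>R q x))"
      unfolding set_lebesgue_integral_def by (rule integral_norm_bound)
    also have "\<dots> \<le> (LINT x|lebesgue. C * e * indicat_real K x + C / e * (indicat_real U x *\<^sub>R (norm (f x))\<^sup>2))"
    proof (rule integral_mono')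
      show "integrable lebesgue (\<lambda>x. C * e * indicat_real K x + C / e * (indicat_real U x *\<^sub>R (norm (f x))\<^sup>2))"
        using k i by (intro Bochner_Integration.integrable_add integrable_mult_right)
      show "norm (indicat_real K x *\<^sub>R q x) \<le> C * e * indicat_real K x + C / e * (indicat_real U x *\<^sub>R (norm (f x))\<^sup>2)" for x
      proof (cases "x \<in> K \<and> x \<in> U")
        case True
        then have "norm (q x) \<le> C * norm (f x)" using q[of x] by simp
        also have "\<dots> \<le> C * (e + (1 / e) * (norm (f x))\<^sup>2)" by (rule mult_left_mono[OF pt C])
        finally show ?thesis using True by (simp add: algebra_simps)
      next
        case False
        then have "norm (indicat_real K x *\<^sub>R q x) = 0" using q[of x] by (auto simp: indicator_def)
        moreover have "0 \<le> C * e * indicat_real K x + C / e * (indicat_real U x *\<^sub>R (norm (f x))\<^sup>2)"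
          using C e by simp
        ultimately show ?thesis by linarith
      qed
      show "0 \<le> C * e * indicat_real K x + C / e * (indicat_real U x *\<^sub>R (norm (f x))\<^sup>2)" for x using C e by simp
    qed
    also have "\<dots> = C * e * measure lebesgue K + C / e * (L2_norm U f)\<^sup>2"
      using k i by (simp add: L)
    also have "C / e * (L2_norm U f)\<^sup>2 \<le> C / e * e\<^sup>2"
      using C e L0 by (intro mult_left_mono power_mono) auto
    finally show ?thesis using e(1) by (simp add: algebra_simps power2_eq_square)
  qed
  show ?thesis
  \<comment> \<open>The preceding bound needs a positive \<open>e\<close>. For zero norm,
    \<open>e\<close> cannot be the norm itself and is sent to 0; the denominator
    \<open>B + 1\<close> instead of \<open>B\<close> covers \<open>B = 0\<close>.\<close>
  proof (cases "L2_norm U f = 0")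
    case True
    have le: "norm (LINT x:K|lebesgue. q x) \<le> 0 + e" if e: "e > 0" for e
    proof -
      define B where "B = C * (measure lebesgue K + 1)"
      have B: "0 \<le> B" using C by (simp add: B_def)
      have "norm (LINT x:K|lebesgue. q x) \<le> B * (e / (B + 1))"
        using *[of "e / (B + 1)"] e B True by (simp add: B_def)
      also have "\<dots> \<le> e" using e B by (simp add: field_simps)
      finally show ?thesis by simp
    qed
    have "norm (LINT x:K|lebesgue. q x) \<le> 0" by (rule field_le_epsilon[OF le])
    then show ?thesis using True by simp
  next
    case False
    then show ?thesis using *[of "L2_norm U f"] L0 by simp
  qed
qed

text \<open>Test functions vanish off \<open>U\<close>, so the approximants satisfy the weak
  gradient identity on the whole space. The defect of this identity for the extension of
  \<open>z\<close> is bounded by their H1 distance to \<open>z\<close>, which tends to 0.\<close>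

lemma sobolev_H10_zero_extension:
  assumes U: "open U" and z: "z \<in> sobolev_H10 U" and G: "has_weak_grad U z G"
  shows "has_weak_grad UNIV (\<lambda>x. indicat_real U x * z x) (\<lambda>x. indicat_real U x *\<^sub>R G x)"
proof -
  \<comment> \<open>The estimates need a square-integrable weak gradient, which membership in the
    space provides; uniqueness replaces it by \<open>G\<close> at the end.\<close>
  obtain G' where G': "has_weak_grad U z G'" "G' square_integrable_on U" and z2: "z square_integrable_on U"
    using z by (auto simp: sobolev_H10_def sobolev_H1_def)
  obtain \<phi> where \<phi>: "\<And>n. \<phi> n \<in> test_functions U" and lim: "(\<lambda>n. H1_norm U (\<lambda>x. \<phi> n x - z x)) \<longlonglongrightarrow> 0"
    using z by (auto simp: sobolev_H10_def)
  let ?d = "\<lambda>n x. \<phi> n x - z x" and ?D = "\<lambda>n x. classical_grad (\<phi> n) x - G' x"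
  have sq: "?d n square_integrable_on U" "?D n square_integrable_on U" for n
  proof -
    obtain K where K: "compact K" "K \<subseteq> U" "\<And>x. x \<notin> K \<Longrightarrow> \<phi> n x = 0" "\<And>x. x \<notin> K \<Longrightarrow> classical_grad (\<phi> n) x = 0"
      using test_function_support[OF \<phi>[of n]] by metis
    show "?d n square_integrable_on U"
      by (rule square_integrable_diff[OF square_integrable_continuous_compact_support[OF 
          test_function_continuous[OF \<phi>] K(1) K(3) U] z2])
    show "?D n square_integrable_on U"
      by (rule square_integrable_diff[OF square_integrable_continuous_compact_support[OF 
          test_function_grad_continuous[OF \<phi>] K(1) K(4) U] G'(2)])
  qed
  have off: "\<phi> n x = 0" "classical_grad (\<phi> n) x = 0" if "x \<notin> U" for n x
    using test_function_support[OF \<phi>[of n]] that by (metis subsetD)+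
  have L: "L2_norm U (?d n) \<le> H1_norm U (?d n)" "L2_norm U (?D n) \<le> H1_norm U (?d n)" for n
  proof -
    \<comment> \<open>\<open>H1_norm\<close> involves the chosen weak gradient of the difference;
      uniqueness identifies its norm with that of \<open>?D n\<close>.\<close>
    have "has_weak_grad U (?d n) (?D n)"
      by (rule has_weak_grad_diff[OF has_weak_grad_test_function[OF \<phi>] G'(1)])
    from weak_grad_AE[OF U this] have "AE x in lebesgue. x \<in> U \<longrightarrow> (norm (weak_grad U (?d n) x))\<^sup>2 = (norm (?D n x))\<^sup>2"
      by eventually_elim simp
    from set_lebesgue_cong_AE(1)[OF this] have e: "H1_seminorm U (?d n) = L2_norm U (?D n)"
      by (simp add: H1_seminorm_def L2_norm_def)
    show "L2_norm U (?d n) \<le> H1_norm U (?d n)" "L2_norm U (?D n) \<le> H1_norm U (?d n)"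
      unfolding H1_norm_def e by (auto intro!: real_le_rsqrt)
  qed
  have "has_weak_grad UNIV (\<lambda>x. indicat_real U x * z x) (\<lambda>x. indicat_real U x *\<^sub>R G' x)"
  proof (rule has_weak_gradI)
    fix K :: "'a set" assume K: "compact K"
    show "set_integrable lebesgue K (\<lambda>x. indicat_real U x * z x) \<and> set_integrable lebesgue K (\<lambda>x. indicat_real U x *\<^sub>R G' x)"
      using square_integrable_imp_set_integrable[OF z2 K] square_integrable_imp_set_integrable[OF G'(2) K] by simp
  next
    fix \<psi> and K :: "'a set" 
    assume K: "\<psi> \<in> test_functions UNIV" "compact K" "K \<subseteq> UNIV"
      "\<And>x. x \<notin> K \<Longrightarrow> \<psi> x = 0" "\<And>x. x \<notin> K \<Longrightarrow> classical_grad \<psi> x = 0"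
    let ?p = "\<lambda>x. (indicat_real U x * z x) *\<^sub>R classical_grad \<psi> x" and ?q = "\<lambda>x. \<psi> x *\<^sub>R (indicat_real U x *\<^sub>R G' x)"
    note cp = test_function_continuous[OF K(1), of UNIV] and cg = test_function_grad_continuous[OF K(1), of UNIV]
    have ip: "set_integrable lebesgue K ?p"
      using square_integrable_imp_set_integrable[OF z2 K(2)] by (intro set_integrable_scaleR_continuous' K cg) simp
    have iq: "set_integrable lebesgue K ?q"
      by (intro set_integrable_scaleR_continuous K cp square_integrable_imp_set_integrable[OF G'(2)])
    obtain C1 where C1: "\<And>x. norm (classical_grad \<psi> x) \<le> C1"
      using continuous_compact_support_bounded[OF cg K(2,5)] by blast
    obtain C2 where C2: "\<And>x. norm (\<psi> x) \<le> C2"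
      using continuous_compact_support_bounded[OF cp K(2,4)] by blast
    have C0: "0 \<le> C1" "0 \<le> C2" using order_trans[OF norm_ge_zero C1] order_trans[OF norm_ge_zero C2] by auto
    define S where "S = (LINT x:K|lebesgue. ?p x) + (LINT x:K|lebesgue. ?q x)"
    have S: "norm S \<le> (C1 + C2) * (measure lebesgue K + 1) * H1_norm U (?d n)" for n
    proof -
      have a: "(LINT x:K|lebesgue. \<phi> n x *\<^sub>R classical_grad \<psi> x) = - (LINT x:K|lebesgue. \<psi> x *\<^sub>R classical_grad (\<phi> n) x)"
        "set_integrable lebesgue K (\<lambda>x. \<phi> n x *\<^sub>R classical_grad \<psi> x)"
        "set_integrable lebesgue K (\<lambda>x. \<psi> x *\<^sub>R classical_grad (\<phi> n) x)"
        by (rule has_weak_gradD[OF has_weak_grad_test_function[OF \<phi>[of n]] K(1,2,3)]; erule K(4,5))+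
      \<comment> \<open>The two terms subtracted here cancel by the weak gradient identity for
        \<open>\<phi> n\<close>.\<close>
      have S: "S = (LINT x:K|lebesgue. ?p x - \<phi> n x *\<^sub>R classical_grad \<psi> x) + (LINT x:K|lebesgue. ?q x - \<psi> x *\<^sub>R classical_grad (\<phi> n) x)"
      proof -
        have "P + R = (P - - Q) + (R - Q)" for P Q R :: 'a by simp
        moreover have "(LINT x:K|lebesgue. ?p x - \<phi> n x *\<^sub>R classical_grad \<psi> x) =
          (LINT x:K|lebesgue. ?p x) - - (LINT x:K|lebesgue. \<psi> x *\<^sub>R classical_grad (\<phi> n) x)"
          unfolding a(1)[symmetric] by (rule set_integral_diff(2)[OF ip a(2)])
        moreover have "(LINT x:K|lebesgue. ?q x - \<psi> x *\<^sub>R classical_grad (\<phi> n) x) =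
          (LINT x:K|lebesgue. ?q x) - (LINT x:K|lebesgue. \<psi> x *\<^sub>R classical_grad (\<phi> n) x)"
          by (rule set_integral_diff(2)[OF iq a(3)])
        ultimately show ?thesis unfolding S_def by (simp only:)
      qed
      have "norm (LINT x:K|lebesgue. ?p x - \<phi> n x *\<^sub>R classical_grad \<psi> x) \<le> C1 * (measure lebesgue K + 1) * L2_norm U (?d n)"
      proof (rule norm_integral_le_L2_norm[OF sq(1) K(2) C0(1)])
        fix x
        have "?p x - \<phi> n x *\<^sub>R classical_grad \<psi> x = (- indicat_real U x * ?d n x) *\<^sub>R classical_grad \<psi> x"
          by (cases "x \<in> U") (auto simp: off scaleR_diff_left)
        then show "norm (?p x - \<phi> n x *\<^sub>R classical_grad \<psi> x) \<le> C1 * (indicat_real U x * norm (?d n x))"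
          using mult_right_mono[OF C1[of x], of "indicat_real U x * norm (?d n x)"] by (simp add: abs_mult ac_simps)
      qed
      also have "\<dots> \<le> C1 * (measure lebesgue K + 1) * H1_norm U (?d n)"
        using C0 by (intro mult_left_mono L) simp
      finally have 1: "norm (LINT x:K|lebesgue. ?p x - \<phi> n x *\<^sub>R classical_grad \<psi> x) \<le> C1 * (measure lebesgue K + 1) * H1_norm U (?d n)" .
      have "norm (LINT x:K|lebesgue. ?q x - \<psi> x *\<^sub>R classical_grad (\<phi> n) x) \<le> C2 * (measure lebesgue K + 1) * L2_norm U (?D n)"
      proof (rule norm_integral_le_L2_norm[OF sq(2) K(2) C0(2)])
        fix x
        have "?q x - \<psi> x *\<^sub>R classical_grad (\<phi> n) x = (- indicat_real U x * \<psi> x) *\<^sub>R ?D n x"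
          by (cases "x \<in> U") (auto simp: off scaleR_diff_right)
        then show "norm (?q x - \<psi> x *\<^sub>R classical_grad (\<phi> n) x) \<le> C2 * (indicat_real U x * norm (?D n x))"
          using mult_right_mono[OF C2[of x], of "indicat_real U x * norm (?D n x)"] by (simp add: abs_mult ac_simps)
      qed
      also have "\<dots> \<le> C2 * (measure lebesgue K + 1) * H1_norm U (?d n)"
        using C0 by (intro mult_left_mono L) simp
      finally have 2: "norm (LINT x:K|lebesgue. ?q x - \<psi> x *\<^sub>R classical_grad (\<phi> n) x) \<le> C2 * (measure lebesgue K + 1) * H1_norm U (?d n)" .
      show ?thesis unfolding S using norm_triangle_le[OF add_mono[OF 1 2]] by (simp add: algebra_simps)
    qed
    have "norm S \<le> (C1 + C2) * (measure lebesgue K + 1) * 0"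
      by (rule LIMSEQ_le_const[OF tendsto_mult_left[OF lim]]) (use S in auto)
    then show "(LINT x:K|lebesgue. ?p x) = - (LINT x:K|lebesgue. ?q x)"
      by (simp add: S_def eq_neg_iff_add_eq_0)
  qed
  then show ?thesis
    by (rule has_weak_grad_cong)
      (use has_weak_grad_unique[OF U G'(1) G] in \<open>eventually_elim, auto simp: indicator_def\<close>)
qed

section \<open>Absence of jumps across a hyperplane\<close>

lemma test_function_set_integral:
  assumes "\<phi> \<in> test_functions U" "has_weak_grad U v G"
  shows "(LINT x:U|lebesgue. v x * (classical_grad \<phi> x \<bullet> b)) = - (LINT x:U|lebesgue. \<phi> x * (G x \<bullet> b))"
proof -
  obtain K where K: "compact K" "K \<subseteq> U" "\<And>x. x \<notin> K \<Longrightarrow> \<phi> x = 0" "\<And>x. x \<notin> K \<Longrightarrow> classical_grad \<phi> x = 0"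
    using test_function_support[OF assms(1)] by metis
  have a: "(LINT x:K|lebesgue. v x *\<^sub>R classical_grad \<phi> x) = - (LINT x:K|lebesgue. \<phi> x *\<^sub>R G x)"
    "set_integrable lebesgue K (\<lambda>x. v x *\<^sub>R classical_grad \<phi> x)"
    "set_integrable lebesgue K (\<lambda>x. \<phi> x *\<^sub>R G x)"
    by (rule has_weak_gradD[OF assms(2,1) K(1,2)]; erule K(3,4))+
  have "(LINT x:U|lebesgue. v x * (classical_grad \<phi> x \<bullet> b)) = (LINT x:K|lebesgue. v x * (classical_grad \<phi> x \<bullet> b))"
    by (rule set_integral_support[OF K(2)]) (simp add: K)
  also have "\<dots> = (LINT x:K|lebesgue. v x *\<^sub>R classical_grad \<phi> x) \<bullet> b"
    using integral_inner_left[of b lebesgue "\<lambda>x. indicat_real K x *\<^sub>R v x *\<^sub>R classical_grad \<phi> x"] a(2)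
    by (simp add: set_lebesgue_integral_def set_integrable_def mult.assoc)
  also have "\<dots> = - ((LINT x:K|lebesgue. \<phi> x *\<^sub>R G x) \<bullet> b)" unfolding a(1) by simp
  also have "(LINT x:K|lebesgue. \<phi> x *\<^sub>R G x) \<bullet> b = (LINT x:K|lebesgue. \<phi> x * (G x \<bullet> b))"
    using integral_inner_left[of b lebesgue "\<lambda>x. indicat_real K x *\<^sub>R \<phi> x *\<^sub>R G x"] a(3)
    by (simp add: set_lebesgue_integral_def set_integrable_def mult.assoc)
  also have "\<dots> = (LINT x:U|lebesgue. \<phi> x * (G x \<bullet> b))"
    by (rule set_integral_support[OF K(2), symmetric]) (simp add: K)
  finally show ?thesis .
qed

text \<open>Translating a bump across the hyperplane makes the weak gradient identity a differential
  inequality: with \<open>m t\<close> the integral of \<open>a \<bullet> x + c\<close> against the translated bump over the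
  half-space and \<open>k t\<close> that of \<open>1\<close>, one has \<open>m' = - (a \<bullet> n) k\<close> and \<open>k t \<le> k 0\<close>, and \<open>m\<close> vanishes as
  soon as the bump has left the half-space. So \<open>m 0\<close> is of lower order than \<open>k 0\<close> for small bumps.\<close>

lemma weak_grad_half_space_no_jump:
  fixes a p n :: "'a::euclidean_space"
  assumes n: "norm n = 1" and r: "r > 0"
    and wg: "has_weak_grad (ball p r) (\<lambda>x. indicat_real {x. n \<bullet> x > n \<bullet> p} x * (a \<bullet> x + c))
      (\<lambda>x. indicat_real {x. n \<bullet> x > n \<bullet> p} x *\<^sub>R a)"
  shows "a \<bullet> p + c = 0"
proof (rule ccontr)
  assume "a \<bullet> p + c \<noteq> 0"
  define l where "l = \<bar>a \<bullet> p + c\<bar>"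
  define s where "s = sgn (a \<bullet> p + c)"
  have l: "l > 0" using \<open>a \<bullet> p + c \<noteq> 0\<close> by (simp add: l_def)
  have s: "\<bar>s\<bar> = 1" "s * (a \<bullet> p + c) = l" using \<open>a \<bullet> p + c \<noteq> 0\<close> by (auto simp: s_def l_def abs_sgn_eq sgn_if)
  \<comment> \<open>The bump lives in the ball of radius \<delta> and is moved by at most 2
    \<delta>, so r/4 keeps it inside \<open>ball p r\<close>. The other bound gives
    \<open>4 * \<delta> * norm a < l\<close>, which contradicts the final estimate
    \<open>l \<le> 3 * (\<delta> * norm a)\<close>.\<close>
  define \<delta> where "\<delta> = min (r / 4) (l / (4 * (norm a + 1)))"
  have \<delta>: "\<delta> > 0" "4 * \<delta> \<le> r" using r l norm_ge_zero[of a] by (auto simp: \<delta>_def add_nonneg_pos)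
  have \<delta>a: "4 * \<delta> * norm a < l"
  proof -
    have "\<delta> \<le> l / (4 * (norm a + 1))" by (simp add: \<delta>_def)
    then have "4 * \<delta> * (norm a + 1) \<le> l" using norm_ge_zero[of a] by (simp add: field_simps add_nonneg_pos)
    then show ?thesis using \<delta>(1) by (simp add: algebra_simps)
  qed
  define H where "H = {x. n \<bullet> x > n \<bullet> p}"
  have oH: "open H" unfolding H_def by (rule open_halfspace_gt)
  then have H[measurable]: "H \<in> sets borel" by (rule borel_open)
  \<comment> \<open>Radius \<delta>/2 for the open box leaves room for its closure in the open ball
    of radius \<delta>.\<close>
  obtain \<alpha> \<gamma> where box: "p \<in> box \<alpha> \<gamma>" "box \<alpha> \<gamma> \<subseteq> ball p (\<delta> / 2)"
    using rational_boxes[of "\<delta> / 2" p] \<delta> by auto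
  have "cbox \<alpha> \<gamma> = closure (box \<alpha> \<gamma>)" using box(1) by (intro closure_box[symmetric]) auto
  also have "\<dots> \<subseteq> closure (ball p (\<delta> / 2))" by (rule closure_mono) fact
  also have "\<dots> \<subseteq> ball p \<delta>" using \<delta> by (auto simp: closure_ball)
  finally have cbox: "cbox \<alpha> \<gamma> \<subseteq> ball p \<delta>" .
  define \<phi> where "\<phi> = bump \<alpha> \<gamma> (Suc 0)"
  have \<phi>t: "\<phi> \<in> test_functions UNIV" unfolding \<phi>_def by (rule bump_in_test_functions) auto
  have \<phi>0: "\<phi> x = 0" if "x \<notin> ball p \<delta>" for x
    using that bump_nonzero[of "Suc 0" \<alpha> \<gamma> x] box_subset_cbox[of \<alpha> \<gamma>] cbox by (auto simp: \<phi>_def)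
  have \<phi>nonneg: "0 \<le> \<phi> x" for x by (simp add: \<phi>_def bump_bounds)
  define w where "w x = indicat_real (ball p r \<inter> H) x * (a \<bullet> x + c)" for x
  define h where "h x = indicat_real (ball p r \<inter> H) x" for x
  have sets: "ball p r \<inter> H \<in> sets lebesgue" using H by auto
  have inth: "integrable lebesgue (\<lambda>x. h x * f x)" if f: "continuous_on UNIV f" for f :: "'a \<Rightarrow> real"
  proof -
    have "set_integrable lebesgue (cball p r) f" by (rule set_integrable_continuous[OF compact_cball f])
    moreover have "ball p r \<inter> H \<subseteq> cball p r" by auto
    ultimately have "set_integrable lebesgue (ball p r \<inter> H) f" using set_integrable_subset[OF _ sets] by blast
    then show ?thesis by (simp add: set_integrable_def h_def)
  qed
  have intw: "integrable lebesgue w"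
    using inth[of "\<lambda>x. a \<bullet> x + c"] by (simp add: w_def[abs_def] h_def continuous_intros)
  have inth1: "integrable lebesgue h" using inth[of "\<lambda>_. 1"] by simp
  \<comment> \<open>The argument \<open>x + t *\<^sub>R n\<close> moves the bump by
    \<open>- t *\<^sub>R n\<close>, out of the half-space \<open>H\<close>.\<close>
  define m where "m t = (LINT x|lebesgue. w x * \<phi> (x + t *\<^sub>R n))" for t
  define k where "k t = (LINT x|lebesgue. h x * \<phi> (x + t *\<^sub>R n))" for t
  obtain K where K: "compact K" "\<And>x. x \<notin> K \<Longrightarrow> \<phi> x = 0" "\<And>x. x \<notin> K \<Longrightarrow> classical_grad \<phi> x = 0"
    using test_function_support[OF \<phi>t] by metis
  obtain C where C: "\<And>x. norm (classical_grad \<phi> x) \<le> C" 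
    using continuous_compact_support_bounded[OF test_function_grad_continuous[OF \<phi>t] K(1,3)] by blast
  have DERIV_m: "(m has_real_derivative - (a \<bullet> n) * k t) (at t)" if t: "0 \<le> t" "t \<le> 2 * \<delta>" for t
  proof -
    define \<psi> where "\<psi> = bump (\<alpha> - t *\<^sub>R n) (\<gamma> - t *\<^sub>R n) (Suc 0)"
    have \<psi>\<phi>: "\<psi> x = \<phi> (x + t *\<^sub>R n)" for x by (simp add: \<psi>_def \<phi>_def bump_shift)
    have "cbox (\<alpha> - t *\<^sub>R n) (\<gamma> - t *\<^sub>R n) \<subseteq> ball p r"
    proof
      fix x assume "x \<in> cbox (\<alpha> - t *\<^sub>R n) (\<gamma> - t *\<^sub>R n)"
      then have "x + t *\<^sub>R n \<in> cbox \<alpha> \<gamma>" by (auto simp: mem_box inner_simps algebra_simps)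
      then have "norm (x + t *\<^sub>R n - p) < \<delta>" using cbox by (auto simp: dist_norm norm_minus_commute)
      moreover have "norm (t *\<^sub>R n) \<le> 2 * \<delta>" using t n by simp
      moreover have "norm (x - p) \<le> norm (x + t *\<^sub>R n - p) + norm (t *\<^sub>R n)"
        using norm_triangle_ineq4[of "x + t *\<^sub>R n - p" "t *\<^sub>R n"] by simp
      ultimately have "norm (x - p) < r" using \<delta> by linarith
      then show "x \<in> ball p r" by (simp add: dist_norm norm_minus_commute)
    qed
    then have \<psi>: "\<psi> \<in> test_functions (ball p r)" unfolding \<psi>_def by (intro bump_in_test_functions) auto
    have grad: "classical_grad \<psi> x = classical_grad \<phi> (x + t *\<^sub>R n)" for x
    proof (rule has_derivative_classical_grad)
      have "((\<lambda>x. x + t *\<^sub>R n) has_derivative (\<lambda>h. h)) (at x)" by (auto intro!: derivative_eq_intros)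
      from has_derivative_compose[OF this test_function_has_derivative[OF \<phi>t]]
      have "((\<lambda>x. \<phi> (x + t *\<^sub>R n)) has_derivative (\<lambda>h. classical_grad \<phi> (x + t *\<^sub>R n) \<bullet> h)) (at x)" .
      moreover have "(\<lambda>x. \<phi> (x + t *\<^sub>R n)) = \<psi>" by (auto simp: \<psi>\<phi>)
      ultimately show "(\<psi> has_derivative (\<lambda>h. classical_grad \<phi> (x + t *\<^sub>R n) \<bullet> h)) (at x)" by simp
    qed
    have "(LINT x|lebesgue. w x * (classical_grad \<phi> (x + t *\<^sub>R n) \<bullet> n)) =
      (LINT x:ball p r|lebesgue. (indicat_real {x. n \<bullet> x > n \<bullet> p} x * (a \<bullet> x + c)) * (classical_grad \<psi> x \<bullet> n))"
      unfolding set_lebesgue_integral_def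
      by (intro Bochner_Integration.integral_cong) (auto simp: w_def H_def indicator_def grad)
    also have "\<dots> = - (LINT x:ball p r|lebesgue. \<psi> x * ((indicat_real {x. n \<bullet> x > n \<bullet> p} x *\<^sub>R a) \<bullet> n))"
      by (rule test_function_set_integral[OF \<psi> wg])
    also have "(LINT x:ball p r|lebesgue. \<psi> x * ((indicat_real {x. n \<bullet> x > n \<bullet> p} x *\<^sub>R a) \<bullet> n)) =
      (LINT x|lebesgue. (a \<bullet> n) * (h x * \<phi> (x + t *\<^sub>R n)))"
      unfolding set_lebesgue_integral_def
      by (intro Bochner_Integration.integral_cong) (auto simp: h_def H_def indicator_def \<psi>\<phi>)
    also have "\<dots> = (a \<bullet> n) * k t" by (simp add: k_def)
    finally have e: "(LINT x|lebesgue. w x * (classical_grad \<phi> (x + t *\<^sub>R n) \<bullet> n)) = - (a \<bullet> n) * k t" by simp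
    have "(m has_real_derivative (LINT x|lebesgue. w x * (classical_grad \<phi> (x + t *\<^sub>R n) \<bullet> n))) (at t)"
      unfolding m_def[abs_def]
    proof (rule DERIV_integral_shift[OF intw test_function_has_derivative[OF \<phi>t] test_function_grad_continuous[OF \<phi>t] C])
      show "\<bar>\<phi> x\<bar> \<le> 1" for x using bump_bounds[of \<alpha> \<gamma> "Suc 0" x] by (simp add: \<phi>_def)
    qed
    then show ?thesis unfolding e .
  qed
  \<comment> \<open>After substitution the indicator is evaluated at
    \<open>y - t *\<^sub>R n\<close>; if that point lies in \<open>H\<close>, then so does
    \<open>y\<close>.\<close>
  have k_mono: "k t \<le> k 0" if t: "0 \<le> t" for t
  proof -
    have [measurable]: "\<phi> \<in> borel_measurable borel" 
      by (intro borel_measurable_continuous_onI test_function_continuous[OF \<phi>t])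
    have [measurable]: "h \<in> borel_measurable borel"
      unfolding h_def[abs_def] using oH by (intro borel_measurable_indicator) auto
    have "k t = (LINT x|lborel. h x * \<phi> (x + t *\<^sub>R n))" unfolding k_def by (rule integral_completion) measurable
    also have "\<dots> = (LINT y|lborel. h (y - t *\<^sub>R n) * \<phi> y)"
      by (subst (2) lborel_distr_plus[of "t *\<^sub>R n", symmetric]) (simp add: integral_distr add.commute)
    also have "\<dots> \<le> (LINT y|lborel. h y * \<phi> y)"
    proof (rule integral_mono')
      have "integrable lebesgue (\<lambda>y. h y * \<phi> y)" by (rule inth[OF test_function_continuous[OF \<phi>t]])
      then show "integrable lborel (\<lambda>y. h y * \<phi> y)" by (subst (asm) integrable_completion) measurable
      show "0 \<le> h y * \<phi> y" for y by (simp add: h_def \<phi>nonneg)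
      show "h (y - t *\<^sub>R n) * \<phi> y \<le> h y * \<phi> y" for y
      proof (cases "y \<in> ball p \<delta>")
        case True
        have "n \<bullet> n = 1" using n by (simp add: norm_eq_1)
        then have "y \<in> H" if "y - t *\<^sub>R n \<in> H" using that t by (auto simp: H_def inner_simps)
        moreover have "y \<in> ball p r" using True \<delta> by auto
        ultimately have "h (y - t *\<^sub>R n) \<le> h y" by (auto simp: h_def indicator_def)
        then show ?thesis by (rule mult_right_mono) (rule \<phi>nonneg)
      qed (simp add: \<phi>0)
    qed
    also have "\<dots> = (LINT y|lebesgue. h y * \<phi> y)" by (rule integral_completion[symmetric]) measurable
    finally show ?thesis by (simp add: k_def)
  qed
  have int0: "integrable lebesgue (\<lambda>y. h y * \<phi> y)" by (rule inth[OF test_function_continuous[OF \<phi>t]])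
  have k_nonneg: "0 \<le> k t" for t
    unfolding k_def by (intro Bochner_Integration.integral_nonneg) (auto simp: h_def \<phi>nonneg)
  have k_pos: "0 < k 0"
  proof (rule ccontr)
    assume "\<not> 0 < k 0"
    then have "(LINT y|lebesgue. h y * \<phi> y) = 0" using k_nonneg[of 0] by (simp add: k_def)
    then have "AE y in lebesgue. h y * \<phi> y = 0"
      using integral_nonneg_eq_0_iff_AE[OF int0] by (auto simp: h_def \<phi>nonneg)
    then have "AE y in lebesgue. y \<notin> box \<alpha> \<gamma> \<inter> H"
    proof eventually_elim
      case (elim y)
      show ?case
      proof
        assume y: "y \<in> box \<alpha> \<gamma> \<inter> H"
        then have "\<phi> y \<noteq> 0" using bump_nonzero[of "Suc 0" \<alpha> \<gamma> y] by (simp add: \<phi>_def)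
        moreover have "y \<in> ball p r" using y box(2) \<delta> by auto
        ultimately show False using elim y by (simp add: h_def)
      qed
    qed
    then have "negligible (box \<alpha> \<gamma> \<inter> H)"
      unfolding negligible_iff_null_sets completion.null_sets_iff_AE by simp
    moreover have "open (box \<alpha> \<gamma> \<inter> H)" using oH by auto
    moreover have "box \<alpha> \<gamma> \<inter> H \<noteq> {}"
    proof -
      obtain e where e: "e > 0" "ball p e \<subseteq> box \<alpha> \<gamma>" using box(1) open_box openE by blast
      have "p + (e / 2) *\<^sub>R n \<in> ball p e" using e n by (simp add: dist_norm)
      moreover have "p + (e / 2) *\<^sub>R n \<in> H" using e n by (simp add: H_def inner_simps norm_eq_1)
      ultimately show ?thesis using e by blast
    qed
    ultimately show False using open_not_negligible by blast
  qed
  \<comment> \<open>The moved bump is supported within \<delta> of a point that lies at distance 2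
    \<delta> behind the hyperplane.\<close>
  have m_end: "m (2 * \<delta>) = 0"
  proof -
    have w0: "w x * \<phi> (x + (2 * \<delta>) *\<^sub>R n) = 0" for x
    proof (cases "x \<in> H \<and> x + (2 * \<delta>) *\<^sub>R n \<in> ball p \<delta>")
      case True
      then have "norm (x + (2 * \<delta>) *\<^sub>R n - p) < \<delta>" by (auto simp: dist_norm norm_minus_commute)
      moreover have "n \<bullet> (x + (2 * \<delta>) *\<^sub>R n - p) \<le> norm (x + (2 * \<delta>) *\<^sub>R n - p)"
        using norm_cauchy_schwarz[of n "x + (2 * \<delta>) *\<^sub>R n - p"] n by simp
      moreover have "n \<bullet> (x + (2 * \<delta>) *\<^sub>R n - p) = n \<bullet> x - n \<bullet> p + 2 * \<delta>" using n by (simp add: inner_simps norm_eq_1)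
      ultimately show ?thesis using True \<delta>(1) by (auto simp: H_def)
    qed (auto simp: w_def \<phi>0)
    show ?thesis unfolding m_def w0 by simp
  qed
  \<comment> \<open>By Cauchy--Schwarz, within \<delta> of \<open>p\<close> the affine function
    multiplied by \<open>s\<close> stays above its value \<open>l\<close> at \<open>p\<close> minus
    \<open>norm a * \<delta>\<close>.\<close>
  have m_start: "(l - norm a * \<delta>) * k 0 \<le> s * m 0"
  proof -
    have "(l - norm a * \<delta>) * k 0 = (LINT x|lebesgue. (l - norm a * \<delta>) * (h x * \<phi> x))" by (simp add: k_def)
    also have "\<dots> \<le> (LINT x|lebesgue. s * (w x * \<phi> x))"
    proof (rule integral_mono)
      show "integrable lebesgue (\<lambda>x. (l - norm a * \<delta>) * (h x * \<phi> x))" using int0 by simp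
      have "integrable lebesgue (\<lambda>x. h x * ((a \<bullet> x + c) * \<phi> x))"
        by (intro inth continuous_intros test_function_continuous[OF \<phi>t])
      then show "integrable lebesgue (\<lambda>x. s * (w x * \<phi> x))" by (simp add: w_def[abs_def] h_def ac_simps)
      show "(l - norm a * \<delta>) * (h x * \<phi> x) \<le> s * (w x * \<phi> x)" for x
      proof (cases "x \<in> ball p \<delta>")
        case True
        have "\<bar>s * (a \<bullet> (x - p))\<bar> \<le> norm a * norm (x - p)"
          using Cauchy_Schwarz_ineq2[of a "x - p"] s by (simp add: abs_mult)
        also have "\<dots> \<le> norm a * \<delta>" using True by (intro mult_left_mono) (auto simp: dist_norm norm_minus_commute)
        finally have "l - norm a * \<delta> \<le> s * (a \<bullet> x + c)" using s(2) by (simp add: inner_simps algebra_simps)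
        then have "(l - norm a * \<delta>) * (h x * \<phi> x) \<le> s * (a \<bullet> x + c) * (h x * \<phi> x)"
          by (rule mult_right_mono) (simp add: h_def \<phi>nonneg)
        then show ?thesis by (simp add: w_def h_def ac_simps)
      qed (simp add: \<phi>0)
    qed
    also have "\<dots> = s * m 0" by (simp add: m_def)
    finally show ?thesis .
  qed
  have "0 < 2 * \<delta>" using \<delta> by simp
  from MVT2[OF this DERIV_m] obtain z where z: "z > 0" "m (2 * \<delta>) - m 0 = (2 * \<delta> - 0) * (- (a \<bullet> n) * k z)" by auto
  then have "\<bar>m 0\<bar> = 2 * \<delta> * \<bar>a \<bullet> n\<bar> * k z" using m_end \<delta>(1) k_nonneg[of z] by (simp add: abs_mult)
  also have "\<dots> \<le> 2 * \<delta> * norm a * k 0"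
    using k_mono[of z] z(1) Cauchy_Schwarz_ineq2[of a n] n k_nonneg \<delta>(1) by (intro mult_mono) auto
  finally have "\<bar>m 0\<bar> \<le> 2 * \<delta> * norm a * k 0" .
  moreover have "s * m 0 \<le> \<bar>m 0\<bar>" using s(1) abs_ge_self[of "s * m 0"] by (simp add: abs_mult)
  ultimately have "(l - norm a * \<delta>) * k 0 \<le> (2 * \<delta> * norm a) * k 0" using m_start by linarith
  then have "l - norm a * \<delta> \<le> 2 * \<delta> * norm a" using k_pos by simp
  then have "l \<le> 3 * (\<delta> * norm a)" by (simp add: algebra_simps)
  moreover have "0 \<le> \<delta> * norm a" using \<delta>(1) by simp
  ultimately show False using \<delta>a by linarith
qed

text \<open>Subtracting the affine function of the lower side reduces to a function that vanishes
  there; the hyperplane itself is a null set.\<close>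

lemma weak_grad_no_jump:
  fixes p n :: "'a::euclidean_space"
  assumes n: "norm n = 1" and r: "r > 0" and wg: "has_weak_grad (ball p r) Z \<Gamma>"
    and pos: "AE x in lebesgue. x \<in> ball p r \<and> n \<bullet> x > n \<bullet> p \<longrightarrow> Z x = a \<bullet> x + c \<and> \<Gamma> x = a"
    and neg: "AE x in lebesgue. x \<in> ball p r \<and> n \<bullet> x < n \<bullet> p \<longrightarrow> Z x = a' \<bullet> x + c' \<and> \<Gamma> x = a'"
  shows "a \<bullet> p + c = a' \<bullet> p + c'"
proof -
  have "negligible {x. n \<bullet> x = n \<bullet> p}" using n by (intro negligible_hyperplane) auto
  then have "AE x in lebesgue. x \<notin> {x. n \<bullet> x = n \<bullet> p}"
    unfolding negligible_iff_null_sets by (rule AE_not_in)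
  with pos neg have "AE x in lebesgue. x \<in> ball p r \<longrightarrow>
    Z x - (a' \<bullet> x + c') = indicat_real {x. n \<bullet> x > n \<bullet> p} x * ((a - a') \<bullet> x + (c - c')) \<and>
    \<Gamma> x - a' = indicat_real {x. n \<bullet> x > n \<bullet> p} x *\<^sub>R (a - a')"
    by eventually_elim (auto simp: indicator_def inner_simps not_less)
  from has_weak_grad_cong[OF has_weak_grad_diff[OF wg has_weak_grad_affine] this]
  have "(a - a') \<bullet> p + (c - c') = 0" by (rule weak_grad_half_space_no_jump[OF n r])
  then show ?thesis by (simp add: inner_simps)
qed



section \<open>Facets\<close>

text \<open>A point near \<open>p\<close> on the side of \<open>q\<close> lies on the segment from
  \<open>q\<close> to its central projection onto the hyperplane of \<open>F\<close>. The projection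
  is continuous at \<open>p\<close> and fixes \<open>p\<close>, so near \<open>p\<close> it lands in
  \<open>F\<close>, and convexity concludes.\<close>

lemma convex_half_ball_subset:
  fixes T :: "'a::euclidean_space set"
  assumes T: "convex T" and F: "F \<subseteq> T" "affine hull F = {x. n \<bullet> x = n \<bullet> p}"
    and p: "p \<in> rel_interior F" and q: "q \<in> T" "n \<bullet> q > n \<bullet> p"
  obtains e where "e > 0" "ball p e \<inter> {x. n \<bullet> x \<ge> n \<bullet> p} \<subseteq> T"
proof -
  obtain d where d: "d > 0" "ball p d \<inter> affine hull F \<subseteq> F" using p by (auto simp: mem_rel_interior_ball)
  define D where "D = n \<bullet> q - n \<bullet> p"
  have D: "D > 0" using q by (simp add: D_def)
  \<comment> \<open>\<open>t\<close> is the affine function that is 0 on the hyperplane and 1 at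
    \<open>q\<close>; \<open>f\<close> is the projection from \<open>q\<close>.\<close>
  define t where "t x = (n \<bullet> x - n \<bullet> p) / D" for x
  define f where "f x = (x - t x *\<^sub>R q) /\<^sub>R (1 - t x)" for x
  have tp: "t p = 0" by (simp add: t_def)
  have ct: "(t \<longlongrightarrow> 0) (nhds p)"
  proof -
    have "isCont t p" unfolding t_def using D by (intro continuous_intros) auto
    then have "(t \<longlongrightarrow> t p) (nhds p)" by (simp only: continuous_at tendsto_at_iff_tendsto_nhds)
    then show ?thesis by (simp only: tp)
  qed
  have cf: "(f \<longlongrightarrow> p) (nhds p)"
  proof -
    have "isCont f p" unfolding f_def t_def using D by (intro continuous_intros) auto
    then have "(f \<longlongrightarrow> f p) (nhds p)" by (simp only: continuous_at tendsto_at_iff_tendsto_nhds)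
    moreover have "f p = p" by (simp add: f_def tp)
    ultimately show ?thesis by (simp only:)
  qed
  have "\<forall>\<^sub>F x in nhds p. t x < 1 \<and> f x \<in> ball p d"
    using order_tendstoD(2)[OF ct, of 1] topological_tendstoD[OF cf, of "ball p d"] d(1) 
    by (auto intro: eventually_conj)
  then obtain e where e: "e > 0" "\<And>x. dist x p < e \<Longrightarrow> t x < 1 \<and> f x \<in> ball p d"
    by (auto simp: eventually_nhds_metric)
  show ?thesis
  proof (rule that[OF e(1)], safe)
    fix x assume x: "x \<in> ball p e" "n \<bullet> p \<le> n \<bullet> x"
    then have t1: "t x < 1" and fx: "f x \<in> ball p d" using e(2)[of x] by (auto simp: dist_commute)
    have t0: "0 \<le> t x" using x D by (simp add: t_def)
    have x_eq: "x = (1 - t x) *\<^sub>R f x + t x *\<^sub>R q" using t1 by (simp add: f_def)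
    have tD: "t x * D = n \<bullet> x - n \<bullet> p" using D by (simp add: t_def)
    have "(1 - t x) * (n \<bullet> f x) = n \<bullet> x - t x * (n \<bullet> q)" using t1 by (simp add: f_def inner_simps)
    also have "\<dots> = (1 - t x) * (n \<bullet> p)" using tD by (simp add: D_def algebra_simps)
    finally have "f x \<in> affine hull F" using t1 by (simp add: F)
    then have "f x \<in> T" using fx d(2) F(1) by blast
    then have "(1 - t x) *\<^sub>R f x + t x *\<^sub>R q \<in> T"
      using T q(1) t0 t1 by (intro convexD) auto
    then show "x \<in> T" using x_eq by simp
  qed
qed

text \<open>If \<open>T\<close> had points strictly on both sides of the facet, half-balls on both
  sides would make \<open>p\<close> interior to \<open>T\<close>, although a proper face misses the
  interior.\<close>

lemma facet_half_ball:
  fixes T :: "'a::euclidean_space set"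
  assumes T: "convex T" "interior T \<noteq> {}" and F: "F facet_of T" and p: "p \<in> rel_interior F"
  obtains n e where "norm n = 1" "e > 0" "affine hull F = {x. n \<bullet> x = n \<bullet> p}"
    "T \<subseteq> {x. n \<bullet> x \<ge> n \<bullet> p}" "ball p e \<inter> {x. n \<bullet> x \<ge> n \<bullet> p} \<subseteq> T"
proof -
  have aT: "aff_dim T = DIM('a)" using T(2) by (rule aff_dim_nonempty_interior)
  have FT: "F face_of T" "aff_dim F = DIM('a) - 1" using F aT by (auto simp: facet_of_def)
  have FsT: "F \<subseteq> T" using FT(1) by (rule face_of_imp_subset)
  have FnT: "F \<noteq> T" using FT(2) aT by auto
  have pF: "p \<in> F" using p rel_interior_subset by blast
  obtain m b where m: "m \<noteq> 0" "affine hull F = {x. m \<bullet> x = b}"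
    using FT(2) aff_dim_eq_hyperplane[of F] by auto
  have "m \<bullet> p = b" using m(2) hull_inc[OF pF, of affine] by simp
  have "\<not> T \<subseteq> {x. m \<bullet> x = m \<bullet> p}"
    using aff_dim_subset[of T "{x. m \<bullet> x = m \<bullet> p}"] m(1) aT by auto
  then obtain q where q: "q \<in> T" "m \<bullet> q \<noteq> m \<bullet> p" by auto
  define n where "n = (sgn (m \<bullet> q - m \<bullet> p) / norm m) *\<^sub>R m"
  have c0: "sgn (m \<bullet> q - m \<bullet> p) / norm m \<noteq> 0" using q m by (simp add: sgn_eq_0_iff)
  have n1: "norm n = 1" using q m by (simp add: n_def abs_sgn_eq)
  have hull: "affine hull F = {x. n \<bullet> x = n \<bullet> p}" using c0 by (simp add: m(2) \<open>m \<bullet> p = b\<close>[symmetric] n_def)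
  have nq: "n \<bullet> q > n \<bullet> p"
  proof -
    have "n \<bullet> q - n \<bullet> p = (m \<bullet> q - m \<bullet> p) * sgn (m \<bullet> q - m \<bullet> p) / norm m"
      by (simp add: n_def diff_divide_distrib left_diff_distrib mult.commute)
    also have "\<dots> = \<bar>m \<bullet> q - m \<bullet> p\<bar> / norm m" by (simp add: abs_sgn)
    also have "\<dots> > 0" using q m by simp
    finally show ?thesis by simp
  qed
  obtain e where e: "e > 0" "ball p e \<inter> {x. n \<bullet> x \<ge> n \<bullet> p} \<subseteq> T"
    using convex_half_ball_subset[OF T(1) FsT hull p q(1) nq] by metis
  have "T \<subseteq> {x. n \<bullet> x \<ge> n \<bullet> p}"
  proof (rule ccontr)
    assume "\<not> T \<subseteq> {x. n \<bullet> x \<ge> n \<bullet> p}"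
    then obtain q' where q': "q' \<in> T" "(- n) \<bullet> q' > (- n) \<bullet> p" by (auto simp: subset_iff not_le)
    have hull': "affine hull F = {x. (- n) \<bullet> x = (- n) \<bullet> p}" using hull by simp
    obtain e' where e': "e' > 0" "ball p e' \<inter> {x. (- n) \<bullet> x \<ge> (- n) \<bullet> p} \<subseteq> T"
      using convex_half_ball_subset[OF T(1) FsT hull' p q'] by metis
    have "ball p (min e e') \<subseteq> T"
    proof
      fix x assume "x \<in> ball p (min e e')"
      then show "x \<in> T" using e(2) e'(2) by (cases "n \<bullet> x \<ge> n \<bullet> p") auto
    qed
    then have "p \<in> interior T" using e(1) e'(1) by (auto simp: mem_interior intro!: exI[of _ "min e e'"])
    then show False using face_of_disjoint_interior[OF FT(1) FnT] pF by blast
  qed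
  from that[OF n1 e(1) hull this e(2)] show ?thesis .
qed

text \<open>A domain that lies locally above a Lipschitz graph has no slits: just below the graph
  there is an open set that misses it. This guarantees later that a boundary facet has elements on
  one side only.\<close>

lemma interior_closure_lipschitz:
  fixes U :: "'a::euclidean_space set"
  assumes U: "open U" and lip: "lipschitz_boundary U"
  shows "interior (closure U) \<subseteq> U"
proof
  fix p assume p: "p \<in> interior (closure U)"
  show "p \<in> U"
  proof (rule ccontr)
    assume pU: "p \<notin> U"
    then have "p \<in> frontier U" using p interior_subset U by (auto simp: frontier_def interior_open)
    then obtain e \<gamma> L r where e: "norm e = 1" "0 < r" "L-lipschitz_on {y. y \<bullet> e = 0} \<gamma>"
      "U \<inter> ball p r = {x \<in> ball p r. \<gamma> (x - (x \<bullet> e) *\<^sub>R e) < x \<bullet> e}"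
      using lip unfolding lipschitz_boundary_def by blast
    have ee: "e \<bullet> e = 1" using e(1) by (simp add: norm_eq_1)
    define g where "g x = \<gamma> (x - (x \<bullet> e) *\<^sub>R e) - x \<bullet> e" for x
    have cg: "continuous_on UNIV g"
      unfolding g_def
      by (intro continuous_intros continuous_on_compose2[OF lipschitz_on_continuous_on[OF e(3)]])
        (auto simp: inner_diff_left ee)
    have "g p \<ge> 0"
    proof (rule ccontr)
      assume "\<not> g p \<ge> 0"
      then have "p \<in> {x \<in> ball p r. \<gamma> (x - (x \<bullet> e) *\<^sub>R e) < x \<bullet> e}" using e(2) by (simp add: g_def)
      then show False using e(4) pU by blast
    qed
    obtain d where d: "d > 0" "ball p d \<subseteq> closure U" using p by (auto simp: mem_interior)
    define t where "t = min d r / 2"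
    have t: "t > 0" "t < d" "t < r" using d e(2) by (auto simp: t_def)
    \<comment> \<open>Moving against \<open>e\<close> keeps the remaining coordinates, hence the
      value of \<gamma>, and increases \<open>g\<close> by \<open>t\<close>.\<close>
    define x where "x = p - t *\<^sub>R e"
    have xp: "x - (x \<bullet> e) *\<^sub>R e = p - (p \<bullet> e) *\<^sub>R e" by (simp add: x_def inner_simps ee algebra_simps)
    have gx: "g x > 0" using \<open>g p \<ge> 0\<close> t(1) unfolding g_def xp by (simp add: x_def inner_simps ee)
    have "dist p x < d" "dist p x < r" using t e(1) by (auto simp: x_def dist_norm)
    then have "x \<in> closure U" using d by auto
    have "open ({y. g y > 0} \<inter> ball p r)"
      using open_Collect_less[OF continuous_on_const cg] by auto
    moreover have "x \<in> {y. g y > 0} \<inter> ball p r" using gx \<open>dist p x < r\<close> by simp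
    ultimately have "U \<inter> ({y. g y > 0} \<inter> ball p r) \<noteq> {}"
      using \<open>x \<in> closure U\<close> open_Int_closure_eq_empty[of "{y. g y > 0} \<inter> ball p r" U] by blast
    then obtain y where "y \<in> U \<inter> ball p r" "g y > 0" by blast
    then show False unfolding e(4) by (auto simp: g_def)
  qed
qed

lemma conforming_element:
  fixes T :: "'a::euclidean_space set"
  assumes "int DIM('a) simplex T"
  shows "convex T" "compact T" "interior T \<noteq> {}" "closure (interior T) = T" "T \<noteq> {}"
proof -
  show c: "convex T" "compact T" using assms convex_simplex compact_simplex by auto
  have "aff_dim T = DIM('a)" using aff_dim_simplex[OF assms] .
  then have ri: "rel_interior T = interior T" using rel_interior_interior aff_dim_eq_full by blast
  show ne: "T \<noteq> {}" using \<open>aff_dim T = DIM('a)\<close> by auto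
  then show i: "interior T \<noteq> {}" using rel_interior_eq_empty[OF c(1)] ri by simp
  show "closure (interior T) = T" using convex_closure_interior[OF c(1) i] compact_imp_closed[OF c(2)] by simp
qed

text \<open>On the same side of the common facet the two simplices would share an open
  half-ball.\<close>

lemma facets_opposite:
  fixes T T' :: "'a::euclidean_space set"
  assumes T: "convex T" "interior T \<noteq> {}" and T': "convex T'" "interior T' \<noteq> {}"
    and disj: "interior T \<inter> interior T' = {}"
    and F: "F facet_of T" "F facet_of T'" and p: "p \<in> rel_interior F"
  obtains n e where "norm n = 1" "e > 0" "ball p e \<inter> {x. n \<bullet> x \<ge> n \<bullet> p} \<subseteq> T" "ball p e \<inter> {x. n \<bullet> x \<le> n \<bullet> p} \<subseteq> T'"
proof -
  obtain n e where n: "norm n = 1" "e > 0" "affine hull F = {x. n \<bullet> x = n \<bullet> p}" "T \<subseteq> {x. n \<bullet> x \<ge> n \<bullet> p}"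
    and e: "ball p e \<inter> {x. n \<bullet> x \<ge> n \<bullet> p} \<subseteq> T"
    using facet_half_ball[OF T F(1) p] by metis
  have FT': "F \<subseteq> T'" using F(2) by (auto simp: facet_of_def dest: face_of_imp_subset)
  have "\<not> T' \<subseteq> {x. n \<bullet> x \<ge> n \<bullet> p}"
  proof
    assume sub: "T' \<subseteq> {x. n \<bullet> x \<ge> n \<bullet> p}"
    have "n \<noteq> 0" using n(1) by auto
    then have "\<not> T' \<subseteq> {x. n \<bullet> x = n \<bullet> p}"
      using aff_dim_subset[of T' "{x. n \<bullet> x = n \<bullet> p}"] n(1) aff_dim_nonempty_interior[OF T'(2)] by auto
    then obtain q where q: "q \<in> T'" "n \<bullet> q > n \<bullet> p" using sub by force
    obtain e' where e': "e' > 0" "ball p e' \<inter> {x. n \<bullet> x \<ge> n \<bullet> p} \<subseteq> T'"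
      using convex_half_ball_subset[OF T'(1) FT' n(3) p q] by metis
    define d where "d = min e e'"
    have d: "d > 0" using n e' by (simp add: d_def)
    have "open (ball p d \<inter> {x. n \<bullet> x > n \<bullet> p})" by (intro open_Int open_ball open_halfspace_gt)
    moreover have "ball p d \<inter> {x. n \<bullet> x > n \<bullet> p} \<subseteq> T" "ball p d \<inter> {x. n \<bullet> x > n \<bullet> p} \<subseteq> T'"
      using e e'(2) by (auto simp: d_def subset_iff)
    moreover have "n \<bullet> n = 1" using n(1) by (simp add: norm_eq_1)
    then have "p + (d / 2) *\<^sub>R n \<in> ball p d \<inter> {x. n \<bullet> x > n \<bullet> p}"
      using d n(1) by (simp add: dist_norm inner_simps)
    ultimately have "p + (d / 2) *\<^sub>R n \<in> interior T" "p + (d / 2) *\<^sub>R n \<in> interior T'"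
      using interiorI by blast+
    then show False using disj by blast
  qed
  then obtain q where q: "q \<in> T'" "(- n) \<bullet> q > (- n) \<bullet> p" by (auto simp: subset_iff not_le)
  have hull': "affine hull F = {x. (- n) \<bullet> x = (- n) \<bullet> p}" using n(3) by simp
  obtain e' where e': "e' > 0" "ball p e' \<inter> {x. (- n) \<bullet> x \<ge> (- n) \<bullet> p} \<subseteq> T'"
    using convex_half_ball_subset[OF T'(1) FT' hull' p q] by metis
  show ?thesis
    by (rule that[of n "min e e'"]) (use n e e' in \<open>auto simp: subset_iff\<close>)
qed

section \<open>Traces and surface integrals on facets\<close>

lemma elem_trace_affine:
  fixes T :: "'a::euclidean_space set"
  assumes T: "int DIM('a) simplex T" and F: "F facet_of T" and x: "x \<in> F"
    and v: "\<And>x. x \<in> interior T \<Longrightarrow> v x = a \<bullet> x + c"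
  shows "elem_trace T v x = a \<bullet> x + c"
proof -
  have FT: "F face_of T" using F by (simp add: facet_of_def)
  have "F \<noteq> T" using F by auto
  then have xi: "x \<notin> interior T" using face_of_disjoint_interior[OF FT] x by blast
  \<comment> \<open>\<open>Lim\<close> is determined by convergence only for a nontrivial filter, so
    \<open>x\<close> must be a limit point of the interior.\<close>
  have "x \<in> closure (interior T)" using conforming_element[OF T] face_of_imp_subset[OF FT] x by auto
  then have "x islimpt interior T" using xi by (auto simp: closure_def)
  then have nt: "at x within interior T \<noteq> bot" by (simp add: trivial_limit_within)
  have "((\<lambda>x. a \<bullet> x + c) \<longlongrightarrow> a \<bullet> x + c) (at x within interior T)" by (intro tendsto_intros)
  moreover have "\<forall>\<^sub>F y in at x within interior T. a \<bullet> y + c = v y"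
    by (simp add: eventually_at_filter v)
  ultimately have "(v \<longlongrightarrow> a \<bullet> x + c) (at x within interior T)" by (rule Lim_transform_eventually)
  then show ?thesis unfolding elem_trace_def by (rule tendsto_Lim[OF nt])
qed

lemma face_integral_eq_0:
  fixes F T :: "'a::euclidean_space set"
  assumes T: "int DIM('a) simplex T" and F: "F facet_of T" and f: "\<And>x. x \<in> F \<Longrightarrow> f x = 0"
  shows "face_integral F f = 0"
proof -
  have "aff_dim F = DIM('a) - 1" using F aff_dim_simplex[OF T] by (auto simp: facet_of_def)
  then obtain m b where m: "m \<noteq> 0" "affine hull F = {x. m \<bullet> x = b}" using aff_dim_eq_hyperplane[of F] by auto
  have "m \<bullet> x = b" if "x \<in> F" for x using hull_inc[OF that, of affine] m(2) by simp
  then have "norm (m /\<^sub>R norm m) = 1 \<and> (\<forall>x\<in>F. \<forall>y\<in>F. (m /\<^sub>R norm m) \<bullet> (x - y) = 0)"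
    using m(1) by (simp add: inner_simps)
  then have n: "\<forall>x\<in>F. \<forall>y\<in>F. unit_normal F \<bullet> (x - y) = 0"
    unfolding unit_normal_def by (rule someI2) blast
  \<comment> \<open>The nearest point of the hull is the foot of the prism fibre. It lies in
    \<open>F\<close>, where \<open>f\<close> is known to vanish.\<close>
  have cp: "closest_point (affine hull F) (y + t *\<^sub>R unit_normal F) = y" if y: "y \<in> F" for y t
  proof (rule closest_point_unique[symmetric])
    show "convex (affine hull F)" "closed (affine hull F)" "y \<in> affine hull F"
      using y by (auto simp: affine_imp_convex hull_inc)
    show "\<forall>z\<in>affine hull F. dist (y + t *\<^sub>R unit_normal F) y \<le> dist (y + t *\<^sub>R unit_normal F) z"
    proof
      fix z assume z: "z \<in> affine hull F"
      have "affine hull F \<subseteq> {z. unit_normal F \<bullet> z = unit_normal F \<bullet> y}"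
      proof (rule hull_minimal)
        show "F \<subseteq> {z. unit_normal F \<bullet> z = unit_normal F \<bullet> y}"
        proof
          fix x assume "x \<in> F"
          then have "unit_normal F \<bullet> (x - y) = 0" using n y by blast
          then show "x \<in> {z. unit_normal F \<bullet> z = unit_normal F \<bullet> y}" by (simp add: inner_diff_right)
        qed
      qed (rule affine_hyperplane)
      then have "unit_normal F \<bullet> (y - z) = 0" using z by (auto simp: inner_diff_right)
      then have "orthogonal (y - z) (t *\<^sub>R unit_normal F)" by (simp add: orthogonal_def inner_commute)
      from norm_add_Pythagorean[OF this]
      have "(norm (y + t *\<^sub>R unit_normal F - z))\<^sup>2 = (norm (y - z))\<^sup>2 + (norm (t *\<^sub>R unit_normal F))\<^sup>2"
        by (simp add: algebra_simps)
      then have "(norm (t *\<^sub>R unit_normal F))\<^sup>2 \<le> (norm (y + t *\<^sub>R unit_normal F - z))\<^sup>2" by simp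
      then have "norm (t *\<^sub>R unit_normal F) \<le> norm (y + t *\<^sub>R unit_normal F - z)" by (rule power2_le_imp_le) simp
      then show "dist (y + t *\<^sub>R unit_normal F) y \<le> dist (y + t *\<^sub>R unit_normal F) z" by (simp add: dist_norm)
    qed
  qed
  show ?thesis unfolding face_integral_def set_lebesgue_integral_def
    by (rule integral_eq_zero_AE, rule AE_I2) (auto simp: indicator_def cp f)
qed

section \<open>Elementwise affine functions on the mesh\<close>

lemma L2_norm_sq: "(L2_norm U f)\<^sup>2 = (LINT x:U|lebesgue. (norm (f x))\<^sup>2)"
  unfolding L2_norm_def set_lebesgue_integral_def
  by (rule real_sqrt_pow2) (simp add: Bochner_Integration.integral_nonneg)

locale conforming_mesh =
  fixes \<Omega> :: "'a::euclidean_space set" and \<T> :: "'a set set"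
  assumes domain: "polyhedral_lipschitz_domain \<Omega>" and mesh: "conforming_triangulation \<Omega> \<T>"
begin

lemma open_domain: "open \<Omega>" using domain by (simp add: polyhedral_lipschitz_domain_def)

lemma finite_mesh: "finite \<T>"
  using mesh by (simp add: conforming_triangulation_def triangulation_def)

lemma simplex_elem: "T \<in> \<T> \<Longrightarrow> int DIM('a) simplex T"
  using mesh by (simp add: conforming_triangulation_def)

lemma Union_mesh: "\<Union>\<T> = closure \<Omega>"
  using mesh by (simp add: conforming_triangulation_def)

lemma face_inter: "T \<in> \<T> \<Longrightarrow> T' \<in> \<T> \<Longrightarrow> T \<inter> T' face_of T"
  using mesh by (simp add: conforming_triangulation_def triangulation_def)

lemmas elem = conforming_element[OF simplex_elem]

lemma interior_closure_domain: "interior (closure \<Omega>) \<subseteq> \<Omega>"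
  using domain by (intro interior_closure_lipschitz) (auto simp: polyhedral_lipschitz_domain_def)

lemma interior_elem_subset: "T \<in> \<T> \<Longrightarrow> interior T \<subseteq> \<Omega>"
  using interior_mono[of T "closure \<Omega>"] interior_closure_domain Union_mesh by blast

text \<open>If the interiors met, the common face would contain an interior point of each simplex
  and so equal both.\<close>

lemma interior_disjoint:
  assumes T: "T \<in> \<T>" "T' \<in> \<T>" "T \<noteq> T'"
  shows "interior T \<inter> interior T' = {}"
proof (rule ccontr)
  assume "interior T \<inter> interior T' \<noteq> {}"
  then obtain x where x: "x \<in> interior T" "x \<in> interior T'" by blast
  then have xT: "x \<in> T \<inter> T'" using interior_subset by blast
  have "T \<inter> T' = T" using face_of_disjoint_interior[OF face_inter[OF T(1,2)]] x xT by blast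
  moreover have "T' \<inter> T = T'" using face_of_disjoint_interior[OF face_inter[OF T(2,1)]] x xT by blast
  ultimately show False using T(3) by blast
qed

lemma AE_not_frontier: "AE x in lebesgue. \<forall>T\<in>\<T>. x \<notin> frontier T"
  unfolding AE_ball_countable[OF countable_finite[OF finite_mesh]]
proof
  fix T assume "T \<in> \<T>"
  then have "negligible (frontier T)" by (intro negligible_convex_frontier elem)
  then show "AE x in lebesgue. x \<notin> frontier T"
    unfolding negligible_iff_null_sets by (rule AE_not_in)
qed

text \<open>Off the null skeleton each point of \<Omega> lies in exactly one element, and in its
  interior. Continuity of \<open>h T\<close> supplies integrability over each compact
  element.\<close>

lemma integral_elementwise:
  fixes f :: "'a \<Rightarrow> real"
  assumes f: "\<And>T. T \<in> \<T> \<Longrightarrow> AE x in lebesgue. x \<in> interior T \<longrightarrow> f x = h T x"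
    and h: "\<And>T. T \<in> \<T> \<Longrightarrow> continuous_on UNIV (h T)"
  shows "(LINT x:\<Omega>|lebesgue. f x) = (\<Sum>T\<in>\<T>. LINT x:T|lebesgue. h T x)"
proof -
  have "AE x in lebesgue. \<forall>T\<in>\<T>. x \<in> interior T \<longrightarrow> f x = h T x"
    unfolding AE_ball_countable[OF countable_finite[OF finite_mesh]] using f by blast
  with AE_not_frontier
  have "AE x in lebesgue. indicat_real \<Omega> x *\<^sub>R f x = (\<Sum>T\<in>\<T>. indicat_real T x *\<^sub>R h T x)"
  proof eventually_elim
    case (elim x)
    have int: "x \<in> interior T" if "T \<in> \<T>" "x \<in> T" for T
      using elim(1) that closure_subset by (auto simp: frontier_def)
    show ?case
    proof (cases "x \<in> \<Omega>")
      case True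
      then obtain T where T: "T \<in> \<T>" "x \<in> T" using closure_subset Union_mesh by blast
      have "(\<Sum>S\<in>\<T>. indicat_real S x *\<^sub>R h S x) = (\<Sum>S\<in>\<T>. if S = T then h T x else 0)"
      proof (rule sum.cong[OF refl])
        fix S assume S: "S \<in> \<T>"
        have "x \<notin> S" if "S \<noteq> T"
          using interior_disjoint[OF S T(1) that] int[OF S] int[OF T] by blast
        then show "indicat_real S x *\<^sub>R h S x = (if S = T then h T x else 0)" using T by (auto simp: indicator_def)
      qed
      also have "\<dots> = h T x" using T finite_mesh by simp
      also have "\<dots> = f x" using elim(2) T(1) int[OF T] by simp
      finally show ?thesis using True by simp
    next
      case False
      then have "x \<notin> T" if "T \<in> \<T>" for T using int[OF that] interior_elem_subset[OF that] by blast
      then show ?thesis using False by (simp add: indicator_def)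
    qed
  qed
  from lebesgue_integral_cong_AE'(1)[OF this]
  have "(LINT x:\<Omega>|lebesgue. f x) = (LINT x|lebesgue. (\<Sum>T\<in>\<T>. indicat_real T x *\<^sub>R h T x))"
    by (simp add: set_lebesgue_integral_def)
  also have "\<dots> = (\<Sum>T\<in>\<T>. (LINT x|lebesgue. indicat_real T x *\<^sub>R h T x))"
    using set_integrable_continuous[OF elem(2) h]
    by (intro Bochner_Integration.integral_sum) (auto simp: set_integrable_def)
  finally show ?thesis by (simp add: set_lebesgue_integral_def)
qed

text \<open>Slopes and offsets of all elements are named at once; the slopes are the elementwise
  gradients, in terms of which the norms below are computed.\<close>

definition affine_pieces :: "('a \<Rightarrow> real) \<Rightarrow> ('a set \<Rightarrow> 'a) \<Rightarrow> ('a set \<Rightarrow> real) \<Rightarrow> bool"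
  where "affine_pieces v a c \<longleftrightarrow> (\<forall>T\<in>\<T>. \<forall>x\<in>interior T. v x = a T \<bullet> x + c T)"

lemma piecewise_affineE:
  assumes "v \<in> piecewise_affine \<T>"
  obtains a c where "affine_pieces v a c"
proof -
  have "\<forall>T\<in>\<T>. \<exists>ac. \<forall>x\<in>interior T. v x = fst ac \<bullet> x + snd ac"
    using assms by (auto simp: piecewise_affine_def)
  then obtain ac where "\<forall>T\<in>\<T>. \<forall>x\<in>interior T. v x = fst (ac T) \<bullet> x + snd (ac T)" by metis
  then show ?thesis by (intro that[of "fst \<circ> ac" "snd \<circ> ac"]) (simp add: affine_pieces_def)
qed

lemma has_weak_grad_elem:
  assumes "affine_pieces v a c" "T \<in> \<T>"
  shows "has_weak_grad (interior T) v (\<lambda>_. a T)"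
  by (rule has_weak_grad_cong[OF has_weak_grad_affine[of _ "a T" "c T"]], rule AE_I2)
    (use assms in \<open>auto simp: affine_pieces_def\<close>)

lemma broken_grad_AE:
  assumes v: "affine_pieces v a c" and T: "T \<in> \<T>"
  shows "AE x in lebesgue. x \<in> interior T \<longrightarrow> broken_grad \<T> v x = a T"
  using weak_grad_AE[OF open_interior has_weak_grad_elem[OF v T]]
proof eventually_elim
  case (elim x)
  show ?case
  proof
    assume x: "x \<in> interior T"
    have "broken_grad \<T> v x = (\<Sum>S\<in>\<T>. if S = T then weak_grad (interior T) v x else 0)"
      unfolding broken_grad_def
      by (rule sum.cong[OF refl]) (use x interior_disjoint[OF _ T] in \<open>auto simp: indicator_def\<close>)
    also have "\<dots> = a T" using elim x T finite_mesh by simp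
    finally show "broken_grad \<T> v x = a T" .
  qed
qed

lemma has_weak_grad_H1:
  assumes "z \<in> sobolev_H1 \<Omega>" shows "has_weak_grad \<Omega> z (weak_grad \<Omega> z)"
proof -
  obtain G where "has_weak_grad \<Omega> z G" using assms by (auto simp: sobolev_H1_def)
  then show ?thesis unfolding weak_grad_def by (rule someI[of "has_weak_grad \<Omega> z"])
qed

text \<open>A weak gradient on \<Omega> is one on every element interior, where uniqueness compares
  it with the slope.\<close>

lemma weak_grad_elem_AE:
  assumes z: "z \<in> sobolev_H1 \<Omega>" "affine_pieces z a c" and T: "T \<in> \<T>"
  shows "AE x in lebesgue. x \<in> interior T \<longrightarrow> weak_grad \<Omega> z x = a T"
  by (rule has_weak_grad_unique[OF open_interior has_weak_grad_subset[OF has_weak_grad_H1[OF z(1)] interior_elem_subset[OF T]]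
      has_weak_grad_elem[OF z(2) T]])

lemma opposite_half_balls:
  assumes T: "T \<in> \<T>" "T' \<in> \<T>" "T \<noteq> T'" and F: "F facet_of T" "F facet_of T'" and p: "p \<in> rel_interior F"
  obtains n e where "norm n = 1" "e > 0" "ball p e \<inter> {x. n \<bullet> x \<ge> n \<bullet> p} \<subseteq> T" "ball p e \<inter> {x. n \<bullet> x \<le> n \<bullet> p} \<subseteq> T'"
  by (rule facets_opposite[OF elem(1,3)[OF T(1)] elem(1,3)[OF T(2)] interior_disjoint[OF T] F p])

text \<open>A second element through \<open>p\<close> would meet \<open>T\<close> in a proper face
  containing \<open>F\<close>, hence in \<open>F\<close> itself by dimension. The two half-balls at
  \<open>p\<close> would then fill a ball and put \<open>p\<close> into the interior of the closure
  of \<Omega>, that is into \<Omega> and not on its frontier.\<close>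

lemma boundary_facet_unique:
  assumes T: "T \<in> \<T>" and F: "F facet_of T" "F \<subseteq> frontier \<Omega>" and p: "p \<in> rel_interior F"
    and S: "S \<in> \<T>" "p \<in> S"
  shows "S = T"
proof (rule ccontr)
  assume ST: "S \<noteq> T"
  have pF: "p \<in> F" using p rel_interior_subset by blast
  have dim: "aff_dim T = DIM('a)" "aff_dim S = DIM('a)" using aff_dim_simplex simplex_elem T S by blast+
  have FT: "F face_of T" "aff_dim F = DIM('a) - 1" "F \<noteq> {}" using F dim by (auto simp: facet_of_def)
  have I: "T \<inter> S face_of T" "T \<inter> S face_of S" using face_inter[OF T S(1)] face_inter[OF S(1) T] by (auto simp: Int_commute)
  have FI: "F \<subseteq> T \<inter> S"
    by (rule subset_of_face_of[OF I(1) face_of_imp_subset[OF FT(1)]]) (use p pF S face_of_imp_subset[OF FT(1)] in auto)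
  have "T \<inter> S \<noteq> T"
  proof
    assume "T \<inter> S = T"
    then have "T face_of S" using I(2) by simp
    then show False using face_of_aff_dim_lt[OF elem(1)[OF S(1)], of T] ST dim by auto
  qed
  then have "aff_dim (T \<inter> S) < DIM('a)" using face_of_aff_dim_lt[OF elem(1)[OF T] I(1)] dim by simp
  moreover have FfI: "F face_of T \<inter> S" by (rule face_of_subset[OF FT(1) FI]) simp
  moreover have "convex (T \<inter> S)" using elem(1)[OF T] elem(1)[OF S(1)] by (rule convex_Int)
  ultimately have "F = T \<inter> S" using face_of_aff_dim_lt[of "T \<inter> S" F] FT(2) by force
  then have "F facet_of S" using I(2) FT dim by (simp add: facet_of_def)
  then obtain n e where "norm n = 1" "e > 0" "ball p e \<inter> {x. n \<bullet> x \<ge> n \<bullet> p} \<subseteq> T" "ball p e \<inter> {x. n \<bullet> x \<le> n \<bullet> p} \<subseteq> S"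
    using opposite_half_balls[OF T S(1) ST[symmetric] F(1) _ p] by metis
  moreover have "ball p e \<subseteq> (ball p e \<inter> {x. n \<bullet> x \<ge> n \<bullet> p}) \<union> (ball p e \<inter> {x. n \<bullet> x \<le> n \<bullet> p})" by auto
  ultimately have "ball p e \<subseteq> closure \<Omega>" "e > 0" using T S(1) Union_mesh by blast+
  then have "p \<in> interior (closure \<Omega>)" by (auto simp: mem_interior)
  then have "p \<in> \<Omega>" using interior_closure_domain by blast
  moreover have "p \<in> frontier \<Omega>" using pF F(2) by blast
  ultimately show False using open_domain by (simp add: frontier_def interior_open)
qed

text \<open>The half-balls are available at relative interior points of a facet; density and
  continuity extend the equality to the whole facet.\<close>

lemma closed_affine_eq:
  fixes F :: "'a set"
  assumes F: "convex F" and eq: "\<And>p. p \<in> rel_interior F \<Longrightarrow> a \<bullet> p + c = a' \<bullet> p + c'" and x: "x \<in> F"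
  shows "a \<bullet> x + c = a' \<bullet> x + c'"
proof -
  have "closed {x. a \<bullet> x + c = a' \<bullet> x + c'}" by (intro closed_Collect_eq continuous_intros)
  then have "closure (rel_interior F) \<subseteq> {x. a \<bullet> x + c = a' \<bullet> x + c'}"
    by (intro closure_minimal) (auto simp: eq)
  moreover have "x \<in> closure (rel_interior F)" using convex_closure_rel_interior[OF F] closure_subset x by blast
  ultimately show ?thesis by blast
qed

section \<open>Conforming functions do not jump across facets\<close>

context
  fixes z a c
  assumes z: "z \<in> sobolev_H10 \<Omega>" and ac: "affine_pieces z a c"
begin

definition "Z x = indicat_real \<Omega> x * z x"
definition "\<Gamma> x = indicat_real \<Omega> x *\<^sub>R weak_grad \<Omega> z x"

lemma H1: "z \<in> sobolev_H1 \<Omega>" using z by (simp add: sobolev_H10_def)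

lemma weak_grad_ext: "has_weak_grad UNIV Z \<Gamma>"
  unfolding Z_def[abs_def] \<Gamma>_def[abs_def]
  by (rule sobolev_H10_zero_extension[OF open_domain z has_weak_grad_H1[OF H1]])

lemma ext_elem_AE:
  assumes T: "T \<in> \<T>"
  shows "AE x in lebesgue. x \<in> interior T \<longrightarrow> Z x = a T \<bullet> x + c T \<and> \<Gamma> x = a T"
  using weak_grad_elem_AE[OF H1 ac T]
  by eventually_elim (use interior_elem_subset[OF T] T ac in \<open>auto simp: Z_def \<Gamma>_def affine_pieces_def\<close>)

lemma half_ball_elem_AE:
  assumes T: "T \<in> \<T>" and sub: "ball p e \<inter> {x. n \<bullet> x \<ge> n \<bullet> p} \<subseteq> T"
  shows "AE x in lebesgue. x \<in> ball p e \<and> n \<bullet> x > n \<bullet> p \<longrightarrow> Z x = a T \<bullet> x + c T \<and> \<Gamma> x = a T"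
proof -
  have "ball p e \<inter> {x. n \<bullet> x > n \<bullet> p} \<subseteq> interior T"
    by (rule interior_maximal) (use sub in \<open>auto simp: open_halfspace_gt\<close>)
  note half = this
  show ?thesis using ext_elem_AE[OF T] by eventually_elim (use half in blast)
qed

lemma conforming_interior_facet:
  assumes T: "T \<in> \<T>" "T' \<in> \<T>" "T \<noteq> T'" and F: "F facet_of T" "F facet_of T'" and x: "x \<in> F"
  shows "a T \<bullet> x + c T = a T' \<bullet> x + c T'"
proof (rule closed_affine_eq[OF _ _ x])
  show "convex F" using F(1) by (auto simp: facet_of_def dest: face_of_imp_convex)
  fix p assume p: "p \<in> rel_interior F"
  obtain n e where n: "norm n = 1" "e > 0" and e: "ball p e \<inter> {x. n \<bullet> x \<ge> n \<bullet> p} \<subseteq> T" "ball p e \<inter> {x. n \<bullet> x \<le> n \<bullet> p} \<subseteq> T'"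
    using opposite_half_balls[OF T F p] by metis
  \<comment> \<open>Reversing the normal lets the statement about the positive side serve for
    \<open>T'\<close>.\<close>
  have e': "ball p e \<inter> {x. (- n) \<bullet> x \<ge> (- n) \<bullet> p} \<subseteq> T'" using e(2) by simp
  have neg: "AE x in lebesgue. x \<in> ball p e \<and> n \<bullet> x < n \<bullet> p \<longrightarrow> Z x = a T' \<bullet> x + c T' \<and> \<Gamma> x = a T'"
    using half_ball_elem_AE[OF T(2) e'] by simp
  show "a T \<bullet> p + c T = a T' \<bullet> p + c T'"
    by (rule weak_grad_no_jump[OF n has_weak_grad_subset[OF weak_grad_ext subset_UNIV] half_ball_elem_AE[OF T(1) e(1)] neg])
qed

text \<open>The exterior is treated as an element that carries the affine function 0.\<close>

lemma conforming_boundary_facet: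
  assumes T: "T \<in> \<T>" and F: "F facet_of T" "F \<subseteq> frontier \<Omega>" and x: "x \<in> F"
  shows "a T \<bullet> x + c T = 0"
proof -
  have "a T \<bullet> x + c T = 0 \<bullet> x + 0"
  proof (rule closed_affine_eq[OF _ _ x])
    show "convex F" using F(1) by (auto simp: facet_of_def dest: face_of_imp_convex)
    fix p assume p: "p \<in> rel_interior F"
    obtain n e where n: "norm n = 1" "e > 0" and Tn: "T \<subseteq> {x. n \<bullet> x \<ge> n \<bullet> p}" and e: "ball p e \<inter> {x. n \<bullet> x \<ge> n \<bullet> p} \<subseteq> T"
      using facet_half_ball[OF elem(1,3)[OF T] F(1) p] by metis
    \<comment> \<open>The other elements form a closed set that misses \<open>p\<close>, so near
      \<open>p\<close> the domain meets only \<open>T\<close>, which lies on the positive side;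
      beyond the hyperplane there is only exterior.\<close>
    have "closed (\<Union>(\<T> - {T}))" using finite_mesh elem(2) by (intro closed_Union) (auto intro: compact_imp_closed)
    moreover have "p \<notin> \<Union>(\<T> - {T})" using boundary_facet_unique[OF T F p] by blast
    ultimately obtain d where d: "d > 0" "ball p d \<subseteq> - \<Union>(\<T> - {T})"
      using openE[of "- \<Union>(\<T> - {T})" p] by (metis ComplI open_Compl)
    define r where "r = min d e"
    have r: "r > 0" using d n by (simp add: r_def)
    have "x \<notin> \<Omega>" if "x \<in> ball p r" "n \<bullet> x < n \<bullet> p" for x
    proof
      assume "x \<in> \<Omega>"
      then obtain S where "S \<in> \<T>" "x \<in> S" using closure_subset Union_mesh by blast
      moreover have "x \<in> ball p d" using that by (simp add: r_def)
      ultimately have "x \<in> T" using d(2) by blast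
      then show False using Tn that(2) by auto
    qed
    then have neg: "AE x in lebesgue. x \<in> ball p r \<and> n \<bullet> x < n \<bullet> p \<longrightarrow> Z x = 0 \<bullet> x + 0 \<and> \<Gamma> x = 0"
      by (intro AE_I2) (auto simp: Z_def \<Gamma>_def)
    have "ball p r \<inter> {x. n \<bullet> x \<ge> n \<bullet> p} \<subseteq> T" using e by (auto simp: r_def)
    note pos = half_ball_elem_AE[OF T this]
    show "a T \<bullet> p + c T = 0 \<bullet> p + 0"
      by (rule weak_grad_no_jump[OF n(1) r has_weak_grad_subset[OF weak_grad_ext subset_UNIV] pos neg])
  qed
  then show ?thesis by simp
qed

text \<open>The one-sided values agree pointwise on facets, which is stronger than the vanishing of
  the integrated jumps.\<close>

lemma conforming_mem_CR: "z \<in> CR_space \<Omega> \<T>"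
proof -
  have tr: "elem_trace T z x = a T \<bullet> x + c T" if "T \<in> \<T>" "F facet_of T" "x \<in> F" for T F x
    by (rule elem_trace_affine[OF simplex_elem[OF that(1)] that(2,3)])
      (use ac that(1) in \<open>auto simp: affine_pieces_def\<close>)
  have "z \<in> piecewise_affine \<T>" using ac by (auto simp: piecewise_affine_def affine_pieces_def)
  moreover have "face_integral F (\<lambda>x. elem_trace T z x - elem_trace T' z x) = 0"
    if "T \<in> \<T>" "T' \<in> \<T>" "T \<noteq> T'" "F facet_of T" "F facet_of T'" for T T' F
    by (rule face_integral_eq_0[OF simplex_elem[OF that(1)] that(4)])
      (simp add: tr[OF that(1,4)] tr[OF that(2,5)] conforming_interior_facet[OF that])
  moreover have "face_integral F (elem_trace T z) = 0" if "T \<in> \<T>" "F facet_of T" "F \<subseteq> frontier \<Omega>" for T F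
    by (rule face_integral_eq_0[OF simplex_elem[OF that(1)] that(2)])
      (simp add: tr[OF that(1,2)] conforming_boundary_facet[OF that])
  ultimately show ?thesis by (auto simp: CR_space_def)
qed

end

lemma conforming_subset_CR: "conforming_space \<Omega> \<T> \<subseteq> CR_space \<Omega> \<T>"
proof
  fix z assume "z \<in> conforming_space \<Omega> \<T>"
  then have z: "z \<in> sobolev_H10 \<Omega>" "z \<in> piecewise_affine \<T>" by (auto simp: conforming_space_def)
  obtain a c where "affine_pieces z a c" using z(2) by (rule piecewise_affineE)
  then show "z \<in> CR_space \<Omega> \<T>" by (rule conforming_mem_CR[OF z(1)])
qed

section \<open>Elementwise sums and the two identities\<close>

lemma L2_norm_sq_piecewise_constant:
  assumes "\<And>T. T \<in> \<T> \<Longrightarrow> AE x in lebesgue. x \<in> interior T \<longrightarrow> f x = b T"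
  shows "(L2_norm \<Omega> f)\<^sup>2 = (\<Sum>T\<in>\<T>. (norm (b T))\<^sup>2 * measure lebesgue T)"
proof -
  have "(L2_norm \<Omega> f)\<^sup>2 = (\<Sum>T\<in>\<T>. LINT x:T|lebesgue. (norm (b T))\<^sup>2)"
    unfolding L2_norm_sq
  proof (rule integral_elementwise)
    fix T assume "T \<in> \<T>"
    from assms[OF this] show "AE x in lebesgue. x \<in> interior T \<longrightarrow> (norm (f x))\<^sup>2 = (norm (b T))\<^sup>2"
      by eventually_elim simp
  qed auto
  also have "\<dots> = (\<Sum>T\<in>\<T>. (norm (b T))\<^sup>2 * measure lebesgue T)"
    by (simp add: set_lebesgue_integral_def mult.commute)
  finally show ?thesis .
qed

lemma L2_inner_piecewise_constant:
  assumes "\<And>T. T \<in> \<T> \<Longrightarrow> AE x in lebesgue. x \<in> interior T \<longrightarrow> f x = b T"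
    "\<And>T. T \<in> \<T> \<Longrightarrow> AE x in lebesgue. x \<in> interior T \<longrightarrow> g x = b' T"
  shows "L2_inner \<Omega> f g = (\<Sum>T\<in>\<T>. (b T \<bullet> b' T) * measure lebesgue T)"
proof -
  have "L2_inner \<Omega> f g = (\<Sum>T\<in>\<T>. LINT x:T|lebesgue. b T \<bullet> b' T)"
    unfolding L2_inner_def
  proof (rule integral_elementwise)
    fix T assume "T \<in> \<T>"
    from assms(1)[OF this] assms(2)[OF this]
    show "AE x in lebesgue. x \<in> interior T \<longrightarrow> f x \<bullet> g x = b T \<bullet> b' T" by eventually_elim simp
  qed auto
  also have "\<dots> = (\<Sum>T\<in>\<T>. (b T \<bullet> b' T) * measure lebesgue T)"
    by (simp add: set_lebesgue_integral_def mult.commute)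
  finally show ?thesis .
qed

text \<open>The mixed term is a multiple of a first moment about the barycentre, which
  vanishes.\<close>

lemma integral_norm_affine_sq:
  assumes T: "T \<in> \<T>"
  shows "(LINT x:T|lebesgue. (norm (e - k *\<^sub>R (x - barycentre T)))\<^sup>2) = (norm e)\<^sup>2 * measure lebesgue T + k\<^sup>2 * second_moment T"
proof -
  have i: "set_integrable lebesgue T f" if "continuous_on UNIV f" for f :: "'a \<Rightarrow> real"
    using elem(2)[OF T] that by (rule set_integrable_continuous)
  have "(norm (e - k *\<^sub>R (x - barycentre T)))\<^sup>2 = (norm e)\<^sup>2 + k\<^sup>2 * (norm (x - barycentre T))\<^sup>2 - (2 * k) * (e \<bullet> (x - barycentre T))" for x
    by (simp only: power2_norm_eq_inner) (simp add: inner_simps inner_commute power2_eq_square algebra_simps)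
  then have "(LINT x:T|lebesgue. (norm (e - k *\<^sub>R (x - barycentre T)))\<^sup>2) =
    (LINT x:T|lebesgue. (norm e)\<^sup>2 + k\<^sup>2 * (norm (x - barycentre T))\<^sup>2 - (2 * k) * (e \<bullet> (x - barycentre T)))" by (simp only:)
  also have "\<dots> = (LINT x:T|lebesgue. (norm e)\<^sup>2) + k\<^sup>2 * (LINT x:T|lebesgue. (norm (x - barycentre T))\<^sup>2)
    - (2 * k) * (LINT x:T|lebesgue. e \<bullet> (x - barycentre T))"
    by (subst set_integral_diff set_integral_add | intro i continuous_intros | simp)+
  also have "(LINT x:T|lebesgue. e \<bullet> (x - barycentre T)) = 0" by (rule barycentre_moment_zero[OF simplex_elem[OF T]])
  also have "(LINT x:T|lebesgue. (norm e)\<^sup>2) = (norm e)\<^sup>2 * measure lebesgue T" by (simp add: set_lebesgue_integral_def)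
  finally show ?thesis by (simp add: second_moment_def)
qed

lemma flux_identities:
  assumes zc: "is_conforming_solution \<Omega> \<T> g zc" and zCR: "is_CR_solution \<Omega> \<T> g zCR"
  shows "(L2_norm \<Omega> (\<lambda>x. marini_flux \<T> g zCR x - weak_grad \<Omega> zc x))\<^sup>2 =
      (broken_H1_seminorm \<Omega> \<T> (\<lambda>x. zCR x - zc x))\<^sup>2 +
      1 / (real DIM('a))\<^sup>2 * (\<Sum>T\<in>\<T>. second_moment T * \<bar>elem_value g T\<bar>\<^sup>2)"
    and "(broken_H1_seminorm \<Omega> \<T> (\<lambda>x. zCR x - zc x))\<^sup>2 =
      (broken_H1_seminorm \<Omega> \<T> zCR)\<^sup>2 - (H1_seminorm \<Omega> zc)\<^sup>2"
proof -
  have c: "zc \<in> conforming_space \<Omega> \<T>" and CR: "zCR \<in> CR_space \<Omega> \<T>"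
    using zc zCR by (auto simp: is_conforming_solution_def is_CR_solution_def)
  have H1: "zc \<in> sobolev_H1 \<Omega>" using c by (auto simp: conforming_space_def sobolev_H10_def)
  obtain a \<alpha> where a: "affine_pieces zc a \<alpha>" using c piecewise_affineE by (auto simp: conforming_space_def)
  obtain b \<beta> where b: "affine_pieces zCR b \<beta>" using CR piecewise_affineE by (auto simp: CR_space_def)
  have d: "affine_pieces (\<lambda>x. zCR x - zc x) (\<lambda>T. b T - a T) (\<lambda>T. \<beta> T - \<alpha> T)"
    using a b by (auto simp: affine_pieces_def inner_simps)
  have cCR: "zc \<in> CR_space \<Omega> \<T>" using c conforming_subset_CR by blast
  have Bd: "(broken_H1_seminorm \<Omega> \<T> (\<lambda>x. zCR x - zc x))\<^sup>2 = (\<Sum>T\<in>\<T>. (norm (b T - a T))\<^sup>2 * measure lebesgue T)"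
    unfolding broken_H1_seminorm_def by (rule L2_norm_sq_piecewise_constant[OF broken_grad_AE[OF d]])
  have Bb: "(broken_H1_seminorm \<Omega> \<T> zCR)\<^sup>2 = (\<Sum>T\<in>\<T>. (norm (b T))\<^sup>2 * measure lebesgue T)"
    unfolding broken_H1_seminorm_def by (rule L2_norm_sq_piecewise_constant[OF broken_grad_AE[OF b]])
  have Ba: "(H1_seminorm \<Omega> zc)\<^sup>2 = (\<Sum>T\<in>\<T>. (norm (a T))\<^sup>2 * measure lebesgue T)"
    unfolding H1_seminorm_def by (rule L2_norm_sq_piecewise_constant[OF weak_grad_elem_AE[OF H1 a]])
  \<comment> \<open>\<open>zc\<close> is admissible in both discrete equations, so both left-hand
    sides equal the pairing of \<open>g\<close> with \<open>zc\<close>.\<close>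
  have "L2_inner \<Omega> (broken_grad \<T> zCR) (broken_grad \<T> zc) = L2_inner \<Omega> (weak_grad \<Omega> zc) (weak_grad \<Omega> zc)"
    using zc zCR c cCR by (auto simp: is_conforming_solution_def is_CR_solution_def)
  moreover have "L2_inner \<Omega> (broken_grad \<T> zCR) (broken_grad \<T> zc) = (\<Sum>T\<in>\<T>. (b T \<bullet> a T) * measure lebesgue T)"
    by (rule L2_inner_piecewise_constant[OF broken_grad_AE[OF b] broken_grad_AE[OF a]])
  moreover have "L2_inner \<Omega> (weak_grad \<Omega> zc) (weak_grad \<Omega> zc) = (\<Sum>T\<in>\<T>. (a T \<bullet> a T) * measure lebesgue T)"
    by (rule L2_inner_piecewise_constant[OF weak_grad_elem_AE[OF H1 a] weak_grad_elem_AE[OF H1 a]])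
  ultimately have galerkin: "(\<Sum>T\<in>\<T>. (b T \<bullet> a T) * measure lebesgue T) = (\<Sum>T\<in>\<T>. (a T \<bullet> a T) * measure lebesgue T)"
    by (simp only:)
  \<comment> \<open>Galerkin orthogonality turns the mixed term into minus twice the energy of
    \<open>zc\<close>, which leaves that energy with coefficient -1.\<close>
  have "(\<Sum>T\<in>\<T>. (norm (b T - a T))\<^sup>2 * measure lebesgue T) =
    (\<Sum>T\<in>\<T>. (norm (b T))\<^sup>2 * measure lebesgue T - 2 * ((b T \<bullet> a T) * measure lebesgue T) + (a T \<bullet> a T) * measure lebesgue T)"
    by (intro sum.cong refl) (simp add: power2_norm_eq_inner inner_simps inner_commute algebra_simps)
  also have "\<dots> = (\<Sum>T\<in>\<T>. (norm (b T))\<^sup>2 * measure lebesgue T) - (\<Sum>T\<in>\<T>. (a T \<bullet> a T) * measure lebesgue T)"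
    by (simp only: sum.distrib sum_subtractf sum_distrib_left[symmetric] galerkin)
  finally show "(broken_H1_seminorm \<Omega> \<T> (\<lambda>x. zCR x - zc x))\<^sup>2 =
      (broken_H1_seminorm \<Omega> \<T> zCR)\<^sup>2 - (H1_seminorm \<Omega> zc)\<^sup>2"
    unfolding Bd Bb Ba by (simp add: power2_norm_eq_inner)
  define k where "k T = elem_value g T / real DIM('a)" for T
  have "(L2_norm \<Omega> (\<lambda>x. marini_flux \<T> g zCR x - weak_grad \<Omega> zc x))\<^sup>2 =
    (\<Sum>T\<in>\<T>. LINT x:T|lebesgue. (norm ((b T - a T) - k T *\<^sub>R (x - barycentre T)))\<^sup>2)"
    unfolding L2_norm_sq
  proof (rule integral_elementwise)
    fix T assume T: "T \<in> \<T>"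
    show "AE x in lebesgue. x \<in> interior T \<longrightarrow>
      (norm (marini_flux \<T> g zCR x - weak_grad \<Omega> zc x))\<^sup>2 = (norm ((b T - a T) - k T *\<^sub>R (x - barycentre T)))\<^sup>2"
      using broken_grad_AE[OF b T] weak_grad_elem_AE[OF H1 a T]
    proof eventually_elim
      case (elim x)
      show ?case
      proof
        assume x: "x \<in> interior T"
        have "marini_flux \<T> g zCR x = (\<Sum>S\<in>\<T>. if S = T then b T - k T *\<^sub>R (x - barycentre T) else 0)"
          unfolding marini_flux_def
          by (rule sum.cong[OF refl])
            (use x elim interior_disjoint[OF _ T] in \<open>auto simp: indicator_def k_def\<close>)
        then have flux: "marini_flux \<T> g zCR x = b T - k T *\<^sub>R (x - barycentre T)" using T finite_mesh by simp
        have "marini_flux \<T> g zCR x - weak_grad \<Omega> zc x = (b T - a T) - k T *\<^sub>R (x - barycentre T)"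
          using elim x unfolding flux by simp
        then show "(norm (marini_flux \<T> g zCR x - weak_grad \<Omega> zc x))\<^sup>2 = (norm ((b T - a T) - k T *\<^sub>R (x - barycentre T)))\<^sup>2"
          by (simp only:)
      qed
    qed
  qed (intro continuous_intros)
  also have "\<dots> = (\<Sum>T\<in>\<T>. (norm (b T - a T))\<^sup>2 * measure lebesgue T + (k T)\<^sup>2 * second_moment T)"
    by (intro sum.cong refl integral_norm_affine_sq)
  also have "\<dots> = (\<Sum>T\<in>\<T>. (norm (b T - a T))\<^sup>2 * measure lebesgue T) + 1 / (real DIM('a))\<^sup>2 * (\<Sum>T\<in>\<T>. second_moment T * \<bar>elem_value g T\<bar>\<^sup>2)"
    by (simp add: sum.distrib sum_distrib_left k_def power_divide mult.commute)
  finally show "(L2_norm \<Omega> (\<lambda>x. marini_flux \<T> g zCR x - weak_grad \<Omega> zc x))\<^sup>2 =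
      (broken_H1_seminorm \<Omega> \<T> (\<lambda>x. zCR x - zc x))\<^sup>2 +
      1 / (real DIM('a))\<^sup>2 * (\<Sum>T\<in>\<T>. second_moment T * \<bar>elem_value g T\<bar>\<^sup>2)"
    unfolding Bd .
qed

end

theorem proposition3p2:
  fixes \<Omega> :: "'a::euclidean_space set" and \<T> :: "'a set set"
  assumes dim: "DIM('a) \<in> {2, 3}"
    and domain: "polyhedral_lipschitz_domain \<Omega>"
    and mesh: "conforming_triangulation \<Omega> \<T>"
  shows "(\<forall>T\<in>\<T>. \<forall>x :: nat \<Rightarrow> 'a. bij_betw x {1..DIM('a) + 1} (vertices T) \<longrightarrow>
           second_moment T =
             measure lebesgue T / ((real DIM('a) + 1)\<^sup>2 * (real DIM('a) + 2)) *
             (\<Sum>i = 1..DIM('a) + 1. \<Sum>j = i + 1..DIM('a) + 1. (norm (x i - x j))\<^sup>2)) \<and>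
         (\<forall>g \<in> piecewise_constant \<T>. \<forall>zc zCR.
           is_conforming_solution \<Omega> \<T> g zc \<and> is_CR_solution \<Omega> \<T> g zCR \<longrightarrow>
             (L2_norm \<Omega> (\<lambda>x. marini_flux \<T> g zCR x - weak_grad \<Omega> zc x))\<^sup>2 =
               (broken_H1_seminorm \<Omega> \<T> (\<lambda>x. zCR x - zc x))\<^sup>2 +
               1 / (real DIM('a))\<^sup>2 * (\<Sum>T\<in>\<T>. second_moment T * \<bar>elem_value g T\<bar>\<^sup>2) \<and>
             (broken_H1_seminorm \<Omega> \<T> (\<lambda>x. zCR x - zc x))\<^sup>2 =
               (broken_H1_seminorm \<Omega> \<T> zCR)\<^sup>2 - (H1_seminorm \<Omega> zc)\<^sup>2)"
proof -
  interpret conforming_mesh \<Omega> \<T> by unfold_locales (fact domain mesh)+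
  show ?thesis
    by (intro conjI ballI allI impI second_moment_simplex simplex_elem flux_identities) auto
qed

end
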